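(* Let $\sigma:\mathcal A\to\mathcal A^+$ be an aperiodic substitution on a finite alphabet $\mathcal A$ such that $|\sigma^n(a)|\to\infty$ as $n\to\infty$ for all $a\in\mathcal A$. Then there is a one-to-one correspondence $\Phi$ between the set of ergodic $T_\sigma$-invariant probability measures on the space $X_\sigma$ and the set of ergodic $\mathcal R$-invariant probability measures on the path space $X_{B_\sigma}$ of the stationary Bratteli diagram $B_\sigma$ defined by the substitution $\sigma$. The same statement holds for ergodic non-atomic infinite ($\sigma$-finite) invariant measures.
   Context: $\mathcal A^+$ is the set of non-empty words over $\mathcal A$; $\sigma$ extends to $\mathcal A^+$ by concatenation; $|w|$ is the length of $w$. The language $\mathcal L(\sigma)$ is the set of all words which appear as factors of $\sigma^n(a)$, $a\in\mathcal A$, $n\ge1$. $X_\sigma=\{x\in\mathcal A^{\mathbb Z}: x[-n,n]\in\mathcal L(\sigma)\text{ for all }n\}$ and $T_\sigma$ is the left shift on $X_\sigma$. $\sigma$ is aperiodic if $(X_\sigma,T_\sigma)$ has no periodic points. $B_\sigma$ is the stationary diagram read on $\sigma$: $V_0=\{v_0\}$, each $V_n$ ($n\ge1$) is a copy of $\mathcal A$, there is a single edge from $v_0$ to each vertex of $V_1$, and for $n\ge1$ the number of edges from $b\in V_n$ to $a\in V_{n+1}$ is the number of occurrences of the letter $b$ in $\sigma(a)$. $X_{B_\sigma}$ is the set of infinite paths $x=(x_1,x_2,\dots)$ starting at $v_0$ ($x_n$ an edge from level $n-1$ to level $n$, the range of $x_n$ being the source of $x_{n+1}$), with the topology generated by cylinder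 sets. $\mathcal R$ is the tail equivalence relation: $x\,\mathcal R\,y$ iff $x_i=y_i$ for all large $i$. A measure is $\mathcal R$-invariant if it is invariant under the Borel action of any countable group whose orbit equivalence relation is $\mathcal R$; it is ergodic if every $\mathcal R$-saturated Borel set or its complement is null. *)

theory Defs
  imports
    "HOL-Probability.Probability"
    "HOL-Library.Sublist"
    "HOL-Algebra.Group_Action"
begin

section \<open>Substitution systems\<close>

text \<open>The alphabet is a finite type \<open>'a\<close>; a substitution is a map \<open>\<sigma> :: 'a \<Rightarrow> 'a list\<close>
  all of whose values are non-empty words.\<close>

definition substitution :: "('a :: finite \<Rightarrow> 'a list) \<Rightarrow> bool" where
  "substitution \<sigma> \<longleftrightarrow> (\<forall>a. \<sigma> a \<noteq> [])"

definition subst_word :: "('a \<Rightarrow> 'a list) \<Rightarrow> 'a list \<Rightarrow> 'a list" where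
  "subst_word \<sigma> w = concat (map \<sigma> w)"

definition subst_power :: "('a \<Rightarrow> 'a list) \<Rightarrow> nat \<Rightarrow> 'a \<Rightarrow> 'a list" where
  "subst_power \<sigma> n a = (subst_word \<sigma> ^^ n) [a]"

definition language :: "('a \<Rightarrow> 'a list) \<Rightarrow> 'a list set" where
  "language \<sigma> = {w. \<exists>a. \<exists>n\<ge>1. sublist w (subst_power \<sigma> n a)}"

definition subst_shift_space :: "('a \<Rightarrow> 'a list) \<Rightarrow> (int \<Rightarrow> 'a) set" where
  "subst_shift_space \<sigma> = {x. \<forall>n::nat. map x [- int n..int n] \<in> language \<sigma>}"

definition shift :: "(int \<Rightarrow> 'a) \<Rightarrow> int \<Rightarrow> 'a" where
  "shift x = (\<lambda>i. x (i + 1))"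

definition aperiodic :: "('a \<Rightarrow> 'a list) \<Rightarrow> bool" where
  "aperiodic \<sigma> \<longleftrightarrow> \<not> (\<exists>x\<in>subst_shift_space \<sigma>. \<exists>p\<ge>1. (shift ^^ p) x = x)"

definition subst_shift_top :: "('a \<Rightarrow> 'a list) \<Rightarrow> (int \<Rightarrow> 'a) topology" where
  "subst_shift_top \<sigma> =
     subtopology (product_topology (\<lambda>_. discrete_topology UNIV) UNIV) (subst_shift_space \<sigma>)"


section \<open>Bratteli diagrams\<close>

text \<open>\<open>edges B n\<close> is the set of edges from level \<open>n\<close> to level \<open>n + 1\<close>. Labels may be reused on
  different levels: the level is always given by the index \<open>n\<close>. Accordingly a path \<open>x\<close> is
  indexed from \<open>0\<close>, so that \<open>x n\<close> is the edge usually written $x_{n+1}$.\<close>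

record ('v, 'e) bratteli_diagram =
  vertices :: "nat \<Rightarrow> 'v set"
  edges :: "nat \<Rightarrow> 'e set"
  source :: "'e \<Rightarrow> 'v"
  target :: "'e \<Rightarrow> 'v"

definition path_space :: "('v, 'e) bratteli_diagram \<Rightarrow> (nat \<Rightarrow> 'e) set" where
  "path_space B = {x. source B (x 0) \<in> vertices B 0 \<and>
     (\<forall>n. x n \<in> edges B n \<and> target B (x n) = source B (x (Suc n)))}"

definition cylinder :: "('v, 'e) bratteli_diagram \<Rightarrow> 'e list \<Rightarrow> (nat \<Rightarrow> 'e) set" where
  "cylinder B es = {x \<in> path_space B. \<forall>i<length es. x i = es ! i}"

definition path_top :: "('v, 'e) bratteli_diagram \<Rightarrow> (nat \<Rightarrow> 'e) topology" where
  "path_top B = topology_generated_by (range (cylinder B))"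

definition tail_rel :: "('v, 'e) bratteli_diagram \<Rightarrow> ((nat \<Rightarrow> 'e) \<times> (nat \<Rightarrow> 'e)) set" where
  "tail_rel B =
     {(x, y). x \<in> path_space B \<and> y \<in> path_space B \<and> (\<forall>\<^sub>F i in sequentially. x i = y i)}"

text \<open>The stationary diagram read on \<open>\<sigma>\<close>. The vertex \<open>None\<close> is $v_0$, and \<open>Some a\<close> is the copy
  of the letter \<open>a\<close> on the level under consideration. \<open>Top_Edge a\<close> is the edge from $v_0$ to \<open>a\<close>,
  and \<open>Occ_Edge a i\<close> is the edge into \<open>a\<close> given by the occurrence of a letter at
  position \<open>i\<close> of \<open>\<sigma> a\<close>, that letter being its source.\<close>

datatype 'a subst_edge = Top_Edge 'a | Occ_Edge 'a nat

definition subst_diagram :: "('a \<Rightarrow> 'a list) \<Rightarrow> ('a option, 'a subst_edge) bratteli_diagram" where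
  "subst_diagram \<sigma> = \<lparr>
     vertices = (\<lambda>n. if n = 0 then {None} else range Some),
     edges = (\<lambda>n. if n = 0 then range Top_Edge else {Occ_Edge a i | a i. i < length (\<sigma> a)}),
     source = (\<lambda>e. case e of Top_Edge a \<Rightarrow> None | Occ_Edge a i \<Rightarrow> Some (\<sigma> a ! i)),
     target = (\<lambda>e. case e of Top_Edge a \<Rightarrow> Some a | Occ_Edge a i \<Rightarrow> Some a)\<rparr>"

lemma card_edges_subst_diagram:
  assumes "n \<ge> 1"
  shows "card {e \<in> edges (subst_diagram \<sigma>) n.
           source (subst_diagram \<sigma>) e = Some b \<and> target (subst_diagram \<sigma>) e = Some a}
         = count_list (\<sigma> a) b"
proof -
  have "{e \<in> edges (subst_diagram \<sigma>) n.
           source (subst_diagram \<sigma>) e = Some b \<and> target (subst_diagram \<sigma>) e = Some a}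
        = Occ_Edge a ` {i. i < length (\<sigma> a) \<and> b = \<sigma> a ! i}"
    using assms by (auto simp: subst_diagram_def)
  moreover have "inj_on (Occ_Edge a) S" for S
    by (auto simp: inj_on_def)
  ultimately show ?thesis
    by (simp add: card_image count_list_eq_length_filter length_filter_conv_card)
qed


section \<open>Invariant and ergodic measures\<close>

definition borel_of :: "'b topology \<Rightarrow> 'b measure" where
  "borel_of X = sigma (topspace X) {U. openin X U}"

definition borel_measure_on :: "'b topology \<Rightarrow> 'b measure \<Rightarrow> bool" where
  "borel_measure_on X M \<longleftrightarrow> sets M = sets (borel_of X)"

definition shift_invariant :: "(int \<Rightarrow> 'a) measure \<Rightarrow> bool" where
  "shift_invariant M \<longleftrightarrow>
     (\<forall>A\<in>sets M. emeasure M (shift -` A \<inter> space M) = emeasure M A)"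

definition shift_ergodic :: "(int \<Rightarrow> 'a) measure \<Rightarrow> bool" where
  "shift_ergodic M \<longleftrightarrow>
     (\<forall>A\<in>sets M. shift -` A \<inter> space M = A \<longrightarrow> A \<in> null_sets M \<or> space M - A \<in> null_sets M)"

text \<open>Every countable group is isomorphic to one whose carrier is a set of natural numbers, so
  quantifying over all \<open>G :: nat monoid\<close> covers the actions of arbitrary countable groups.\<close>

definition borel_action_generating ::
  "('v, 'e) bratteli_diagram \<Rightarrow> nat monoid \<Rightarrow> (nat \<Rightarrow> (nat \<Rightarrow> 'e) \<Rightarrow> (nat \<Rightarrow> 'e)) \<Rightarrow> bool" where
  "borel_action_generating B G \<phi> \<longleftrightarrow>
     group_action G (path_space B) \<phi> \<and>
     (\<forall>g\<in>carrier G. \<phi> g \<in> borel_of (path_top B) \<rightarrow>\<^sub>M borel_of (path_top B)) \<and>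
     (\<forall>x\<in>path_space B. orbit G \<phi> x = tail_rel B `` {x})"

definition tail_invariant :: "('v, 'e) bratteli_diagram \<Rightarrow> (nat \<Rightarrow> 'e) measure \<Rightarrow> bool" where
  "tail_invariant B M \<longleftrightarrow>
     (\<forall>G \<phi>. borel_action_generating B G \<phi> \<longrightarrow>
        (\<forall>g\<in>carrier G. \<forall>A\<in>sets M. emeasure M (\<phi> g -` A \<inter> space M) = emeasure M A))"

definition tail_ergodic :: "('v, 'e) bratteli_diagram \<Rightarrow> (nat \<Rightarrow> 'e) measure \<Rightarrow> bool" where
  "tail_ergodic B M \<longleftrightarrow>
     (\<forall>A\<in>sets M. tail_rel B `` A \<subseteq> A \<longrightarrow> A \<in> null_sets M \<or> space M - A \<in> null_sets M)"

definition nonatomic :: "'b measure \<Rightarrow> bool" where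
  "nonatomic M \<longleftrightarrow>
     (\<forall>A\<in>sets M. emeasure M A > 0 \<longrightarrow>
        (\<exists>C\<in>sets M. C \<subseteq> A \<and> 0 < emeasure M C \<and> emeasure M C < emeasure M A))"

definition infinite_sigma_finite :: "'b measure \<Rightarrow> bool" where
  "infinite_sigma_finite M \<longleftrightarrow> sigma_finite_measure M \<and> emeasure M (space M) = \<infinity>"

definition shift_ergodic_measures :: "('a \<Rightarrow> 'a list) \<Rightarrow> (int \<Rightarrow> 'a) measure set" where
  "shift_ergodic_measures \<sigma> =
     {M. borel_measure_on (subst_shift_top \<sigma>) M \<and> shift_invariant M \<and> shift_ergodic M}"

definition tail_ergodic_measures :: "('v, 'e) bratteli_diagram \<Rightarrow> (nat \<Rightarrow> 'e) measure set" where
  "tail_ergodic_measures B =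
     {M. borel_measure_on (path_top B) M \<and> tail_invariant B M \<and> tail_ergodic B M}"

end

theory Submission
  imports Defs "HOL-Algebra.Generated_Groups" "HOL-Algebra.Weak_Morphisms"
begin

text \<open>
  Every point \<open>x\<close> of the shift space has a unique desubstitution (recognizability), so iterating it
  assigns to \<open>x\<close> the path \<open>F x\<close> of the ancestors of the letter at the origin. This map turns shift
  orbits into tail classes. It is invertible as soon as the blocks around the origin exhaust the
  integers, which fails only for paths that eventually stay at the left or at the right end of
  their blocks; there are countably many such paths, and countably many such points. Countable sets
  are null for the measures considered, so pushing measures forward along \<open>F\<close> is the required
  bijection. Invariance is transported by cutting an orbit-preserving bijection into countably many
  pieces on each of which it is a power of the shift, or an element of a generating group.

  For recognizability, let a power \<open>\<sigma>\<^sup>n\<close> factor through a set of \<open>r\<close> words, with \<open>r\<close> minimal. Then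
  \<open>\<sigma>\<close> restricted to these words is an elementary morphism. If a point had two parsings by an
  elementary morphism with a common cut, the defect theorem would reduce \<open>r\<close>; without a common cut,
  the overhang of one parsing over the other determines the whole future, again by a defect argument,
  and the point is periodic.
\<close>

section \<open>Defect theorems\<close>

text \<open>Neither injectivity nor primitivity of \<open>\<sigma>\<close> is available, so two
  parsings cannot be compared letter by letter. The remedy is to let the power vary: with
  \<open>r\<close> least over all powers, a factorization of the \<open>\<sigma>\<close>-images of
  the \<open>r\<close> words through fewer words would factor the next power, so
  \<open>\<sigma>\<close> is elementary on these words, and the words themselves serve as letters.
  The defect arguments concern infinite words. In finite form the length that suffices is the total
  length of the images, since every cancellation shortens some image. Uniqueness of desubstitution
  gives continuity of the coding by compactness: a limit of desubstitutions is a desubstitution.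
  Hence \<open>F\<close> is Borel without any explicit window of recognizability. Tail invariance
  quantifies over all generating group actions and would be vacuous if there were none; therefore a
  countable group is constructed. Growth makes tail classes infinite and aperiodicity makes shift
  orbits infinite; this excludes atoms of probability measures, while in the infinite case
  non-atomicity is assumed.\<close>

abbreviation ext :: "('c \<Rightarrow> 'a list) \<Rightarrow> 'c list \<Rightarrow> 'a list" where
  "ext \<gamma> u \<equiv> concat (map \<gamma> u)"

text \<open>The combinatorial rank of \<open>W\<close> is at most \<open>k\<close>. A morphism on
  \<open>C\<close> is elementary when its image set does not have rank at most
  \<open>card C - 1\<close>. Excluding the empty word from \<open>F\<close> lets the words of
  \<open>F\<close> be used as blocks of a parsing.\<close>

definition factorization_rank_le :: "'a list set \<Rightarrow> nat \<Rightarrow> bool" where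
  "factorization_rank_le W k \<longleftrightarrow> (\<exists>F. finite F \<and> card F \<le> k \<and> [] \<notin> F \<and> W \<subseteq> concat ` lists F)"

lemma factorization_rank_leI:
  "finite F \<Longrightarrow> card F \<le> k \<Longrightarrow> [] \<notin> F \<Longrightarrow> W \<subseteq> concat ` lists F \<Longrightarrow> factorization_rank_le W k"
  unfolding factorization_rank_le_def by blast

lemma concat_lists_append:
  assumes "u \<in> concat ` lists F" "v \<in> concat ` lists F"
  shows "u @ v \<in> concat ` lists F"
proof -
  obtain a b where "u = concat a" "v = concat b" "a \<in> lists F" "b \<in> lists F"
    using assms by auto
  then have "u @ v = concat (a @ b)" "a @ b \<in> lists F" by auto
  then show ?thesis by blast
qed

lemma ext_in_concat_lists:
  "(\<And>c. c \<in> set u \<Longrightarrow> \<gamma> c \<in> concat ` lists F) \<Longrightarrow> ext \<gamma> u \<in> concat ` lists F"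
proof (induction u)
  case Nil
  show ?case using image_eqI[of "[]" concat "[]" "lists F"] by simp
next
  case (Cons a u)
  then have "\<gamma> a @ ext \<gamma> u \<in> concat ` lists F"
    by (intro concat_lists_append) auto
  then show ?case by simp
qed

lemma subset_concat_lists: "F \<subseteq> concat ` lists F"
proof
  fix f assume "f \<in> F"
  then have "f = concat [f]" "[f] \<in> lists F" by auto
  then show "f \<in> concat ` lists F" by blast
qed

text \<open>Reversal turns suffixes into prefixes, so that the leftward comparison of parsings can
  reuse the defect theorem for prefixes.\<close>

lemma factorization_rank_le_rev:
  assumes "factorization_rank_le (rev ` W) k"
  shows "factorization_rank_le W k"
proof -
  obtain F where F: "finite F" "card F \<le> k" "[] \<notin> F" "rev ` W \<subseteq> concat ` lists F"
    using assms unfolding factorization_rank_le_def by auto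
  show ?thesis
  proof (rule factorization_rank_leI[of "rev ` F"])
    show "card (rev ` F) \<le> k" using F(2) card_image_le[OF F(1), of rev] by linarith
    show "W \<subseteq> concat ` lists (rev ` F)"
    proof
      fix w assume "w \<in> W"
      then obtain fs where fs: "fs \<in> lists F" "rev w = concat fs" using F(4) by blast
      then have "w = concat (rev (map rev fs))"
        by (metis rev_concat rev_map rev_rev_ident)
      moreover have "rev (map rev fs) \<in> lists (rev ` F)" using fs(1) by (auto simp: in_lists_conv_set)
      ultimately show "w \<in> concat ` lists (rev ` F)" by blast
    qed
  qed (use F in auto)
qed

text \<open>These pairs are the edges of the graph in the graph lemma of combinatorics on words. Finite words
  of length at least \<open>n\<close> replace the infinite words of that lemma.\<close>

definition clash :: "('c \<Rightarrow> 'a list) \<Rightarrow> 'c set \<Rightarrow> nat \<Rightarrow> 'c \<Rightarrow> 'c \<Rightarrow> bool" where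
  "clash \<gamma> D n c d \<longleftrightarrow> c \<in> D \<and> d \<in> D \<and> c \<noteq> d \<and>
     (\<exists>u v w. set u \<subseteq> D \<and> set v \<subseteq> D \<and> n \<le> length u \<and> n \<le> length v \<and>
        prefix (ext \<gamma> (c # u)) w \<and> prefix (ext \<gamma> (d # v)) w)"

lemma clash_sym: "clash \<gamma> D n c d \<Longrightarrow> clash \<gamma> D n d c"
  unfolding clash_def by blast

lemma clash_mono: "clash \<gamma> D n c d \<Longrightarrow> m \<le> n \<Longrightarrow> clash \<gamma> D m c d"
  unfolding clash_def by (meson order_trans)

lemma clash_prefix: "clash \<gamma> D n c d \<Longrightarrow> prefix (\<gamma> c) (\<gamma> d) \<or> prefix (\<gamma> d) (\<gamma> c)"
  unfolding clash_def using prefix_same_cases append_prefixD by (metis concat.simps(2) list.map(2))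

text \<open>A Nielsen step: \<open>d\<close> is recoded as \<open>c d\<close> and keeps only the
  remainder \<open>w\<close> as image. In recoded words every \<open>d\<close> is preceded by
  \<open>c\<close>, so none of them starts with \<open>d\<close>.\<close>

lemma ext_split_letter:
  assumes "\<gamma> d = \<gamma> c @ w" "c \<noteq> d"
  shows "ext (\<gamma>(d := w)) (ext (\<lambda>x. if x = d then [c, d] else [x]) u) = ext \<gamma> u"
  using assms by (induction u) auto

text \<open>After cancelling \<open>\<gamma> c\<close> on both sides, one word starts with
  \<open>d\<close> and the other with the first letter of the recoded \<open>u\<close>, which is
  never \<open>d\<close>. That letter leaves the tail, hence the loss of one in
  \<open>n\<close>.\<close>

lemma clash_split_same:
  assumes "clash \<gamma> D (Suc n) c d" "\<gamma> d = \<gamma> c @ w"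
  shows "\<exists>x. x \<noteq> d \<and> clash (\<gamma>(d := w)) D n x d"
proof -
  let ?\<alpha> = "\<lambda>x. if x = d then [c, d] else [x]"
  let ?\<gamma> = "\<gamma>(d := w)"
  obtain u v z where cd: "c \<in> D" "d \<in> D" "c \<noteq> d" and uv: "set u \<subseteq> D" "set v \<subseteq> D"
    "Suc n \<le> length u" "Suc n \<le> length v"
    and z: "prefix (ext \<gamma> (c # u)) z" "prefix (ext \<gamma> (d # v)) z"
    using assms(1) unfolding clash_def by blast
  obtain a u' where u: "u = a # u'" using uv(3) by (cases u) auto
  define x where "x = (if a = d then c else a)"
  define u'' where "u'' = (if a = d then [d] else []) @ ext ?\<alpha> u'"
  have xu: "ext ?\<alpha> u = x # u''" by (simp add: u x_def u''_def)
  obtain z' where z': "z = \<gamma> c @ z'" using z(1) unfolding prefix_def by auto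
  have len: "length s \<le> length (ext ?\<alpha> s)" for s by (induction s) auto
  have sub: "set (ext ?\<alpha> s) \<subseteq> D" if "set s \<subseteq> D" for s using that cd by (induction s) auto
  have "x \<noteq> d" using cd by (simp add: x_def)
  moreover have "clash ?\<gamma> D n x d"
    unfolding clash_def
  proof (intro conjI exI)
    show "x \<in> D" using uv(1) u cd by (simp add: x_def)
    show "d \<in> D" by fact
    show "x \<noteq> d" by fact
    show "set u'' \<subseteq> D" using sub[OF uv(1)] xu by simp
    show "set (ext ?\<alpha> v) \<subseteq> D" by (rule sub) fact
    show "n \<le> length u''" using len[of u'] uv(3) by (simp add: u u''_def)
    show "n \<le> length (ext ?\<alpha> v)" using len[of v] uv(4) by simp
    have "ext ?\<gamma> (x # u'') = ext \<gamma> u" using xu ext_split_letter[OF assms(2) cd(3)] by metis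
    then show "prefix (ext ?\<gamma> (x # u'')) z'" using z(1) by (simp add: z')
    have "ext ?\<gamma> (ext ?\<alpha> v) = ext \<gamma> v" using ext_split_letter[OF assms(2) cd(3)] by metis
    then show "prefix (ext ?\<gamma> (d # ext ?\<alpha> v)) z'" using z(2) by (simp add: z' assms(2))
  qed
  ultimately show ?thesis by blast
qed

text \<open>Recoding turns a leading \<open>d\<close> into a leading \<open>c\<close>, and this can
  make the two leading letters equal only for the pair \<open>c\<close>, \<open>d\<close>. Nothing
  is cancelled, so \<open>n\<close> is kept.\<close>

lemma clash_split_other:
  assumes "clash \<gamma> D n e f" "\<gamma> d = \<gamma> c @ w" "c \<noteq> d" "c \<in> D" "{e, f} \<noteq> {c, d}"
  shows "clash (\<gamma>(d := w)) D n (if e = d then c else e) (if f = d then c else f)"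
proof -
  let ?\<alpha> = "\<lambda>x. if x = d then [c, d] else [x]"
  let ?\<gamma> = "\<gamma>(d := w)"
  obtain u v z where ef: "e \<in> D" "f \<in> D" "e \<noteq> f" and uv: "set u \<subseteq> D" "set v \<subseteq> D"
    "n \<le> length u" "n \<le> length v"
    and z: "prefix (ext \<gamma> (e # u)) z" "prefix (ext \<gamma> (f # v)) z"
    using assms(1) unfolding clash_def by blast
  have len: "length s \<le> length (ext ?\<alpha> s)" for s by (induction s) auto
  have sub: "set (ext ?\<alpha> s) \<subseteq> D" if "set s \<subseteq> D" "d \<in> D \<or> d \<notin> set s" for s
    using that assms(4) by (induction s) auto
  have tl: "set (tl (ext ?\<alpha> (b # s))) \<subseteq> D" "n \<le> length (tl (ext ?\<alpha> (b # s)))"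
    "ext ?\<gamma> ((if b = d then c else b) # tl (ext ?\<alpha> (b # s))) = ext \<gamma> (b # s)"
    if "set s \<subseteq> D" "b \<in> D" "n \<le> length s" for b s
  proof -
    show "set (tl (ext ?\<alpha> (b # s))) \<subseteq> D" using sub[of s] that by auto
    show "n \<le> length (tl (ext ?\<alpha> (b # s)))" using len[of s] that by auto
    have "(if b = d then c else b) # tl (ext ?\<alpha> (b # s)) = ext ?\<alpha> (b # s)" by simp
    then show "ext ?\<gamma> ((if b = d then c else b) # tl (ext ?\<alpha> (b # s))) = ext \<gamma> (b # s)"
      using ext_split_letter[OF assms(2,3)] by metis
  qed
  show ?thesis
    unfolding clash_def
  proof (intro conjI exI)
    show "(if e = d then c else e) \<in> D" "(if f = d then c else f) \<in> D" using ef assms(4) by auto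
    show "(if e = d then c else e) \<noteq> (if f = d then c else f)" using ef(3) assms(5) by auto
    show "set (tl (ext ?\<alpha> (e # u))) \<subseteq> D" "n \<le> length (tl (ext ?\<alpha> (e # u)))"
      "set (tl (ext ?\<alpha> (f # v))) \<subseteq> D" "n \<le> length (tl (ext ?\<alpha> (f # v)))"
      using tl uv ef by blast+
    show "prefix (ext ?\<gamma> ((if e = d then c else e) # tl (ext ?\<alpha> (e # u)))) z"
      using tl(3)[OF uv(1) ef(1) uv(3)] z(1) by metis
    show "prefix (ext ?\<gamma> ((if f = d then c else f) # tl (ext ?\<alpha> (f # v)))) z"
      using tl(3)[OF uv(2) ef(2) uv(4)] z(2) by metis
  qed
qed

text \<open>The degenerate split, with empty remainder: \<open>d\<close> is merged into
  \<open>c\<close> and leaves the alphabet.\<close>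

lemma clash_identify:
  assumes "clash \<gamma> D n e f" "\<gamma> d = \<gamma> c" "c \<noteq> d" "c \<in> D" "{e, f} \<noteq> {c, d}"
  shows "clash \<gamma> (D - {d}) n (if e = d then c else e) (if f = d then c else f)"
proof -
  let ?\<alpha> = "\<lambda>x. if x = d then c else x"
  obtain u v z where ef: "e \<in> D" "f \<in> D" "e \<noteq> f" and uv: "set u \<subseteq> D" "set v \<subseteq> D"
    "n \<le> length u" "n \<le> length v"
    and z: "prefix (ext \<gamma> (e # u)) z" "prefix (ext \<gamma> (f # v)) z"
    using assms(1) unfolding clash_def by blast
  have \<gamma>: "\<gamma> (?\<alpha> x) = \<gamma> x" for x by (simp add: assms(2))
  have m: "ext \<gamma> (map ?\<alpha> s) = ext \<gamma> s" for s using assms(2) by (induction s) auto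
  show ?thesis
    unfolding clash_def
  proof (intro conjI exI)
    show "?\<alpha> e \<in> D - {d}" "?\<alpha> f \<in> D - {d}" using ef assms(3,4) by auto
    show "?\<alpha> e \<noteq> ?\<alpha> f" using ef(3) assms(5) by auto
    show "set (map ?\<alpha> u) \<subseteq> D - {d}" "set (map ?\<alpha> v) \<subseteq> D - {d}" using uv assms(3,4) by auto
    show "n \<le> length (map ?\<alpha> u)" "n \<le> length (map ?\<alpha> v)" using uv by auto
    show "prefix (ext \<gamma> (?\<alpha> e # map ?\<alpha> u)) z"
      using z(1) m[of u] \<gamma>[of e] by simp
    show "prefix (ext \<gamma> (?\<alpha> f # map ?\<alpha> v)) z"
      using z(2) m[of v] \<gamma>[of f] by simp
  qed
qed

lemma image_remove_duplicate:
  assumes "f d = f c" "c \<in> D" "d \<in> D" "c \<noteq> d"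
  shows "f ` D = f ` (D - {d})"
proof -
  have "f d \<in> f ` (D - {d})" using assms by (intro image_eqI[of _ _ c]) auto
  then show ?thesis using assms(3) by (metis image_insert insert_Diff insert_absorb)
qed

lemma sum_length_fun_upd:
  fixes \<gamma> :: "'c \<Rightarrow> 'a list"
  assumes "finite D" "d \<in> D" "\<gamma> d = v @ w" "v \<noteq> []"
  shows "(\<Sum>x\<in>D. length ((\<gamma>(d := w)) x)) < (\<Sum>x\<in>D. length (\<gamma> x))"
  using assms by (intro sum_strict_mono_ex1) auto

lemma factorization_rank_le_split:
  assumes "factorization_rank_le ((\<gamma>(d := w)) ` D) k" "\<gamma> d = \<gamma> c @ w" "c \<in> D" "d \<in> D" "c \<noteq> d"
  shows "factorization_rank_le (\<gamma> ` D) k"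
proof -
  let ?\<gamma> = "\<gamma>(d := w)"
  obtain F where F: "finite F" "card F \<le> k" "[] \<notin> F" "?\<gamma> ` D \<subseteq> concat ` lists F"
    using assms(1) unfolding factorization_rank_le_def by blast
  have "\<gamma> x \<in> concat ` lists F" if "x \<in> D" for x
  proof (cases "x = d")
    case True
    have "?\<gamma> c @ ?\<gamma> d \<in> concat ` lists F"
      using F(4) assms(3,4) by (intro concat_lists_append) auto
    then show ?thesis using True assms(2,5) by simp
  next
    case False
    then show ?thesis using F(4) that by (metis fun_upd_other image_subset_iff)
  qed
  then show ?thesis using F by (intro factorization_rank_leI[of F]) auto
qed

lemma defect_one_clash:
  assumes "finite D" "\<forall>x\<in>D. \<gamma> x \<noteq> []" "clash \<gamma> D n c d" "(\<Sum>x\<in>D. length (\<gamma> x)) \<le> n"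
  shows "factorization_rank_le (\<gamma> ` D) (card D - 1)"
  using assms(2-)
proof (induction n arbitrary: \<gamma> c d rule: less_induct)
  case (less n)
  have *: ?case if cl: "clash \<gamma> D n c d" and w: "\<gamma> d = \<gamma> c @ w" for c d w
  proof -
    have cd: "c \<in> D" "d \<in> D" "c \<noteq> d" using cl by (auto simp: clash_def)
    show ?case
    proof (cases "w = []")
      case True
      have "\<gamma> ` D = \<gamma> ` (D - {d})" using w True cd by (intro image_remove_duplicate[of \<gamma> d c]) auto
      also have "\<dots> \<subseteq> concat ` lists (\<gamma> ` (D - {d}))" by (rule subset_concat_lists)
      finally show ?thesis
      proof (rule factorization_rank_leI[rotated 3])
        show "card (\<gamma> ` (D - {d})) \<le> card D - 1"
          using card_image_le[of "D - {d}" \<gamma>] assms(1) cd by simp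
        show "[] \<notin> \<gamma> ` (D - {d})" using less.prems(1) by auto
      qed (use assms(1) in simp)
    next
      case False
      let ?\<gamma> = "\<gamma>(d := w)"
      have lt: "(\<Sum>x\<in>D. length (?\<gamma> x)) < (\<Sum>x\<in>D. length (\<gamma> x))"
        using less.prems(1) cd w by (intro sum_length_fun_upd[OF assms(1), of d \<gamma> "\<gamma> c"]) auto
      then obtain m where m: "n = Suc m" using less.prems(3) by (cases n) auto
      obtain x where "clash ?\<gamma> D m x d" using clash_split_same[of \<gamma> D m c d w] cl w m by blast
      moreover have "\<forall>y\<in>D. ?\<gamma> y \<noteq> []" using less.prems(1) False by simp
      moreover have "(\<Sum>y\<in>D. length (?\<gamma> y)) \<le> m" using lt less.prems(3) m by linarith
      ultimately have "factorization_rank_le (?\<gamma> ` D) (card D - 1)"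
        using less.IH[of m ?\<gamma> x d] m by blast
      then show ?thesis by (rule factorization_rank_le_split) (use cd w in auto)
    qed
  qed
  \<comment> \<open>A clash is symmetric, so \<open>*\<close> covers both possibilities for the
    shorter word.\<close>
  from clash_prefix[OF less.prems(2)] show ?case
    using *[OF less.prems(2)] *[OF clash_sym[OF less.prems(2)]] by (auto elim!: prefixE)
qed

text \<open>Two distinct edges of the clash graph cost two words. A split regenerates the first
  clash with \<open>d\<close> as an endpoint and moves the second one away from \<open>d\<close>, so
  they stay distinct. Once \<open>c\<close> and \<open>d\<close> have equal images, \<open>d\<close>
  is merged into \<open>c\<close> and the second clash still costs a word on
  \<open>D - {d}\<close>.\<close>

lemma defect_two_clashes:
  assumes "finite D" "\<forall>x\<in>D. \<gamma> x \<noteq> []" "clash \<gamma> D n c d" "clash \<gamma> D n e f" "{c, d} \<noteq> {e, f}"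
    "(\<Sum>x\<in>D. length (\<gamma> x)) \<le> n"
  shows "factorization_rank_le (\<gamma> ` D) (card D - 2)"
  using assms(2-)
proof (induction n arbitrary: \<gamma> c d e f rule: less_induct)
  case (less n)
  have *: ?case if cl: "clash \<gamma> D n c d" and ne: "{c, d} \<noteq> {e, f}" and w: "\<gamma> d = \<gamma> c @ w" for c d w
  proof -
    have cd: "c \<in> D" "d \<in> D" "c \<noteq> d" using cl by (auto simp: clash_def)
    let ?e = "if e = d then c else e" and ?f = "if f = d then c else f"
    show ?case
    proof (cases "w = []")
      case True
      have "clash \<gamma> (D - {d}) n ?e ?f"
        using less.prems(3) w True cd ne by (intro clash_identify) auto
      moreover have "(\<Sum>x\<in>D - {d}. length (\<gamma> x)) \<le> n"
        using sum_mono2[of D "D - {d}" "\<lambda>x. length (\<gamma> x)"] assms(1) less.prems(5) by auto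
      ultimately have "factorization_rank_le (\<gamma> ` (D - {d})) (card (D - {d}) - 1)"
        using assms(1) less.prems(1) by (intro defect_one_clash) auto
      moreover have "\<gamma> ` D = \<gamma> ` (D - {d})" using w True cd by (intro image_remove_duplicate[of \<gamma> d c]) auto
      moreover have "card (D - {d}) - 1 = card D - 2" using cd assms(1) by simp
      ultimately show ?thesis by simp
    next
      case False
      let ?\<gamma> = "\<gamma>(d := w)"
      have lt: "(\<Sum>x\<in>D. length (?\<gamma> x)) < (\<Sum>x\<in>D. length (\<gamma> x))"
        using less.prems(1) cd w by (intro sum_length_fun_upd[OF assms(1), of d \<gamma> "\<gamma> c"]) auto
      then obtain m where m: "n = Suc m" using less.prems(5) by (cases n) auto
      obtain x where x: "clash ?\<gamma> D m x d" using clash_split_same[of \<gamma> D m c d w] cl w m by blast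
      have "clash ?\<gamma> D n ?e ?f"
        using less.prems(3) w cd ne by (intro clash_split_other) auto
      then have "clash ?\<gamma> D m ?e ?f" by (rule clash_mono) (simp add: m)
      moreover have "\<forall>y\<in>D. ?\<gamma> y \<noteq> []" using less.prems(1) False by simp
      moreover have "(\<Sum>y\<in>D. length (?\<gamma> y)) \<le> m" using lt less.prems(5) m by linarith
      moreover have "{x, d} \<noteq> {?e, ?f}" using cd(3) by (auto simp: doubleton_eq_iff)
      ultimately have "factorization_rank_le (?\<gamma> ` D) (card D - 2)"
        using less.IH[of m ?\<gamma> x d ?e ?f] x m by blast
      then show ?thesis by (rule factorization_rank_le_split) (use cd w in auto)
    qed
  qed
  from clash_prefix[OF less.prems(2)] show ?case
    using *[OF less.prems(2,4)] *[OF clash_sym[OF less.prems(2)]] less.prems(4)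
    by (auto elim!: prefixE simp: insert_commute)
qed

section \<open>Bi-infinite words and their parsings\<close>

definition win :: "(int \<Rightarrow> 'a) \<Rightarrow> int \<Rightarrow> nat \<Rightarrow> 'a list" where
  "win x i n = map (\<lambda>k. x (i + int k)) [0..<n]"

lemma length_win [simp]: "length (win x i n) = n"
  by (simp add: win_def)

lemma win_0 [simp]: "win x i 0 = []"
  by (simp add: win_def)

lemma nth_win [simp]: "k < n \<Longrightarrow> win x i n ! k = x (i + int k)"
  by (simp add: win_def)

lemma win_add: "win x i (m + n) = win x i m @ win x (i + int m) n"
  by (rule nth_equalityI) (auto simp: nth_append)

lemma win_Suc: "win x i (Suc n) = x i # win x (i + 1) n"
  by (rule nth_equalityI) (auto simp: nth_Cons' add.assoc of_nat_diff)

lemma win_Suc_last: "win x i (Suc n) = win x i n @ [x (i + int n)]"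
  by (simp add: win_def)

lemma set_win_subset: "range x \<subseteq> C \<Longrightarrow> set (win x i n) \<subseteq> C"
  by (auto simp: win_def)

lemma win_cong: "(\<And>k. i \<le> k \<Longrightarrow> k < i + int n \<Longrightarrow> x k = y k) \<Longrightarrow> win x i n = win y i n"
  by (rule nth_equalityI) auto

lemma prefix_win: "m \<le> n \<Longrightarrow> prefix (win x i m) (win x i n)"
  using win_add[of x i m "n - m"] by (auto simp: prefix_def)

lemma sublist_win:
  assumes "i \<le> j" "j + int m \<le> i + int n"
  shows "sublist (win x j m) (win x i n)"
proof -
  define a where "a = nat (j - i)"
  define b where "b = n - (a + m)"
  have "n = a + m + b" "j = i + int a" using assms by (auto simp: a_def b_def)
  then have "win x i n = win x i a @ win x j m @ win x (j + int m) b"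
    using win_add[of x i a "m + b"] win_add[of x j m b] by (simp add: add.assoc)
  then show ?thesis by (auto simp: sublist_def)
qed

lemma map_upto_win: "map x [i..j] = win x i (nat (j - i + 1))"
  by (rule nth_equalityI) auto

definition tr :: "int \<Rightarrow> (int \<Rightarrow> 'a) \<Rightarrow> int \<Rightarrow> 'a" where
  "tr n x = (\<lambda>i. x (i + n))"

lemma tr_0 [simp]: "tr 0 x = x"
  by (simp add: tr_def)

lemma tr_tr [simp]: "tr m (tr n x) = tr (m + n) x"
  by (simp add: tr_def add.assoc)

lemma win_tr: "win (tr n x) i k = win x (i + n) k"
  by (rule nth_equalityI) (auto simp: tr_def ac_simps)

lemma funpow_shift: "(shift ^^ n) x = tr (int n) x"
  by (induction n) (auto simp: shift_def tr_def ac_simps)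

text \<open>\<open>c i\<close> is the position in \<open>x\<close> at which the block \<open>\<gamma> (w i)\<close> begins; it need not vanish at \<open>0\<close>.\<close>

definition parsing :: "('c \<Rightarrow> 'a list) \<Rightarrow> (int \<Rightarrow> 'c) \<Rightarrow> (int \<Rightarrow> int) \<Rightarrow> (int \<Rightarrow> 'a) \<Rightarrow> bool" where
  "parsing \<gamma> w c x \<longleftrightarrow> (\<forall>i. \<gamma> (w i) \<noteq> [] \<and> c (i + 1) = c i + int (length (\<gamma> (w i))) \<and>
     win x (c i) (length (\<gamma> (w i))) = \<gamma> (w i))"

lemma parsing_nonempty: "parsing \<gamma> w c x \<Longrightarrow> \<gamma> (w i) \<noteq> []"
  and parsing_cut: "parsing \<gamma> w c x \<Longrightarrow> c (i + 1) = c i + int (length (\<gamma> (w i)))"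
  and parsing_block: "parsing \<gamma> w c x \<Longrightarrow> win x (c i) (length (\<gamma> (w i))) = \<gamma> (w i)"
  by (auto simp: parsing_def)

lemma parsing_nth:
  assumes "parsing \<gamma> w c x" "j < length (\<gamma> (w i))"
  shows "x (c i + int j) = \<gamma> (w i) ! j"
  using parsing_block[OF assms(1), of i] assms(2) nth_win[of j "length (\<gamma> (w i))" x "c i"] by simp

lemma parsing_cut_add:
  assumes "parsing \<gamma> w c x"
  shows "c (i + int n) = c i + int (length (ext \<gamma> (win w i n)))"
proof (induction n)
  case (Suc n)
  have "c (i + int (Suc n)) = c (i + int n + 1)" by (simp add: add.commute add.left_commute)
  also have "\<dots> = c (i + int n) + int (length (\<gamma> (w (i + int n))))" by (rule parsing_cut[OF assms])
  finally show ?case using Suc by (simp add: win_Suc_last)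
qed simp

lemma parsing_ext:
  assumes "parsing \<gamma> w c x"
  shows "ext \<gamma> (win w i n) = win x (c i) (length (ext \<gamma> (win w i n)))"
proof (induction n)
  case (Suc n)
  have "win x (c i) (length (ext \<gamma> (win w i (Suc n))))
      = win x (c i) (length (ext \<gamma> (win w i n))) @ win x (c (i + int n)) (length (\<gamma> (w (i + int n))))"
    by (simp add: win_Suc_last win_add parsing_cut_add[OF assms])
  then show ?case using Suc parsing_block[OF assms] by (simp add: win_Suc_last)
qed simp

lemma strict_mono_int:
  fixes c :: "int \<Rightarrow> int"
  assumes "\<And>i. c i < c (i + 1)" "i < j"
  shows "c i < c j"
proof -
  have "c i < c (i + 1 + int n)" for n
  proof (induction n)
    case (Suc n)
    then show ?case using assms(1)[of "i + 1 + int n"] by (simp add: add.assoc)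
  qed (use assms(1) in simp)
  from this[of "nat (j - i - 1)"] show ?thesis using assms(2) by simp
qed

lemma parsing_strict_mono: "parsing \<gamma> w c x \<Longrightarrow> i < j \<Longrightarrow> c i < c j"
  by (rule strict_mono_int) (simp_all add: parsing_cut parsing_nonempty)

lemma parsing_less_iff: "parsing \<gamma> w c x \<Longrightarrow> c i < c j \<longleftrightarrow> i < j"
  using parsing_strict_mono[of \<gamma> w c x] by (metis less_asym linorder_neqE_linordered_idom)

lemma parsing_le_iff: "parsing \<gamma> w c x \<Longrightarrow> c i \<le> c j \<longleftrightarrow> i \<le> j"
  using parsing_less_iff[of \<gamma> w c x] by (metis linorder_not_less)

lemma parsing_cut_ge:
  assumes "parsing \<gamma> w c x"
  shows "c i + int n \<le> c (i + int n)"
proof (induction n)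
  case (Suc n)
  have "c (i + int n) < c (i + int n + 1)" using parsing_strict_mono[OF assms] by simp
  with Suc show ?case by (simp add: algebra_simps)
qed simp

lemma int_interval_exists:
  fixes c :: "int \<Rightarrow> int"
  assumes "c a \<le> t" "t < c b" "a < b"
  shows "\<exists>i. c i \<le> t \<and> t < c (i + 1)"
  using assms
proof (induction "nat (b - a)" arbitrary: b)
  case (Suc n)
  show ?case
  proof (cases "t < c (b - 1)")
    case True
    then have "a < b - 1" using Suc.prems by (cases "a = b - 1") auto
    then show ?thesis using Suc.hyps(1)[of "b - 1"] Suc.hyps(2) Suc.prems True by auto
  next
    case False
    then show ?thesis using Suc.prems by (intro exI[of _ "b - 1"]) auto
  qed
qed simp

lemma parsing_index_exists:
  assumes "parsing \<gamma> w c x"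
  shows "\<exists>i. c i \<le> t \<and> t < c (i + 1)"
proof -
  \<comment> \<open>Cuts advance by at least one per index, so \<open>n\<close> steps from index 0
    lead beyond \<open>t\<close> on either side.\<close>
  define n where "n = nat (abs (c 0) + abs t + 1)"
  have "c (- int n) + int n \<le> c 0" using parsing_cut_ge[OF assms, of "- int n" n] by simp
  moreover have "c 0 + int n \<le> c (int n)" using parsing_cut_ge[OF assms, of 0 n] by simp
  moreover have "int n = \<bar>c 0\<bar> + \<bar>t\<bar> + 1" by (simp add: n_def)
  ultimately have "c (- int n) \<le> t" "t < c (int n)" "- int n < int n" by linarith+
  then show ?thesis by (rule int_interval_exists)
qed

lemma parsing_index_unique:
  assumes "parsing \<gamma> w c x" "c i \<le> t" "t < c (i + 1)" "c j \<le> t" "t < c (j + 1)"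
  shows "i = j"
  using assms parsing_less_iff[OF assms(1), of i "j + 1"] parsing_less_iff[OF assms(1), of j "i + 1"]
  by linarith

lemma parsing_image_unique:
  assumes "parsing \<gamma> w c x" "parsing \<gamma> w c y"
  shows "x = y"
proof
  fix t
  obtain i where i: "c i \<le> t" "t < c (i + 1)" using parsing_index_exists[OF assms(1)] by blast
  define j where "j = nat (t - c i)"
  have "j < length (\<gamma> (w i))" "t = c i + int j"
    using i parsing_cut[OF assms(1), of i] by (auto simp: j_def)
  then show "x t = y t" using parsing_nth[OF assms(1)] parsing_nth[OF assms(2)] by metis
qed

lemma parsing_tr_index: "parsing \<gamma> w c x \<Longrightarrow> parsing \<gamma> (tr s w) (\<lambda>i. c (i + s)) x"
  unfolding parsing_def tr_def by (metis add.commute add.left_commute)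

lemma parsing_tr: "parsing \<gamma> w c x \<Longrightarrow> parsing \<gamma> w (\<lambda>i. c i - n) (tr n x)"
  unfolding parsing_def by (auto simp: win_tr)

lemma cut_functions_eq:
  fixes c d :: "int \<Rightarrow> int"
  assumes "\<And>i. c (i + 1) - c i = d (i + 1) - d i"
  shows "c i - c j = d i - d j"
proof -
  have *: "c (j + int n) - c j = d (j + int n) - d j" for j n
  proof (induction n)
    case (Suc n)
    then show ?case using assms[of "j + int n"] by (simp add: algebra_simps)
  qed simp
  show ?thesis
    using *[of j "nat (i - j)"] *[of i "nat (j - i)"] by (cases "j \<le> i") auto
qed

lemma parsing_cuts_diff:
  assumes "parsing \<gamma> w c x" "parsing \<gamma> w d y"
  shows "c i - c j = d i - d j"
  by (rule cut_functions_eq[of c d]) (simp add: parsing_cut[OF assms(1)] parsing_cut[OF assms(2)])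

lemma parsing_comp:
  assumes "parsing \<delta> y e z" "parsing \<gamma> z f x"
  shows "parsing (\<lambda>a. ext \<gamma> (\<delta> a)) y (\<lambda>i. f (e i)) x"
  unfolding parsing_def
proof (intro allI conjI)
  fix i
  have w: "win z (e i) (length (\<delta> (y i))) = \<delta> (y i)" by (rule parsing_block[OF assms(1)])
  have f: "f (e (i + 1)) = f (e i) + int (length (ext \<gamma> (\<delta> (y i))))"
    using parsing_cut[OF assms(1), of i] parsing_cut_add[OF assms(2), of "e i" "length (\<delta> (y i))"] w
    by simp
  show "f (e (i + 1)) = f (e i) + int (length (ext \<gamma> (\<delta> (y i))))" by fact
  show "ext \<gamma> (\<delta> (y i)) \<noteq> []"
    using f parsing_strict_mono[OF assms(2), of "e i" "e (i + 1)"] parsing_strict_mono[OF assms(1), of i "i + 1"]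
    by auto
  show "win x (f (e i)) (length (ext \<gamma> (\<delta> (y i)))) = ext \<gamma> (\<delta> (y i))"
    using parsing_ext[OF assms(2), of "e i" "length (\<delta> (y i))"] w by simp
qed

text \<open>The cut function normalized at index 0; every parsing of \<open>w\<close> by
  \<open>\<gamma>\<close> has these cuts up to a constant (\<open>parsing_cuts\<close>).\<close>

definition cuts :: "('c \<Rightarrow> 'a list) \<Rightarrow> (int \<Rightarrow> 'c) \<Rightarrow> int \<Rightarrow> int" where
  "cuts \<gamma> w i = (if 0 \<le> i then int (length (ext \<gamma> (win w 0 (nat i))))
     else - int (length (ext \<gamma> (win w i (nat (- i))))))"

lemma cuts_0 [simp]: "cuts \<gamma> w 0 = 0"
  by (simp add: cuts_def)

lemma cuts_Suc: "cuts \<gamma> w (i + 1) = cuts \<gamma> w i + int (length (\<gamma> (w i)))"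
proof (cases "0 \<le> i")
  case True
  then have "nat (i + 1) = Suc (nat i)" by simp
  then show ?thesis using True by (simp add: cuts_def win_Suc_last)
next
  case False
  then have "nat (- i) = Suc (nat (- (i + 1)))" by simp
  then have "win w i (nat (- i)) = w i # win w (i + 1) (nat (- (i + 1)))" by (simp only: win_Suc)
  then show ?thesis using False by (simp add: cuts_def)
qed

text \<open>Locality of the cuts, which lets them pass to pointwise limits of words.\<close>

lemma cuts_cong:
  assumes "\<And>j. \<bar>j\<bar> \<le> \<bar>i\<bar> \<Longrightarrow> w j = v j"
  shows "cuts \<gamma> w i = cuts \<gamma> v i"
proof -
  have "win w 0 (nat i) = win v 0 (nat i)" if "0 \<le> i" using that assms by (intro win_cong) auto
  moreover have "win w i (nat (- i)) = win v i (nat (- i))" if "\<not> 0 \<le> i"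
    using that assms by (intro win_cong) auto
  ultimately show ?thesis by (simp add: cuts_def)
qed

lemma parsing_cuts: "parsing \<gamma> w c x \<Longrightarrow> c i = cuts \<gamma> w i + c 0"
  using cut_functions_eq[of c "cuts \<gamma> w" i 0] parsing_cut[of \<gamma> w c x] by (simp add: cuts_Suc)

lemma parsing_exists:
  assumes "\<And>i. \<gamma> (w i) \<noteq> []"
  shows "\<exists>x. parsing \<gamma> w (\<lambda>i. cuts \<gamma> w i + k) x"
proof -
  let ?c = "\<lambda>i. cuts \<gamma> w i + k"
  have c: "?c (i + 1) = ?c i + int (length (\<gamma> (w i)))" for i by (simp add: cuts_Suc)
  have mono: "i < j \<Longrightarrow> ?c i < ?c j" for i j
    using strict_mono_int[of ?c i j] c assms by simp
  \<comment> \<open>The index of the block that contains \<open>t\<close>; strict monotonicity of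
    the cuts makes it unique.\<close>
  define idx where "idx t = (THE i. ?c i \<le> t \<and> t < ?c (i + 1))" for t
  have idx: "idx (?c i + int j) = i" if "j < length (\<gamma> (w i))" for i j
    unfolding idx_def
  proof (rule the_equality)
    show "?c i \<le> ?c i + int j \<and> ?c i + int j < ?c (i + 1)" using that c[of i] by simp
    fix i' assume i': "?c i' \<le> ?c i + int j \<and> ?c i + int j < ?c (i' + 1)"
    have "i' < i + 1" using i' mono[of "i + 1" i'] that c[of i] by (cases "i' = i + 1") force+
    moreover have "i < i' + 1" using i' mono[of "i' + 1" i] by (cases "i = i' + 1") force+
    ultimately show "i' = i" by simp
  qed
  define x where "x t = \<gamma> (w (idx t)) ! nat (t - ?c (idx t))" for t
  have "win x (?c i) (length (\<gamma> (w i))) = \<gamma> (w i)" for i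
    by (rule nth_equalityI) (auto simp: x_def idx)
  then show ?thesis using assms c unfolding parsing_def by blast
qed

section \<open>Elementary morphisms are recognizable at aperiodic points\<close>

text \<open>From a common cut both parsings spell \<open>x\<close> to the right, so different
  letters there clash at every order \<open>n\<close>. The common word is a window of
  \<open>x\<close> long enough for both sides.\<close>

lemma win_clash:
  assumes \<gamma>: "parsing \<gamma> w c x" "parsing \<gamma> w' c' x" and C: "range w \<subseteq> C" "range w' \<subseteq> C"
    and ne: "w i \<noteq> w' i'" and eq: "c i = c' i'"
  shows "clash \<gamma> C n (w i) (w' i')"
  unfolding clash_def
proof (intro conjI exI)
  let ?u = "win w (i + 1) n" and ?v = "win w' (i' + 1) n"
  let ?m = "max (length (ext \<gamma> (win w i (Suc n)))) (length (ext \<gamma> (win w' i' (Suc n))))"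
  show "prefix (ext \<gamma> (w i # ?u)) (win x (c i) ?m)"
    using parsing_ext[OF \<gamma>(1), of i "Suc n"] prefix_win[of "length (ext \<gamma> (win w i (Suc n)))" ?m x "c i"]
    by (simp add: win_Suc)
  show "prefix (ext \<gamma> (w' i' # ?v)) (win x (c i) ?m)"
    using parsing_ext[OF \<gamma>(2), of i' "Suc n"] prefix_win[of "length (ext \<gamma> (win w' i' (Suc n)))" ?m x "c i"]
    by (simp add: win_Suc eq)
qed (use assms in \<open>auto simp: set_win_subset\<close>)

text \<open>The mirror image at a common right end: blocks are read leftwards, hence
  \<open>rev \<circ> \<gamma>\<close> and windows of \<open>x\<close> that end at
  \<open>c (i + 1)\<close>.\<close>

lemma win_clash_rev:
  assumes \<gamma>: "parsing \<gamma> w c x" "parsing \<gamma> w' c' x" and C: "range w \<subseteq> C" "range w' \<subseteq> C"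
    and ne: "w i \<noteq> w' i'" and eq: "c (i + 1) = c' (i' + 1)"
  shows "clash (rev \<circ> \<gamma>) C n (w i) (w' i')"
  unfolding clash_def
proof (intro conjI exI)
  let ?u = "rev (win w (i - int n) n)" and ?v = "rev (win w' (i' - int n) n)"
  let ?a = "length (ext \<gamma> (win w (i - int n) (Suc n)))"
    and ?b = "length (ext \<gamma> (win w' (i' - int n) (Suc n)))"
  let ?m = "max ?a ?b"
  have rev_ext: "ext (rev \<circ> \<gamma>) (rev u) = rev (ext \<gamma> u)" for u by (induction u) auto
  have suf: "suffix (win x (p - int a) a) (win x (p - int m) m)" if "a \<le> m" for p a m
  proof -
    have "win x (p - int m) ((m - a) + a) = win x (p - int m) (m - a) @ win x (p - int a) a"
      using that by (simp only: win_add) (simp add: of_nat_diff)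
    then show ?thesis using that by (simp add: suffix_def)
  qed
  have "c (i - int n) = c (i + 1) - int ?a"
    using parsing_cut_add[OF \<gamma>(1), of "i - int n" "Suc n"] by (simp add: add.commute)
  then have "suffix (ext \<gamma> (win w (i - int n) (Suc n))) (win x (c (i + 1) - int ?m) ?m)"
    using parsing_ext[OF \<gamma>(1), of "i - int n" "Suc n"] suf[of ?a ?m "c (i + 1)"] by simp
  then show "prefix (ext (rev \<circ> \<gamma>) (w i # ?u)) (rev (win x (c (i + 1) - int ?m) ?m))"
    using rev_ext[of "win w (i - int n) (Suc n)"] by (simp add: suffix_to_prefix win_Suc_last)
  have "c' (i' - int n) = c (i + 1) - int ?b"
    using parsing_cut_add[OF \<gamma>(2), of "i' - int n" "Suc n"] eq by (simp add: algebra_simps)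
  then have "suffix (ext \<gamma> (win w' (i' - int n) (Suc n))) (win x (c (i + 1) - int ?m) ?m)"
    using parsing_ext[OF \<gamma>(2), of "i' - int n" "Suc n"] suf[of ?b ?m "c (i + 1)"] by simp
  then show "prefix (ext (rev \<circ> \<gamma>) (w' i' # ?v)) (rev (win x (c (i + 1) - int ?m) ?m))"
    using rev_ext[of "win w' (i' - int n) (Suc n)"] by (simp add: suffix_to_prefix win_Suc_last)
qed (use assms in \<open>auto simp: set_win_subset\<close>)

lemma win_eq_Nil [simp]: "win x i n = [] \<longleftrightarrow> n = 0" "[] = win x i n \<longleftrightarrow> n = 0"
  by (auto simp: win_def)

lemma drop_win: "drop k (win x i n) = win x (i + int k) (n - k)"
  by (rule nth_equalityI) (auto simp: add.assoc)

text \<open>One common cut spreads in both directions: a disagreement at the next letter on the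
  right is a clash for \<open>\<gamma>\<close>, on the left a clash for its reversal, and either
  would lower the rank.\<close>

lemma parsing_aligned:
  assumes \<gamma>: "parsing \<gamma> w c x" "parsing \<gamma> w' c' x"
    and C: "finite C" "range w \<subseteq> C" "range w' \<subseteq> C" "\<forall>a\<in>C. \<gamma> a \<noteq> []"
    and el: "\<not> factorization_rank_le (\<gamma> ` C) (card C - 1)"
    and eq: "c i = c' i'"
  shows "w' = tr (i - i') w \<and> c' = (\<lambda>j. c (j + (i - i')))"
proof -
  define s where "s = i - i'"
  have fwd: "w' j = w (j + s)" if "c' j = c (j + s)" for j
  proof (rule ccontr)
    assume "w' j \<noteq> w (j + s)"
    then have "clash \<gamma> C (\<Sum>a\<in>C. length (\<gamma> a)) (w (j + s)) (w' j)"
      using win_clash[OF \<gamma> C(2,3)] that by metis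
    then show False using defect_one_clash[OF C(1,4)] el by blast
  qed
  have bwd: "w' j = w (j + s)" if "c' (j + 1) = c (j + s + 1)" for j
  proof (rule ccontr)
    assume "w' j \<noteq> w (j + s)"
    then have "clash (rev \<circ> \<gamma>) C (\<Sum>a\<in>C. length ((rev \<circ> \<gamma>) a)) (w (j + s)) (w' j)"
      using win_clash_rev[OF \<gamma> C(2,3)] that by metis
    moreover have "\<forall>a\<in>C. (rev \<circ> \<gamma>) a \<noteq> []" using C(4) by simp
    ultimately have "factorization_rank_le ((rev \<circ> \<gamma>) ` C) (card C - 1)"
      using defect_one_clash[OF C(1)] by blast
    then show False using el factorization_rank_le_rev[of "\<gamma> ` C"] by (simp add: image_comp)
  qed
  have "c' j = c (j + s)" for j
  proof (induction j rule: int_induct[where k = i'])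
    case base
    then show ?case using eq by (simp add: s_def)
  next
    case (step1 j)
    then show ?case
      using fwd[of j] parsing_cut[OF \<gamma>(1), of "j + s"] parsing_cut[OF \<gamma>(2), of j]
      by (simp add: algebra_simps)
  next
    case (step2 j)
    then have "c' (j - 1 + 1) = c (j - 1 + s + 1)" by (simp add: algebra_simps)
    then show ?case
      using bwd[of "j - 1"] parsing_cut[OF \<gamma>(1), of "j - 1 + s"] parsing_cut[OF \<gamma>(2), of "j - 1"]
      by simp
  qed
  then show ?thesis using fwd unfolding s_def[symmetric] by (auto simp: tr_def)
qed

text \<open>At the cut \<open>p\<close> of the parsing \<open>w\<close>, the other parsing is ahead by the word \<open>q\<close>; \<open>a\<close> is the
  letter of \<open>w\<close> that starts at \<open>p\<close>.\<close>

definition overhang ::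
  "(int \<Rightarrow> int) \<Rightarrow> (int \<Rightarrow> int) \<Rightarrow> (int \<Rightarrow> 'c) \<Rightarrow> (int \<Rightarrow> 'a) \<Rightarrow> int \<Rightarrow> 'a list \<Rightarrow> 'c \<Rightarrow> bool" where
  "overhang c c' w x p q a \<longleftrightarrow> (\<exists>i i'. c i = p \<and> c' (i' - 1) < p \<and> p < c' i' \<and>
     q = win x p (nat (c' i' - p)) \<and> a = w i)"

text \<open>A step as in the Sardinas-Patterson procedure: the shorter of \<open>q\<close> and
  \<open>\<gamma> a\<close> is cancelled from the longer. If the block sticks out, the two parsings
  exchange roles; equal lengths would produce a common cut.\<close>

lemma overhang_step:
  assumes \<gamma>: "parsing \<gamma> w c x" "parsing \<gamma> w' c' x" and ne: "\<And>i i'. c i \<noteq> c' i'"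
    and ov: "overhang c c' w x p q a"
  shows "if length (\<gamma> a) < length q
     then \<exists>b. overhang c c' w x (p + int (length (\<gamma> a))) (drop (length (\<gamma> a)) q) b
     else \<exists>b. overhang c' c w' x (p + int (length q)) (drop (length q) (\<gamma> a)) b"
proof -
  obtain i i' where i: "c i = p" "c' (i' - 1) < p" "p < c' i'" "q = win x p (nat (c' i' - p))" "a = w i"
    using ov unfolding overhang_def by blast
  have ci: "c (i + 1) = p + int (length (\<gamma> a))" using parsing_cut[OF \<gamma>(1), of i] i by simp
  have q: "int (length q) = c' i' - p" using i by simp
  have "c (i + 1) \<noteq> c' i'" by (rule ne)
  show ?thesis
  proof (cases "length (\<gamma> a) < length q")
    case True
    have "overhang c c' w x (p + int (length (\<gamma> a))) (drop (length (\<gamma> a)) q) (w (i + 1))"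
      unfolding overhang_def
      using i ci q True
      by (intro exI[of _ "i + 1"] exI[of _ i'] conjI) (auto simp: drop_win nat_diff_distrib' diff_diff_eq intro!: arg_cong[of _ _ "win x _"])
    then show ?thesis using True by auto
  next
    case False
    then have lt: "c' i' < c (i + 1)" using ci q \<open>c (i + 1) \<noteq> c' i'\<close> by linarith
    have a: "\<gamma> a = win x p (length (\<gamma> a))" using parsing_block[OF \<gamma>(1), of i] i by simp
    have "drop (length q) (\<gamma> a) = win x (p + int (length q)) (length (\<gamma> a) - length q)"
      by (subst a) (rule drop_win)
    moreover have "length (\<gamma> a) - length q = nat (c (i + 1) - (p + int (length q)))"
      using ci q by simp
    ultimately have "overhang c' c w' x (p + int (length q)) (drop (length q) (\<gamma> a)) (w' i')"
      unfolding overhang_def using i q lt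
      by (intro exI[of _ "i'"] exI[of _ "i + 1"] conjI) auto
    then show ?thesis using False by auto
  qed
qed

text \<open>The overhang becomes the image of an extra letter \<open>None\<close>: \<open>q\<close>
  continued along \<open>w'\<close> and \<open>\<gamma> a\<close> continued along \<open>w\<close>
  both spell \<open>x\<close> from \<open>p\<close> on.\<close>

lemma overhang_clash:
  assumes \<gamma>: "parsing \<gamma> w c x" "parsing \<gamma> w' c' x" and C: "range w \<subseteq> C" "range w' \<subseteq> C"
    and ov: "overhang c c' w x p q a"
  shows "clash (case_option q \<gamma>) (insert None (Some ` C)) n None (Some a)"
proof -
  let ?\<delta> = "case_option q \<gamma>"
  obtain i i' where i: "c i = p" "p < c' i'" "q = win x p (nat (c' i' - p))" "a = w i"
    using ov unfolding overhang_def by blast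
  let ?u = "win w' i' n" and ?v = "win w (i + 1) n"
  let ?l = "length q + length (ext \<gamma> ?u)" and ?l' = "length (ext \<gamma> (win w i (Suc n)))"
  have \<delta>: "ext ?\<delta> (map Some u) = ext \<gamma> u" for u by (induction u) auto
  show ?thesis
    unfolding clash_def
  proof (intro conjI exI)
  have "q @ ext \<gamma> ?u = win x p ?l"
    unfolding win_add using parsing_ext[OF \<gamma>(2), of i' n] i by simp
  then show "prefix (ext ?\<delta> (None # map Some ?u)) (win x p (max ?l ?l'))"
    using \<delta> prefix_win[of ?l "max ?l ?l'" x p] by simp
  have "ext \<gamma> (win w i (Suc n)) = win x p ?l'"
    using parsing_ext[OF \<gamma>(1), of i "Suc n"] i by simp
  then show "prefix (ext ?\<delta> (Some a # map Some ?v)) (win x p (max ?l ?l'))"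
    using \<delta> prefix_win[of ?l' "max ?l ?l'" x p] i by (simp add: win_Suc)
  show "Some a \<in> insert None (Some ` C)" using C i by auto
  show "set (map Some ?u) \<subseteq> insert None (Some ` C)" "set (map Some ?v) \<subseteq> insert None (Some ` C)"
    using set_win_subset[OF C(1), of "i + 1" n] set_win_subset[OF C(2), of i' n] by auto
  qed auto
qed

lemma no_common_cut_periodic:
  fixes x :: "int \<Rightarrow> 'a :: finite"
  assumes \<gamma>: "parsing \<gamma> w c x" "parsing \<gamma> w' c' x"
    and C: "finite C" "range w \<subseteq> C" "range w' \<subseteq> C" "\<forall>a\<in>C. \<gamma> a \<noteq> []"
    and el: "\<not> factorization_rank_le (\<gamma> ` C) (card C - 1)"
    and ne: "\<And>i i'. c i \<noteq> c' i'"
  shows "\<exists>p\<ge>1. tr p x = x"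
proof -
  define St where "St p q a \<longleftrightarrow> overhang c c' w x p q a \<or> overhang c' c w' x p q a" for p q a
  have St_clash: "clash (case_option q \<gamma>) (insert None (Some ` C)) n None (Some a)" if "St p q a" for p q a n
    using that overhang_clash[OF \<gamma> C(2,3)] overhang_clash[OF \<gamma>(2,1) C(3,2)] unfolding St_def by blast
  have St_ne: "q \<noteq> []" "\<gamma> a \<noteq> []" if "St p q a" for p q a
    using that parsing_nonempty[OF \<gamma>(1)] parsing_nonempty[OF \<gamma>(2)]
    unfolding St_def overhang_def by (auto simp flip: length_greater_0_conv)
  have St_q: "q = win x p (length q)" if "St p q a" for p q a
    using that unfolding St_def overhang_def by (auto simp: length_win)
  have St_step: "\<exists>b. St (p + int (min (length (\<gamma> a)) (length q)))
      (if length (\<gamma> a) < length q then drop (length (\<gamma> a)) q else drop (length q) (\<gamma> a)) b"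
    if "St p q a" for p q a
    using that overhang_step[OF \<gamma>, of p q a] overhang_step[OF \<gamma>(2,1), of p q a] ne ne[symmetric]
    unfolding St_def by (auto simp: min_def split: if_splits)
  \<comment> \<open>Different letters after one overhang are two distinct clashes at
    \<open>None\<close>. The \<open>card C + 1\<close> words would then have rank at most
    \<open>card C - 1\<close>, and so would the images of \<open>C\<close>, against
    \<open>el\<close>.\<close>
  have det: "a = b" if "St p q a" "St p' q b" for p p' q a b
  proof (rule ccontr)
    assume "a \<noteq> b"
    let ?D = "insert None (Some ` C)" and ?\<delta> = "case_option q \<gamma>"
    let ?n = "\<Sum>d\<in>?D. length (?\<delta> d)"
    have "{None, Some a} \<noteq> {None, Some b}" using \<open>a \<noteq> b\<close> by (auto simp: doubleton_eq_iff)
    moreover have "\<forall>d\<in>?D. ?\<delta> d \<noteq> []" using C(4) St_ne[OF that(1)] by auto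
    ultimately have "factorization_rank_le (?\<delta> ` ?D) (card ?D - 2)"
      using defect_two_clashes[of ?D ?\<delta> ?n None "Some a" None "Some b"]
        St_clash[OF that(1)] St_clash[OF that(2)] C(1) by blast
    moreover have "card ?D - 2 = card C - 1"
      using C(1) by (simp add: card_image)
    moreover have "\<gamma> ` C \<subseteq> ?\<delta> ` ?D" by (auto simp: image_image)
    ultimately show False using el unfolding factorization_rank_le_def by (metis order_trans)
  qed
  \<comment> \<open>Since the overhang determines the letter, equal overhangs evolve equally. The
    induction is on the distance \<open>t\<close>, each step consuming at least one
    position.\<close>
  have same: "x (p + int t) = x (p' + int t)" if "St p q a" "St p' q b" for p p' q a b t
    using that
  proof (induction t arbitrary: p p' q a b rule: less_induct)
    case (less t)
    have ab: "a = b" using det less.prems by blast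
    let ?m = "min (length (\<gamma> a)) (length q)"
      and ?q = "if length (\<gamma> a) < length q then drop (length (\<gamma> a)) q else drop (length q) (\<gamma> a)"
    show ?case
    proof (cases "t < length q")
      case True
      then show ?thesis
        using St_q[OF less.prems(1)] St_q[OF less.prems(2)] by (metis nth_win)
    next
      case False
      obtain a' where 1: "St (p + int ?m) ?q a'" using St_step[OF less.prems(1)] by blast
      obtain b' where 2: "St (p' + int ?m) ?q b'" using St_step[OF less.prems(2)] ab by blast
      have m: "0 < ?m" "?m \<le> t" using St_ne[OF less.prems(1)] False by auto
      then have "x (p + int ?m + int (t - ?m)) = x (p' + int ?m + int (t - ?m))"
        using less.IH[OF _ 1 2, of "t - ?m"] by linarith
      then show ?thesis using m by (simp add: of_nat_diff)
    qed
  qed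
  define L where "L = Max ((\<lambda>a. length (\<gamma> a)) ` C)"
  have L: "length (\<gamma> (w i)) \<le> L" "length (\<gamma> (w' i)) \<le> L" for i
    using C unfolding L_def by (auto intro!: Max_ge imageI)
  define Q where "Q = {q :: 'a list. length q \<le> L}"
  have finQ: "finite Q" unfolding Q_def using finite_lists_length_le[of "UNIV :: 'a set" L] by simp
  have "\<exists>q. St (c i) q (w i) \<and> q \<in> Q" for i
  proof -
    obtain j where j: "c' j \<le> c i" "c i < c' (j + 1)" using parsing_index_exists[OF \<gamma>(2)] by blast
    then have "c' j < c i" using ne[of i j] by simp
    then have "overhang c c' w x (c i) (win x (c i) (nat (c' (j + 1) - c i))) (w i)"
      unfolding overhang_def using j by (intro exI[of _ i] exI[of _ "j + 1"]) auto
    moreover have "nat (c' (j + 1) - c i) \<le> L"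
      using parsing_cut[OF \<gamma>(2), of j] L(2)[of j] j by linarith
    ultimately show ?thesis unfolding St_def Q_def by (intro exI) auto
  qed
  then obtain q where q: "\<And>i. St (c i) (q i) (w i)" "\<And>i. q i \<in> Q" by metis
  define K where "K = card Q"
  have cdiff: "c (i + int n) - c i \<le> int (n * L)" for i n
  proof (induction n)
    case (Suc n)
    have "c (i + int (Suc n)) = c (i + int n) + int (length (\<gamma> (w (i + int n))))"
      using parsing_cut[OF \<gamma>(1), of "i + int n"] by (simp add: algebra_simps)
    then show ?case using Suc L(1)[of "i + int n"] by (simp add: algebra_simps)
  qed simp
  \<comment> \<open>The periods found below depend on \<open>i\<close> but never exceed
    \<open>K * L\<close>; the factorial is a multiple of all of them.\<close>
  define M where "M = int (fact (K * L))"
  have per: "x (t + M) = x t" if "c (i + int K) \<le> t" for i t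
  proof -
    \<comment> \<open>Pigeonhole: among \<open>K + 1\<close> consecutive cuts two carry the same
      overhang, and their distance is a period to the right.\<close>
    have "\<not> inj_on (\<lambda>n. q (i + int n)) {..K}"
    proof
      assume "inj_on (\<lambda>n. q (i + int n)) {..K}"
      then have "card {..K} \<le> card Q" using q(2) finQ by (intro card_inj_on_le) auto
      then show False by (simp add: K_def)
    qed
    then obtain m n where mn: "m < n" "n \<le> K" "q (i + int m) = q (i + int n)"
      unfolding inj_on_def by (metis atMost_iff linorder_neqE_nat)
    define d where "d = c (i + int n) - c (i + int m)"
    have d: "0 < d" using parsing_strict_mono[OF \<gamma>(1)] mn by (simp add: d_def)
    have "d \<le> int ((n - m) * L)" using cdiff[of "i + int m" "n - m"] mn by (simp add: d_def of_nat_diff)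
    also have "\<dots> \<le> int (K * L)" using mn by (intro of_nat_mono mult_le_mono1) simp
    finally have "nat d \<le> K * L" by (simp only: nat_le_iff)
    then have "nat d dvd fact (K * L)" using d by (intro dvd_fact) auto
    then obtain k where k: "fact (K * L) = nat d * k" by blast
    have M: "M = int k * d" using d k by (simp add: M_def algebra_simps)
    have step: "x (s + d) = x s" if "c (i + int m) \<le> s" for s
    proof -
      have "St (c (i + int n)) (q (i + int m)) (w (i + int n))" using q(1) mn(3) by metis
      from same[OF this q(1), of "nat (s - c (i + int m))"] show ?thesis
        using that by (simp add: d_def algebra_simps)
    qed
    have "x (s + int l * d) = x s" if "c (i + int m) \<le> s" for s l
    proof (induction l)
      case (Suc l)
      have "c (i + int m) \<le> s + int l * d" using that d by (simp add: add_increasing2)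
      from step[OF this] show ?case using Suc by (simp add: algebra_simps)
    qed simp
    moreover have "c (i + int m) \<le> t"
      using that parsing_le_iff[OF \<gamma>(1), of "i + int m" "i + int K"] mn by simp
    ultimately show ?thesis by (simp add: M)
  qed
  have "tr M x = x"
  proof
    fix t
    \<comment> \<open>Starting far enough to the left, the half-line on which \<open>M\<close> is a
      period contains any given \<open>t\<close>.\<close>
    define n where "n = nat (\<bar>c 0\<bar> + \<bar>t\<bar>)"
    have "c (- int n) + int n \<le> c 0" using parsing_cut_ge[OF \<gamma>(1), of "- int n" n] by simp
    moreover have "int n = \<bar>c 0\<bar> + \<bar>t\<bar>" by (simp add: n_def)
    ultimately have "c (- int n - int K + int K) \<le> t" by simp
    from per[OF this] show "tr M x t = x t" by (simp add: tr_def)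
  qed
  moreover have "M \<ge> 1" by (simp add: M_def)
  ultimately show ?thesis by blast
qed

theorem elementary_recognizable:
  fixes x :: "int \<Rightarrow> 'a :: finite"
  assumes \<gamma>: "parsing \<gamma> w c x" "parsing \<gamma> w' c' x"
    and C: "finite C" "range w \<subseteq> C" "range w' \<subseteq> C" "\<forall>a\<in>C. \<gamma> a \<noteq> []"
    and el: "\<not> factorization_rank_le (\<gamma> ` C) (card C - 1)"
    and aper: "\<forall>p\<ge>1. tr p x \<noteq> x"
  shows "\<exists>s. w' = tr s w \<and> c' = (\<lambda>j. c (j + s))"
  using parsing_aligned[OF \<gamma> C el] no_common_cut_periodic[OF \<gamma> C el] aper by metis

section \<open>Recognizability\<close>

lemma ext_ext: "ext \<gamma> (ext \<delta> u) = ext (\<lambda>a. ext \<gamma> (\<delta> a)) u"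
  by (induction u) auto

lemma ext_nth:
  assumes "i < length u" "t < length (\<gamma> (u ! i))"
  shows "ext \<gamma> u ! (length (ext \<gamma> (take i u)) + t) = \<gamma> (u ! i) ! t"
proof -
  have "ext \<gamma> u = ext \<gamma> (take i u) @ \<gamma> (u ! i) @ ext \<gamma> (drop (Suc i) u)"
    using assms(1) by (metis append.assoc concat.simps(2) concat_append id_take_nth_drop list.map(2) map_append)
  then show ?thesis using assms(2) by (simp add: nth_append)
qed

lemma ext_index:
  "t < length (ext \<gamma> u) \<Longrightarrow>
     \<exists>j<length u. length (ext \<gamma> (take j u)) \<le> t \<and> t < length (ext \<gamma> (take (Suc j) u))"
proof (induction u arbitrary: t)
  case (Cons a u)
  show ?case
  proof (cases "t < length (\<gamma> a)")
    case True
    then show ?thesis by (intro exI[of _ 0]) auto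
  next
    case False
    then obtain j where "j < length u" "length (ext \<gamma> (take j u)) \<le> t - length (\<gamma> a)"
      "t - length (\<gamma> a) < length (ext \<gamma> (take (Suc j) u))"
    proof -
      have "t - length (\<gamma> a) < length (ext \<gamma> u)" using False Cons.prems by simp
      from Cons.IH[OF this] show ?thesis using that by blast
    qed
    then show ?thesis using False by (intro exI[of _ "Suc j"]) auto
  qed
qed simp

text \<open>A diagonal choice: there are finitely many central windows of each radius, so an
  infinite index set can be thinned out again and again.\<close>

lemma compact_pointwise:
  fixes f :: "nat \<Rightarrow> int \<Rightarrow> 'b :: finite"
  assumes "infinite I"
  shows "\<exists>g. \<forall>N. infinite {n \<in> I. \<forall>t. \<bar>t\<bar> \<le> int N \<longrightarrow> f n t = g t}"
proof -
  let ?S = "\<lambda>N g. {n \<in> I. \<forall>t. \<bar>t\<bar> \<le> int N \<longrightarrow> f n t = g t}"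
  have ex: "\<exists>m\<in>A. infinite {n \<in> A. \<forall>t. \<bar>t\<bar> \<le> int N \<longrightarrow> f n t = f m t}" if "infinite A" for A N
  proof -
    let ?w = "\<lambda>n. win (f n) (- int N) (2 * N + 1)"
    have "finite (?w ` A)"
      by (rule finite_subset[OF _ finite_lists_length_eq[of UNIV "2 * N + 1"]]) auto
    from pigeonhole_infinite[OF that this]
    obtain m where m: "m \<in> A" "infinite {n \<in> A. ?w n = ?w m}" by blast
    have "{n \<in> A. ?w n = ?w m} \<subseteq> {n \<in> A. \<forall>t. \<bar>t\<bar> \<le> int N \<longrightarrow> f n t = f m t}"
    proof safe
      fix n t assume eq: "?w n = ?w m" and t: "\<bar>t\<bar> \<le> int N"
      have "?w n ! nat (t + int N) = ?w m ! nat (t + int N)" using eq by simp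
      moreover have "int (nat (t + int N)) = t + int N" "nat (t + int N) < 2 * N + 1" using t by auto
      ultimately show "f n t = f m t" by simp
    qed
    then show ?thesis using m by (metis (no_types, lifting) finite_subset)
  qed
  have "\<exists>G. \<forall>N. infinite (?S N (G N)) \<and> (\<forall>t. \<bar>t\<bar> \<le> int N \<longrightarrow> G (Suc N) t = G N t)"
  proof (rule dependent_nat_choice)
    show "\<exists>g. infinite (?S 0 g)"
      using ex[OF assms, of 0] by blast
  next
    fix g N assume inf: "infinite (?S N g)"
    obtain m where m: "m \<in> ?S N g" "infinite {n \<in> ?S N g. \<forall>t. \<bar>t\<bar> \<le> int (Suc N) \<longrightarrow> f n t = f m t}"
      using ex[OF inf, of "Suc N"] by blast
    have "{n \<in> ?S N g. \<forall>t. \<bar>t\<bar> \<le> int (Suc N) \<longrightarrow> f n t = f m t} \<subseteq> ?S (Suc N) (f m)" by blast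
    then have "infinite (?S (Suc N) (f m))" using m(2) finite_subset by blast
    moreover have "\<forall>t. \<bar>t\<bar> \<le> int N \<longrightarrow> f m t = g t" using m(1) by blast
    ultimately show "\<exists>g'. infinite (?S (Suc N) g') \<and> (\<forall>t. \<bar>t\<bar> \<le> int N \<longrightarrow> g' t = g t)" by blast
  qed
  then obtain G where G: "\<And>N. infinite (?S N (G N))"
    "\<And>N t. \<bar>t\<bar> \<le> int N \<Longrightarrow> G (Suc N) t = G N t" by blast
  \<comment> \<open>The functions \<open>G N\<close> extend one another, so the value at
    \<open>t\<close> is read from the first one that covers \<open>t\<close>.\<close>
  define g where "g t = G (nat \<bar>t\<bar>) t" for t
  have "G (nat \<bar>t\<bar> + k) t = g t" for t k
    by (induction k) (auto simp: g_def G(2))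
  then have "G N t = g t" if "\<bar>t\<bar> \<le> int N" for N t
    using that by (metis le_add_diff_inverse nat_le_iff)
  then have eq: "?S N (G N) = ?S N g" for N by auto
  have "infinite (?S N g)" for N using G(1)[of N] unfolding eq .
  then show ?thesis by blast
qed

lemma parsing_range:
  assumes "parsing \<gamma> w c x"
  shows "\<exists>i. x t \<in> set (\<gamma> (w i))"
proof -
  obtain i where i: "c i \<le> t" "t < c (i + 1)" using parsing_index_exists[OF assms] by blast
  have "nat (t - c i) < length (\<gamma> (w i))" using i parsing_cut[OF assms, of i] by auto
  from parsing_nth[OF assms this] show ?thesis using i nth_mem[OF \<open>nat (t - c i) < _\<close>] by auto
qed

section \<open>Powers of the substitution, existence and uniqueness of desubstitutions\<close>

locale aperiodic_substitution =
  fixes \<sigma> :: "'a :: finite \<Rightarrow> 'a list"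
  assumes substitution: "substitution \<sigma>"
    and aperiodic: "aperiodic \<sigma>"
    and growth: "\<And>a. filterlim (\<lambda>n. length (subst_power \<sigma> n a)) at_top sequentially"
begin

abbreviation "P \<equiv> subst_power \<sigma>"
abbreviation "X \<equiv> subst_shift_space \<sigma>"

lemma \<sigma>_nonempty: "\<sigma> a \<noteq> []"
  using substitution by (simp add: substitution_def)

lemma P_0 [simp]: "P 0 a = [a]"
  by (simp add: subst_power_def)

lemma P_Suc: "P (Suc n) a = ext \<sigma> (P n a)"
  by (simp add: subst_power_def subst_word_def)

lemma subst_word_funpow: "(subst_word \<sigma> ^^ n) u = ext (P n) u"
proof (induction n)
  case 0
  show ?case by (induction u) auto
qed (simp add: subst_word_def ext_ext P_Suc)

lemma P_Suc_right: "P (Suc n) a = ext (P n) (\<sigma> a)"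
  using subst_word_funpow[of n "\<sigma> a"] unfolding subst_power_def
  by (simp add: funpow_swap1 subst_word_def)

lemma P_nonempty: "P n a \<noteq> []"
  by (induction n) (auto simp: P_Suc \<sigma>_nonempty)

lemma sublist_language: "sublist u v \<Longrightarrow> v \<in> language \<sigma> \<Longrightarrow> u \<in> language \<sigma>"
  unfolding language_def using sublist_order.order.trans by blast

lemma in_X_iff: "x \<in> X \<longleftrightarrow> (\<forall>i n. win x i n \<in> language \<sigma>)"
proof
  assume x: "x \<in> X"
  show "\<forall>i n. win x i n \<in> language \<sigma>"
  proof (intro allI)
    fix i n
    define m where "m = nat (\<bar>i\<bar> + int n)"
    have m: "int m = \<bar>i\<bar> + int n" by (simp add: m_def)
    have "map x [- int m..int m] \<in> language \<sigma>" using x by (simp add: subst_shift_space_def)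
    moreover have "nat (int m - - int m + 1) = 2 * m + 1" by simp
    ultimately have "win x (- int m) (2 * m + 1) \<in> language \<sigma>"
      by (simp only: map_upto_win)
    moreover have "sublist (win x i n) (win x (- int m) (2 * m + 1))"
      using m by (intro sublist_win) auto
    ultimately show "win x i n \<in> language \<sigma>" using sublist_language by blast
  qed
qed (simp add: subst_shift_space_def map_upto_win)

lemma tr_in_X: "x \<in> X \<Longrightarrow> tr n x \<in> X"
  by (simp add: in_X_iff win_tr)

lemma tr_in_X_iff: "tr n x \<in> X \<longleftrightarrow> x \<in> X"
  using tr_in_X[of "tr n x" "- n"] tr_in_X by auto

lemma X_aperiodic: "x \<in> X \<Longrightarrow> p \<ge> 1 \<Longrightarrow> tr p x \<noteq> x"
  using aperiodic[unfolded aperiodic_def] funpow_shift[of "nat p" x]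
  by (auto dest!: bspec[of _ _ x] spec[of _ "nat p"])

lemma tr_inj:
  assumes "x \<in> X" "tr m x = tr n x"
  shows "m = n"
proof (rule ccontr)
  have *: "tr (j - i) x = x" if "tr i x = tr j x" for i j
    using arg_cong[OF that, of "tr (- i)"] by simp
  assume "m \<noteq> n"
  then show False
    using *[of m n] *[of n m] assms X_aperiodic[of x "n - m"] X_aperiodic[of x "m - n"]
    by (cases "m < n") auto
qed

definition maxlen :: nat where
  "maxlen = Max (range (\<lambda>a. length (\<sigma> a)))"

lemma length_\<sigma>_le: "length (\<sigma> a) \<le> maxlen"
  by (simp add: maxlen_def)

lemma length_\<sigma>_pos: "0 < length (\<sigma> a)"
  by (simp add: \<sigma>_nonempty)

lemma maxlen_pos: "0 < maxlen"
  using length_\<sigma>_le[of undefined] length_\<sigma>_pos[of undefined] by linarith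

lemma length_ext_\<sigma>_le: "length (ext \<sigma> u) \<le> maxlen * length u"
  by (induction u) (auto simp: length_\<sigma>_le add_mono)

lemma abs_cuts_le: "\<bar>cuts \<sigma> y i\<bar> \<le> int maxlen * \<bar>i\<bar>"
proof (cases i rule: int_cases2)
  case (nonneg n)
  then show ?thesis using length_ext_\<sigma>_le[of "win y 0 n"] by (simp add: cuts_def flip: of_nat_mult)
next
  case (nonpos n)
  then show ?thesis using length_ext_\<sigma>_le[of "win y i n"] by (simp add: cuts_def flip: of_nat_mult)
qed

text \<open>Compactness turns approximate desubstitutions of \<open>x\<close> into an exact one.
  This serves twice: for existence, with \<open>y n\<close> taken from words of the language, and
  for continuity, with \<open>y n\<close> the desubstitutions of points near \<open>x\<close>. The
  infinitely many indices in the conclusion are for the second use.\<close>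

lemma parsing_limit:
  assumes k: "\<And>n. k n < length (\<sigma> (y n 0))"
    and lang: "\<And>N. \<forall>\<^sub>F n in sequentially. win (y n) (- int N) (2 * N + 1) \<in> language \<sigma>"
    and x: "\<And>N. \<forall>\<^sub>F n in sequentially. \<forall>i t. \<bar>i\<bar> \<le> int N \<longrightarrow> t < length (\<sigma> (y n i)) \<longrightarrow>
      x (cuts \<sigma> (y n) i - int (k n) + int t) = \<sigma> (y n i) ! t"
  shows "\<exists>z j. z \<in> X \<and> j < length (\<sigma> (z 0)) \<and> parsing \<sigma> z (\<lambda>i. cuts \<sigma> z i - int j) x \<and>
    (\<forall>N. infinite {n. k n = j \<and> (\<forall>t. \<bar>t\<bar> \<le> int N \<longrightarrow> y n t = z t)})"
proof -
  have "k ` UNIV \<subseteq> {..<maxlen}" using k length_\<sigma>_le by (fastforce intro: less_le_trans)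
  then have "finite (k ` UNIV)" using finite_subset by blast
  from pigeonhole_infinite[OF infinite_UNIV_nat this]
  obtain j where j: "infinite {n. k n = j}" by auto
  obtain z where "\<And>N. infinite {n \<in> {n. k n = j}. \<forall>t. \<bar>t\<bar> \<le> int N \<longrightarrow> y n t = z t}"
    using compact_pointwise[OF j, of y] by blast
  then have z: "infinite {n. k n = j \<and> (\<forall>t. \<bar>t\<bar> \<le> int N \<longrightarrow> y n t = z t)}" for N by simp
  have ev: "\<exists>n. k n = j \<and> (\<forall>t. \<bar>t\<bar> \<le> int N \<longrightarrow> y n t = z t) \<and> Q n"
    if "\<forall>\<^sub>F n in sequentially. Q n" for N Q
  proof -
    obtain m where m: "\<And>n. m \<le> n \<Longrightarrow> Q n" using \<open>\<forall>\<^sub>F n in sequentially. Q n\<close> by (auto simp: eventually_sequentially)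
    obtain n where "n > m" "k n = j" "\<forall>t. \<bar>t\<bar> \<le> int N \<longrightarrow> y n t = z t"
      using z[of N] unfolding infinite_nat_iff_unbounded by blast
    then show ?thesis using m[of n] by auto
  qed
  have "z \<in> X"
    unfolding in_X_iff
  proof (intro allI)
    fix i n
    define m where "m = nat (\<bar>i\<bar> + int n)"
    have m: "int m = \<bar>i\<bar> + int n" by (simp add: m_def)
    obtain l where l: "\<forall>t. \<bar>t\<bar> \<le> int m \<longrightarrow> y l t = z t" "win (y l) (- int m) (2 * m + 1) \<in> language \<sigma>"
      using ev[OF lang[of m], of m] by blast
    have "win (y l) i n = win z i n" using l(1) m by (intro win_cong) auto
    moreover have "sublist (win (y l) i n) (win (y l) (- int m) (2 * m + 1))"
      using m by (intro sublist_win) auto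
    ultimately show "win z i n \<in> language \<sigma>" using l(2) sublist_language by metis
  qed
  moreover have "j < length (\<sigma> (z 0))"
  proof -
    obtain n where "k n = j" "\<forall>t. \<bar>t\<bar> \<le> int 0 \<longrightarrow> y n t = z t" using ev[of "\<lambda>_. True" 0] by auto
    then show ?thesis using k[of n] by auto
  qed
  moreover have "parsing \<sigma> z (\<lambda>i. cuts \<sigma> z i - int j) x"
    unfolding parsing_def
  proof (intro allI conjI)
    fix i
    define N where "N = nat \<bar>i\<bar>"
    have N: "int N = \<bar>i\<bar>" by (simp add: N_def)
    obtain n where n: "k n = j" "\<forall>t. \<bar>t\<bar> \<le> int N \<longrightarrow> y n t = z t"
      "\<forall>i t. \<bar>i\<bar> \<le> int N \<longrightarrow> t < length (\<sigma> (y n i)) \<longrightarrow>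
        x (cuts \<sigma> (y n) i - int (k n) + int t) = \<sigma> (y n i) ! t"
      using ev[OF x[of N], of N] by blast
    have c: "cuts \<sigma> (y n) i = cuts \<sigma> z i" using n(2) N by (intro cuts_cong) auto
    have "y n i = z i" using n(2) N by auto
    then show "win x (cuts \<sigma> z i - int j) (length (\<sigma> (z i))) = \<sigma> (z i)"
      using n(1,3) N c by (intro nth_equalityI) auto
  qed (auto simp: \<sigma>_nonempty cuts_Suc)
  ultimately show ?thesis using z by blast
qed

lemma desubstitution_exists:
  assumes x: "x \<in> X"
  shows "\<exists>z j. z \<in> X \<and> j < length (\<sigma> (z 0)) \<and> parsing \<sigma> z (\<lambda>i. cuts \<sigma> z i - int j) x"
proof -
  \<comment> \<open>Approximation of order \<open>n\<close>. Blocks of index at most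
    \<open>N\<close> lie within \<open>(N + 2) * maxlen\<close> of the origin: \<open>N\<close>
    blocks, the offset \<open>k\<close> and the position \<open>t\<close> inside a block.\<close>
  define Q where "Q n y k \<longleftrightarrow> k < length (\<sigma> (y 0)) \<and> (\<forall>N. (N + 2) * maxlen \<le> n \<longrightarrow>
      win y (- int N) (2 * N + 1) \<in> language \<sigma> \<and>
      (\<forall>i t. \<bar>i\<bar> \<le> int N \<longrightarrow> t < length (\<sigma> (y i)) \<longrightarrow> x (cuts \<sigma> y i - int k + int t) = \<sigma> (y i) ! t))"
    for n y k
  have "\<exists>y k. Q n y k" for n
  proof -
    \<comment> \<open>The extra \<open>maxlen\<close> makes the window longer than every
      \<open>\<sigma> a\<close>; it therefore occurs in \<open>P m a\<close> with
      \<open>m \<ge> 2\<close>, and its ancestor \<open>u\<close> is again a word of the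
      language.\<close>
    define n' where "n' = n + maxlen"
    obtain a m where m: "m \<ge> 1" "sublist (win x (- int n') (2 * n' + 1)) (P m a)"
      using x unfolding in_X_iff language_def by blast
    have "m \<noteq> 1"
    proof
      assume "m = 1"
      then have "2 * n' + 1 \<le> length (\<sigma> a)"
        using sublist_length_le[OF m(2)] by (simp add: P_Suc)
      then show False using length_\<sigma>_le[of a] by (simp add: n'_def)
    qed
    then obtain m' where m': "m = Suc m'" "m' \<ge> 1" using m(1) by (cases m) auto
    define u where "u = P m' a"
    have u: "u \<in> language \<sigma>" using m'(2) by (auto simp: language_def u_def)
    obtain pre post where ps: "ext \<sigma> u = pre @ win x (- int n') (2 * n' + 1) @ post"
      using m(2) by (auto simp: m'(1) P_Suc u_def sublist_def)
    \<comment> \<open>The position of the origin of \<open>x\<close> in the image of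
      \<open>u\<close>; below, \<open>j\<close> is the index of its block.\<close>
    define t0 where "t0 = length pre + n'"
    have len: "t0 + n' + 1 \<le> length (ext \<sigma> u)" by (simp add: ps t0_def)
    then obtain j where j: "j < length u" "length (ext \<sigma> (take j u)) \<le> t0"
      "t0 < length (ext \<sigma> (take (Suc j) u))"
      using ext_index[of t0 \<sigma> u] by auto
    define k where "k = t0 - length (ext \<sigma> (take j u))"
    \<comment> \<open>Outside \<open>u\<close> the letter \<open>a\<close> is a filler; the bound on
      \<open>N\<close> keeps the indices tested by \<open>Q\<close> inside \<open>u\<close>.\<close>
    define y where "y i = (if 0 \<le> int j + i \<and> int j + i < int (length u) then u ! nat (int j + i) else a)" for i
    have x_nth: "x s = ext \<sigma> u ! nat (int t0 + s)" if "\<bar>s\<bar> \<le> int n'" for s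
    proof -
      have "nat (int t0 + s) = length pre + nat (int n' + s)" "nat (int n' + s) < 2 * n' + 1"
        "int (nat (int n' + s)) = int n' + s"
        using that by (auto simp: t0_def)
      then show ?thesis by (simp add: ps nth_append)
    qed
    have y0: "y 0 = u ! j" using j by (simp add: y_def)
    have k: "k < length (\<sigma> (y 0))"
      using j y0 by (simp add: k_def take_Suc_conv_app_nth)
    have "win y (- int N) (2 * N + 1) \<in> language \<sigma> \<and>
      (\<forall>i t. \<bar>i\<bar> \<le> int N \<longrightarrow> t < length (\<sigma> (y i)) \<longrightarrow> x (cuts \<sigma> y i - int k + int t) = \<sigma> (y i) ! t)"
      if N: "(N + 2) * maxlen \<le> n" for N
    proof -
      have "(N + 2) * maxlen < (j + 1) * maxlen"
        using N j(3) length_ext_\<sigma>_le[of "take (Suc j) u"] j(1)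
        by (simp add: t0_def n'_def algebra_simps)
      then have "N + 2 < j + 1" by (simp only: mult_less_cancel2)
      then have jN: "N + 1 < j" by simp
      have "ext \<sigma> u = ext \<sigma> (take j u) @ ext \<sigma> (drop j u)"
        by (metis append_take_drop_id concat_append map_append)
      then have "length (ext \<sigma> u) \<le> length (ext \<sigma> (take j u)) + maxlen * (length u - j)"
        using length_ext_\<sigma>_le[of "drop j u"] by simp
      then have "(N + 2) * maxlen < (length u - j) * maxlen"
        using N len j(2) by (simp add: n'_def algebra_simps)
      then have "N + 2 < length u - j" by (simp only: mult_less_cancel2)
      then have uN: "j + N < length u" by simp
      have yi: "y i = u ! nat (int j + i)" if "\<bar>i\<bar> \<le> int N" for i
        using that jN uN by (auto simp: y_def)
      have "win y (- int N) (2 * N + 1) = take (2 * N + 1) (drop (j - N) u)"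
      proof (rule nth_equalityI)
        fix l assume "l < length (win y (- int N) (2 * N + 1))"
        then show "win y (- int N) (2 * N + 1) ! l = take (2 * N + 1) (drop (j - N) u) ! l"
          using yi[of "- int N + int l"] jN uN
          by (simp add: of_nat_diff nat_add_distrib nat_diff_distrib algebra_simps)
      qed (use jN uN in auto)
      moreover have "sublist (take (2 * N + 1) (drop (j - N) u)) u"
        by (meson sublist_drop sublist_order.order.trans sublist_take)
      ultimately have lang: "win y (- int N) (2 * N + 1) \<in> language \<sigma>"
        using u sublist_language by metis
      have cut: "cuts \<sigma> y i - int k = int (length (ext \<sigma> (take (nat (int j + i)) u))) - int t0"
        if i: "\<bar>i\<bar> \<le> int N" for i
      proof (cases "0 \<le> i")
        case True
        define l where "l = nat i"
        have l: "i = int l" "l \<le> N" using True i by (auto simp: l_def)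
        have "win y 0 l = take l (drop j u)"
          using l uN by (intro nth_equalityI) (auto simp: yi nat_add_distrib)
        moreover have "nat (int j + i) = j + l" using l by simp
        ultimately show ?thesis using j(2) l by (simp add: cuts_def k_def take_add of_nat_diff)
      next
        case False
        define l where "l = nat (- i)"
        have l: "i = - int l" "l \<le> N" "0 < l" using False i by (auto simp: l_def)
        have jl: "nat (int j + i) = j - l" using l jN by simp
        have "win y i l = drop (j - l) (take j u)"
        proof (rule nth_equalityI)
          fix q assume "q < length (win y i l)"
          then have q: "q < l" by simp
          have "nat (int j + (i + int q)) = j - l + q" using l jN q by simp
          then show "win y i l ! q = drop (j - l) (take j u) ! q"
            using q l jN uN yi[of "i + int q"] by simp
        qed (use jN uN l in auto)
        then have "take j u = take (j - l) u @ win y i l"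
          by (metis append_take_drop_id diff_le_self min.absorb1 take_take)
        then have "length (ext \<sigma> (take j u)) = length (ext \<sigma> (take (j - l) u)) + length (ext \<sigma> (win y i l))"
          by simp
        then show ?thesis using l j(2) jl by (simp add: cuts_def k_def of_nat_diff)
      qed
      have "x (cuts \<sigma> y i - int k + int t) = \<sigma> (y i) ! t" if i: "\<bar>i\<bar> \<le> int N" and t: "t < length (\<sigma> (y i))" for i t
      proof -
        have "int maxlen * \<bar>i\<bar> \<le> int maxlen * int N" using i by (intro mult_left_mono) auto
        moreover have "int maxlen * int N + 2 * int maxlen \<le> int n"
          using of_nat_mono[OF N, where 'a = int] by (simp add: algebra_simps)
        moreover have "int n' = int n + int maxlen" by (simp add: n'_def)
        moreover have "int k < int maxlen" using k length_\<sigma>_le[of "y 0"] by linarith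
        moreover have "int t < int maxlen" using t length_\<sigma>_le[of "y i"] by linarith
        ultimately have "\<bar>cuts \<sigma> y i - int k + int t\<bar> \<le> int n'"
          using abs_cuts_le[of y i] by linarith
        then have "x (cuts \<sigma> y i - int k + int t) = ext \<sigma> u ! nat (int t0 + (cuts \<sigma> y i - int k + int t))"
          by (rule x_nth)
        also have "nat (int t0 + (cuts \<sigma> y i - int k + int t)) = length (ext \<sigma> (take (nat (int j + i)) u)) + t"
          using cut[OF i] by simp
        also have "ext \<sigma> u ! \<dots> = \<sigma> (y i) ! t"
          using ext_nth[of "nat (int j + i)" u t \<sigma>] t i yi[OF i] jN uN by simp
        finally show ?thesis .
      qed
      then show ?thesis using lang by blast
    qed
    then show ?thesis using k unfolding Q_def by blast
  qed
  then obtain y k where Q: "\<And>n. Q n (y n) (k n)" by metis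
  have Q': "k n < length (\<sigma> (y n 0))" "(N + 2) * maxlen \<le> n \<Longrightarrow> win (y n) (- int N) (2 * N + 1) \<in> language \<sigma>"
    "(N + 2) * maxlen \<le> n \<Longrightarrow> \<forall>i t. \<bar>i\<bar> \<le> int N \<longrightarrow> t < length (\<sigma> (y n i)) \<longrightarrow>
      x (cuts \<sigma> (y n) i - int (k n) + int t) = \<sigma> (y n i) ! t" for n N
    using Q[of n] unfolding Q_def by blast+
  have ev: "\<forall>\<^sub>F n in sequentially. (N + 2) * maxlen \<le> n" for N by (rule eventually_ge_at_top)
  have "\<forall>\<^sub>F n in sequentially. win (y n) (- int N) (2 * N + 1) \<in> language \<sigma>" for N
    by (rule eventually_mono[OF ev[of N] Q'(2)])
  moreover have "\<forall>\<^sub>F n in sequentially. \<forall>i t. \<bar>i\<bar> \<le> int N \<longrightarrow> t < length (\<sigma> (y n i)) \<longrightarrow>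
      x (cuts \<sigma> (y n) i - int (k n) + int t) = \<sigma> (y n i) ! t" for N
    by (rule eventually_mono[OF ev[of N] Q'(3)])
  ultimately show ?thesis using parsing_limit[of k y x, OF Q'(1)] by blast
qed

lemma lift_exists:
  assumes "x \<in> X"
  shows "\<exists>z\<in>X. \<exists>c. parsing (P n) z c x"
  using assms
proof (induction n arbitrary: x)
  case 0
  have "parsing (P 0) x (\<lambda>i. i) x" by (simp add: parsing_def win_def)
  then show ?case using 0 by blast
next
  case (Suc n)
  obtain y j where y: "y \<in> X" "parsing \<sigma> y (\<lambda>i. cuts \<sigma> y i - int j) x"
    using desubstitution_exists[OF Suc.prems] by blast
  obtain z c where z: "z \<in> X" "parsing (P n) z c y" using Suc.IH[OF y(1)] by blast
  have "parsing (\<lambda>a. ext \<sigma> (P n a)) z (\<lambda>i. cuts \<sigma> y (c i) - int j) x"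
    using parsing_comp[OF z(2) y(2)] by simp
  then have "parsing (P (Suc n)) z (\<lambda>i. cuts \<sigma> y (c i) - int j) x"
    by (simp add: P_Suc[abs_def])
  then show ?case using z(1) by blast
qed

text \<open>A parsing into blocks \<open>P n a\<close> is refined by cutting each block into words
  of \<open>F\<close>. These words are themselves the letters of a bi-infinite word, with the
  identity as morphism. The point rebuilt from them has the same \<open>P n\<close> parsing as
  \<open>y\<close>, so it is \<open>y\<close>.\<close>

lemma factor_parsing_exists:
  assumes "y \<in> X" "[] \<notin> F" "\<And>a. P n a \<in> concat ` lists F"
  shows "\<exists>w g. range w \<subseteq> F \<and> parsing (\<lambda>f. f) w g y"
proof -
  have "\<exists>fs. P n a = concat fs \<and> set fs \<subseteq> F" for a
    using assms(3)[of a] by (auto simp: in_lists_conv_set)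
  then obtain \<beta> where \<beta>: "\<And>a. P n a = concat (\<beta> a)" "\<And>a. set (\<beta> a) \<subseteq> F" by metis
  have \<beta>_ne: "\<beta> a \<noteq> []" for a using \<beta>(1)[of a] P_nonempty[of n a] by auto
  obtain z e where z: "parsing (P n) z e y" using lift_exists[OF assms(1)] by blast
  obtain w where w: "parsing \<beta> z (\<lambda>i. cuts \<beta> z i + 0) w"
    using parsing_exists[of \<beta> z 0] \<beta>_ne by auto
  have wF: "w i \<in> F" for i using parsing_range[OF w, of i] \<beta>(2) by blast
  then have "w i \<noteq> []" for i using assms(2) by metis
  then obtain y' where y': "parsing (\<lambda>f. f) w (\<lambda>i. cuts (\<lambda>f. f) w i + e 0) y'"
    using parsing_exists[of "\<lambda>f. f" w "e 0"] by auto
  have p: "parsing (P n) z (\<lambda>i. cuts (\<lambda>f. f) w (cuts \<beta> z i + 0) + e 0) y'"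
    using parsing_comp[OF w y'] by (simp add: \<beta>(1)[abs_def])
  have "cuts (\<lambda>f. f) w (cuts \<beta> z i + 0) + e 0 = e i" for i
    using parsing_cuts[OF p, of i] parsing_cuts[OF z, of i] by simp
  then have "y' = y" using p z parsing_image_unique[of "P n" z e y' y] by presburger
  then show ?thesis using y' wF by blast
qed

theorem recognizable:
  assumes x: "x \<in> X" and y: "y \<in> X" "parsing \<sigma> y c x" "c 0 \<le> 0" "0 < c 1"
    and y': "y' \<in> X" "parsing \<sigma> y' c' x" "c' 0 \<le> 0" "0 < c' 1"
  shows "y = y' \<and> c = c'"
proof -
  \<comment> \<open>The power is part of the quantification because the minimality argument passes
    from \<open>n\<close> to \<open>Suc n\<close>.\<close>
  define R where "R r \<longleftrightarrow> (\<exists>n F. finite F \<and> card F = r \<and> [] \<notin> F \<and> (\<forall>a. P n a \<in> concat ` lists F))" for r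
  have "R (card (range (\<lambda>a::'a. [a])))"
    unfolding R_def
  proof (intro exI[of _ 0] exI[of _ "range (\<lambda>a::'a. [a])"] conjI allI)
    show "P 0 a \<in> concat ` lists (range (\<lambda>a::'a. [a]))" for a
      using subset_concat_lists[of "range (\<lambda>a::'a. [a])"] by auto
  qed auto
  then have "R (LEAST r. R r)" by (rule LeastI)
  then obtain n F where F: "finite F" "card F = (LEAST r. R r)" "[] \<notin> F" "\<And>a. P n a \<in> concat ` lists F"
    unfolding R_def by blast
  \<comment> \<open>Fewer words for the images of \<open>F\<close> would factor
    \<open>P (Suc n)\<close>, against the choice of the least \<open>r\<close>.\<close>
  have el: "\<not> factorization_rank_le (ext \<sigma> ` F) (card F - 1)"
  proof
    assume "factorization_rank_le (ext \<sigma> ` F) (card F - 1)"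
    then obtain F' where F': "finite F'" "card F' \<le> card F - 1" "[] \<notin> F'"
      "ext \<sigma> ` F \<subseteq> concat ` lists F'"
      unfolding factorization_rank_le_def by blast
    have "P (Suc n) a \<in> concat ` lists F'" for a
    proof -
      obtain fs where fs: "P n a = concat fs" "fs \<in> lists F" using F(4) by blast
      have "P (Suc n) a = ext (ext \<sigma>) fs" unfolding P_Suc fs(1) by (induction fs) auto
      also have "\<dots> \<in> concat ` lists F'"
        by (rule ext_in_concat_lists) (use fs(2) F'(4) in blast)
      finally show ?thesis .
    qed
    then have "R (card F')" using F' unfolding R_def by blast
    then have "card F \<le> card F'" unfolding F(2) by (rule Least_le)
    moreover have "card F \<noteq> 0" using F(1,3) F(4)[of undefined] P_nonempty[of n undefined] by auto
    ultimately show False using F'(2) by linarith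
  qed
  obtain w g where w: "range w \<subseteq> F" "parsing (\<lambda>f. f) w g y"
    using factor_parsing_exists[OF y(1) F(3,4)] by blast
  obtain w' g' where w': "range w' \<subseteq> F" "parsing (\<lambda>f. f) w' g' y'"
    using factor_parsing_exists[OF y'(1) F(3,4)] by blast
  have "\<forall>f\<in>F. ext \<sigma> f \<noteq> []" using F(3) \<sigma>_nonempty by (metis concat_eq_Nil_conv image_eqI list.set_map last_in_set)
  moreover have "\<forall>p\<ge>1. tr p x \<noteq> x" using X_aperiodic[OF x] by blast
  ultimately obtain s where s: "w' = tr s w" "(\<lambda>i. c' (g' i)) = (\<lambda>j. c (g (j + s)))"
    using elementary_recognizable[OF parsing_comp[OF w(2) y(2)] parsing_comp[OF w'(2) y'(2)] F(1) w(1) w'(1) _ el]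
    by auto
  \<comment> \<open>The index shift \<open>s\<close> of the \<open>F\<close> parsings amounts to a
    translation of \<open>y\<close> by \<open>h\<close> letters.\<close>
  define h where "h = g s - g' 0"
  have p: "parsing (\<lambda>f. f) w' (\<lambda>i. g (i + s) - h) (tr h y)"
    using parsing_tr[OF parsing_tr_index[OF w(2), of s], of h] by (simp add: s(1))
  have "g' i = g (i + s) - h" for i
    using parsing_cuts_diff[OF w'(2) p, of i 0] by (simp add: h_def)
  then have "g' = (\<lambda>i. g (i + s) - h)" by blast
  then have y'': "y' = tr h y" using p w'(2) parsing_image_unique by metis
  have p': "parsing \<sigma> y' (\<lambda>i. c (i + h)) x" using parsing_tr_index[OF y(2), of h] by (simp add: y'')
  have "c' (g' 0) = c (g' 0 + h)" using fun_cong[OF s(2), of 0] by (simp add: h_def)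
  then have c': "c' i = c (i + h)" for i
    using parsing_cuts_diff[OF y'(2) p', of i "g' 0"] by simp
  \<comment> \<open>In both parsings of \<open>x\<close> the origin lies in block 0, which leaves no
    room for a translation.\<close>
  have "h = 0"
    using parsing_index_unique[OF y(2), of h 0 0] y(3,4) y'(3,4) c'[of 0] c'[of 1]
    by (simp add: add.commute)
  then show ?thesis using y'' c' by auto
qed

end

section \<open>Paths and points of the shift space\<close>

fun letter :: "'a subst_edge \<Rightarrow> 'a" where
  "letter (Top_Edge a) = a" | "letter (Occ_Edge a i) = a"

fun slot :: "'a subst_edge \<Rightarrow> nat" where
  "slot (Top_Edge a) = 0" | "slot (Occ_Edge a i) = i"

context aperiodic_substitution
begin

text \<open>The desubstituted point together with the position of the origin inside its block. On
  \<open>X\<close> the choice is unambiguous by \<open>recognizable\<close>.\<close>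

definition desub :: "(int \<Rightarrow> 'a) \<Rightarrow> (int \<Rightarrow> 'a) \<times> nat" where
  "desub x = (SOME (z, j). z \<in> X \<and> j < length (\<sigma> (z 0)) \<and> parsing \<sigma> z (\<lambda>i. cuts \<sigma> z i - int j) x)"

abbreviation "D x \<equiv> fst (desub x)"
abbreviation "K x \<equiv> snd (desub x)"

lemma desub:
  assumes "x \<in> X"
  shows D_in_X: "D x \<in> X" and K_less: "K x < length (\<sigma> (D x 0))"
    and D_parsing: "parsing \<sigma> (D x) (\<lambda>i. cuts \<sigma> (D x) i - int (K x)) x"
proof -
  have "\<exists>p. case p of (z, j) \<Rightarrow> z \<in> X \<and> j < length (\<sigma> (z 0)) \<and> parsing \<sigma> z (\<lambda>i. cuts \<sigma> z i - int j) x"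
    using desubstitution_exists[OF assms] by simp
  from someI_ex[OF this] show "D x \<in> X" "K x < length (\<sigma> (D x 0))"
    "parsing \<sigma> (D x) (\<lambda>i. cuts \<sigma> (D x) i - int (K x)) x"
    unfolding desub_def[symmetric] by (auto simp: case_prod_beta)
qed

lemma cuts_1: "cuts \<sigma> y 1 = int (length (\<sigma> (y 0)))"
  using cuts_Suc[of \<sigma> y 0] by simp

lemma desub_unique:
  assumes "x \<in> X" "z \<in> X" "parsing \<sigma> z c x" "c 0 = - int k" "k < length (\<sigma> (z 0))"
  shows "D x = z \<and> K x = k"
proof -
  have c: "c 0 \<le> 0" "0 < c 1" using assms(4,5) parsing_cut[OF assms(3), of 0] by auto
  have d: "cuts \<sigma> (D x) 0 - int (K x) \<le> 0" "0 < cuts \<sigma> (D x) 1 - int (K x)"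
    using K_less[OF assms(1)] by (auto simp: cuts_1)
  note * = recognizable[OF assms(1) D_in_X[OF assms(1)] D_parsing[OF assms(1)] d assms(2,3) c]
  then show ?thesis using fun_cong[OF conjunct2[OF *], of 0] assms(4) by simp
qed

text \<open>Otherwise some points tending to \<open>x\<close> have desubstitutions that stay away
  from the one of \<open>x\<close>. By \<open>parsing_limit\<close> these accumulate at a
  desubstitution of \<open>x\<close>, which is unique.\<close>

lemma desub_continuous:
  assumes x: "x \<in> X"
  shows "\<exists>n. \<forall>x'\<in>X. (\<forall>t. \<bar>t\<bar> \<le> int n \<longrightarrow> x' t = x t) \<longrightarrow>
    K x' = K x \<and> (\<forall>t. \<bar>t\<bar> \<le> int N \<longrightarrow> D x' t = D x t)"
proof (rule ccontr)
  assume "\<not> ?thesis"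
  then have "\<forall>n. \<exists>x'\<in>X. (\<forall>t. \<bar>t\<bar> \<le> int n \<longrightarrow> x' t = x t) \<and>
    \<not> (K x' = K x \<and> (\<forall>t. \<bar>t\<bar> \<le> int N \<longrightarrow> D x' t = D x t))" by meson
  then obtain f where f: "\<And>n. f n \<in> X" "\<And>n t. \<bar>t\<bar> \<le> int n \<Longrightarrow> f n t = x t"
    "\<And>n. \<not> (K (f n) = K x \<and> (\<forall>t. \<bar>t\<bar> \<le> int N \<longrightarrow> D (f n) t = D x t))" by metis
  have "\<forall>\<^sub>F n in sequentially. win (D (f n)) (- int N) (2 * N + 1) \<in> language \<sigma>" for N
    using D_in_X[OF f(1)] by (simp add: in_X_iff)
  moreover have "\<forall>\<^sub>F n in sequentially. \<forall>i t. \<bar>i\<bar> \<le> int N \<longrightarrow> t < length (\<sigma> (D (f n) i)) \<longrightarrow>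
      x (cuts \<sigma> (D (f n)) i - int (K (f n)) + int t) = \<sigma> (D (f n) i) ! t" for N
  proof (rule eventually_mono[OF eventually_ge_at_top[of "maxlen * N + 2 * maxlen"]], intro allI impI)
    fix n i t assume n: "maxlen * N + 2 * maxlen \<le> n" and i: "\<bar>i\<bar> \<le> int N"
      and t: "t < length (\<sigma> (D (f n) i))"
    have "int maxlen * \<bar>i\<bar> \<le> int maxlen * int N" using i by (intro mult_left_mono) auto
    moreover have "int maxlen * int N + 2 * int maxlen \<le> int n"
      using of_nat_mono[OF n, where 'a = int] by (simp add: algebra_simps)
    moreover have "int (K (f n)) < int maxlen"
      using K_less[OF f(1), of n] length_\<sigma>_le[of "D (f n) 0"] by linarith
    moreover have "int t < int maxlen" using t length_\<sigma>_le[of "D (f n) i"] by linarith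
    ultimately have "\<bar>cuts \<sigma> (D (f n)) i - int (K (f n)) + int t\<bar> \<le> int n"
      using abs_cuts_le[of "D (f n)" i] by linarith
    then show "x (cuts \<sigma> (D (f n)) i - int (K (f n)) + int t) = \<sigma> (D (f n) i) ! t"
      using f(2) parsing_nth[OF D_parsing[OF f(1)] t] by metis
  qed
  ultimately obtain z j where z: "z \<in> X" "j < length (\<sigma> (z 0))" "parsing \<sigma> z (\<lambda>i. cuts \<sigma> z i - int j) x"
    "infinite {n. K (f n) = j \<and> (\<forall>t. \<bar>t\<bar> \<le> int N \<longrightarrow> D (f n) t = z t)}"
    using parsing_limit[of "\<lambda>n. K (f n)" "\<lambda>n. D (f n)" x] K_less[OF f(1)] by blast
  obtain n where "K (f n) = j" "\<forall>t. \<bar>t\<bar> \<le> int N \<longrightarrow> D (f n) t = z t"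
    using not_finite_existsD[OF z(4)] by blast
  moreover have "D x = z \<and> K x = j" using desub_unique[OF x z(1,3) _ z(2)] by simp
  ultimately show False using f(3)[of n] by auto
qed

text \<open>An odometer step: the origin moves inside its block, or a carry passes to the next
  letter of \<open>D x\<close>.\<close>

lemma desub_tr:
  assumes x: "x \<in> X"
  shows "if K x + 1 < length (\<sigma> (D x 0)) then D (tr 1 x) = D x \<and> K (tr 1 x) = K x + 1
    else D (tr 1 x) = tr 1 (D x) \<and> K (tr 1 x) = 0"
proof (cases "K x + 1 < length (\<sigma> (D x 0))")
  case True
  then show ?thesis
    using desub_unique[OF tr_in_X[OF x, of 1] D_in_X[OF x] parsing_tr[OF D_parsing[OF x], of 1], of "K x + 1"]
    by simp
next
  case False
  then have "length (\<sigma> (D x 0)) = K x + 1" using K_less[OF x] by simp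
  then show ?thesis
    using False desub_unique[OF tr_in_X[OF x, of 1] tr_in_X[OF D_in_X[OF x], of 1]
        parsing_tr_index[OF parsing_tr[OF D_parsing[OF x], of 1], of 1], of 0]
    by (simp add: cuts_1 \<sigma>_nonempty)
qed

abbreviation "B \<equiv> subst_diagram \<sigma>"
abbreviation "Y \<equiv> path_space B"

text \<open>The matching of source and target in terms of letters and slots; it includes that
  \<open>f\<close> is an edge of a positive level.\<close>

definition joined :: "'a subst_edge \<Rightarrow> 'a subst_edge \<Rightarrow> bool" where
  "joined e f \<longleftrightarrow> f = Occ_Edge (letter f) (slot f) \<and> slot f < length (\<sigma> (letter f)) \<and>
     \<sigma> (letter f) ! slot f = letter e"

lemma in_Y_iff: "p \<in> Y \<longleftrightarrow> p 0 = Top_Edge (letter (p 0)) \<and> (\<forall>n. joined (p n) (p (Suc n)))"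
proof
  assume p: "p \<in> Y"
  then have "p n \<in> edges B n" "target B (p n) = source B (p (Suc n))" for n
    by (auto simp: path_space_def)
  then have e: "p 0 \<in> edges B 0" "p (Suc n) \<in> edges B (Suc n)" "target B (p n) = source B (p (Suc n))" for n
    by blast+
  have tgt: "target B f = Some (letter f)" for f by (cases f) (auto simp: subst_diagram_def)
  have "p 0 = Top_Edge (letter (p 0))" using e(1) by (auto simp: subst_diagram_def)
  moreover have "joined (p n) (p (Suc n))" for n
  proof -
    obtain a i where ai: "p (Suc n) = Occ_Edge a i" "i < length (\<sigma> a)"
      using e(2)[of n] by (auto simp: subst_diagram_def)
    moreover have "Some (letter (p n)) = source B (p (Suc n))" using e(3)[of n] tgt[of "p n"] by simp
    ultimately show ?thesis by (simp add: joined_def subst_diagram_def)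
  qed
  ultimately show "p 0 = Top_Edge (letter (p 0)) \<and> (\<forall>n. joined (p n) (p (Suc n)))" by blast
next
  assume p: "p 0 = Top_Edge (letter (p 0)) \<and> (\<forall>n. joined (p n) (p (Suc n)))"
  have "target B f = Some (letter f)" for f by (cases f) (auto simp: subst_diagram_def)
  moreover have "p n \<in> edges B n" for n
  proof (cases n)
    case 0
    have "p 0 \<in> range Top_Edge" using p by (metis rangeI)
    then show ?thesis using 0 by (simp add: subst_diagram_def)
  next
    case (Suc m)
    have "joined (p m) (p (Suc m))" using p by blast
    then show ?thesis unfolding joined_def Suc subst_diagram_def by auto
  qed
  moreover have "source B (p (Suc n)) = Some (letter (p n))" for n
  proof -
    have "joined (p n) (p (Suc n))" using p by blast
    then obtain a i where "p (Suc n) = Occ_Edge a i" "\<sigma> a ! i = letter (p n)"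
      unfolding joined_def by metis
    then show ?thesis by (simp add: subst_diagram_def)
  qed
  moreover have "source B (p 0) \<in> vertices B 0"
  proof -
    obtain a where "p 0 = Top_Edge a" using p by blast
    then show ?thesis by (simp add: subst_diagram_def)
  qed
  ultimately show "p \<in> Y" by (simp add: path_space_def)
qed

lemma Y_top: "p \<in> Y \<Longrightarrow> p 0 = Top_Edge (letter (p 0))"
  and Y_joined: "p \<in> Y \<Longrightarrow> joined (p n) (p (Suc n))"
  by (auto simp: in_Y_iff)

lemma Y_edge: "p \<in> Y \<Longrightarrow> p (Suc n) = Occ_Edge (letter (p (Suc n))) (slot (p (Suc n)))"
  and Y_slot: "p \<in> Y \<Longrightarrow> slot (p (Suc n)) < length (\<sigma> (letter (p (Suc n))))"
  and Y_letter: "p \<in> Y \<Longrightarrow> \<sigma> (letter (p (Suc n))) ! slot (p (Suc n)) = letter (p n)"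
  using Y_joined[of p n] by (auto simp: joined_def)

text \<open>A path \<open>p\<close> puts the origin at position \<open>offs p n\<close> of the word \<open>blk p n\<close>, for every \<open>n\<close>; this word
  then occupies the interval \<open>[- offs p n, rem p n)\<close>.\<close>

definition blk :: "(nat \<Rightarrow> 'a subst_edge) \<Rightarrow> nat \<Rightarrow> 'a list" where
  "blk p n = P n (letter (p n))"

fun offs :: "(nat \<Rightarrow> 'a subst_edge) \<Rightarrow> nat \<Rightarrow> nat" where
  "offs p 0 = 0"
| "offs p (Suc n) = length (ext (P n) (take (slot (p (Suc n))) (\<sigma> (letter (p (Suc n)))))) + offs p n"

lemma offs_cong: "(\<And>i. i \<le> n \<Longrightarrow> p i = q i) \<Longrightarrow> offs p n = offs q n"
  by (induction n) auto

lemma blk_Suc: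
  assumes "p \<in> Y"
  shows "blk p (Suc n) = ext (P n) (take (slot (p (Suc n))) (\<sigma> (letter (p (Suc n))))) @ blk p n @
    ext (P n) (drop (Suc (slot (p (Suc n)))) (\<sigma> (letter (p (Suc n)))))"
proof -
  have "\<sigma> (letter (p (Suc n))) = take (slot (p (Suc n))) (\<sigma> (letter (p (Suc n)))) @ letter (p n) #
      drop (Suc (slot (p (Suc n)))) (\<sigma> (letter (p (Suc n))))"
    using id_take_nth_drop[OF Y_slot[OF assms, of n]] Y_letter[OF assms, of n] by simp
  then have "ext (P n) (\<sigma> (letter (p (Suc n)))) = ext (P n) (take (slot (p (Suc n))) (\<sigma> (letter (p (Suc n)))) @ letter (p n) #
      drop (Suc (slot (p (Suc n)))) (\<sigma> (letter (p (Suc n)))))" by simp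
  then show ?thesis unfolding blk_def P_Suc_right by simp
qed

lemma blk_embed:
  assumes "p \<in> Y" "m \<le> n"
  shows "\<exists>a b. blk p n = a @ blk p m @ b \<and> offs p n = length a + offs p m"
  using assms(2)
proof (induction n rule: dec_induct)
  case base
  show ?case by (intro exI[of _ "[]"]) simp
next
  case (step n)
  then obtain a b where "blk p n = a @ blk p m @ b" "offs p n = length a + offs p m" by blast
  then show ?case
    by (intro exI[of _ "ext (P n) (take (slot (p (Suc n))) (\<sigma> (letter (p (Suc n))))) @ a"]
        exI[of _ "b @ ext (P n) (drop (Suc (slot (p (Suc n)))) (\<sigma> (letter (p (Suc n)))))"])
      (simp add: blk_Suc[OF assms(1)])
qed

lemma offs_less: "p \<in> Y \<Longrightarrow> offs p n < length (blk p n)"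
proof (induction n)
  case 0
  then show ?case by (simp add: blk_def)
qed (simp add: blk_Suc)

definition rem :: "(nat \<Rightarrow> 'a subst_edge) \<Rightarrow> nat \<Rightarrow> nat" where
  "rem p n = length (blk p n) - offs p n"

lemma rem_pos: "p \<in> Y \<Longrightarrow> 0 < rem p n"
  using offs_less by (simp add: rem_def)

lemma offs_add_rem: "p \<in> Y \<Longrightarrow> offs p n + rem p n = length (blk p n)"
  using offs_less[of p n] by (simp add: rem_def)

lemma offs_mono: "p \<in> Y \<Longrightarrow> m \<le> n \<Longrightarrow> offs p m \<le> offs p n"
  using blk_embed by (metis le_add2)

lemma rem_mono: "p \<in> Y \<Longrightarrow> m \<le> n \<Longrightarrow> rem p m \<le> rem p n"
  using blk_embed[of p m n] offs_less[of p m] by (auto simp: rem_def)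

lemma rem_Suc:
  assumes "p \<in> Y"
  shows "rem p (Suc n) = rem p n + length (ext (P n) (drop (Suc (slot (p (Suc n)))) (\<sigma> (letter (p (Suc n))))))"
  using offs_less[OF assms, of n] blk_Suc[OF assms, of n] by (simp add: rem_def)

text \<open>The blocks grow on both sides, so a point that reads them is determined at every
  integer.\<close>

definition good :: "(nat \<Rightarrow> 'a subst_edge) \<Rightarrow> bool" where
  "good p \<longleftrightarrow> p \<in> Y \<and> (\<forall>N. \<exists>n. N \<le> offs p n) \<and> (\<forall>N. \<exists>n. N \<le> rem p n)"

lemma good_ge:
  assumes "good p"
  shows "\<exists>m. \<forall>n\<ge>m. N \<le> offs p n \<and> N \<le> rem p n"
proof -
  obtain k l where "N \<le> offs p k" "N \<le> rem p l" using assms unfolding good_def by blast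
  moreover have "p \<in> Y" using assms by (simp add: good_def)
  ultimately show ?thesis
    using offs_mono[of p k] rem_mono[of p l]
    by (intro exI[of _ "max k l"]) (meson max.boundedE order_trans)
qed

text \<open>The path of the ancestor: \<open>desc (F x) = F (D x)\<close>. Edges at level 0 have no
  position, so the edge \<open>p 1\<close> is replaced by the top edge to its letter; what is
  forgotten is \<open>slot (p 1)\<close>.\<close>

definition desc :: "(nat \<Rightarrow> 'a subst_edge) \<Rightarrow> nat \<Rightarrow> 'a subst_edge" where
  "desc p = case_nat (Top_Edge (letter (p 1))) (\<lambda>n. p (Suc (Suc n)))"

lemma desc_Suc [simp]: "desc p (Suc n) = p (Suc (Suc n))"
  by (simp add: desc_def)

lemma letter_desc [simp]: "letter (desc p n) = letter (p (Suc n))"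
  by (cases n) (auto simp: desc_def)

lemma desc_in_Y:
  assumes "p \<in> Y"
  shows "desc p \<in> Y"
  unfolding in_Y_iff
proof (intro conjI allI)
  show "desc p 0 = Top_Edge (letter (desc p 0))" by (simp add: desc_def)
  show "joined (desc p n) (desc p (Suc n))" for n
    using Y_joined[OF assms, of "Suc n"] by (simp add: joined_def)
qed

lemma blk_desc: "blk p (Suc n) = ext \<sigma> (blk (desc p) n)"
  by (simp add: blk_def P_Suc)

text \<open>The definition of \<open>offs\<close> adds the outermost level last, following
  \<open>P_Suc_right\<close>; here the innermost level is split off, following \<open>P_Suc\<close>.
  The second form is the one compatible with desubstitution.\<close>

lemma offs_desc:
  assumes "p \<in> Y"
  shows "offs p (Suc n) = slot (p 1) + length (ext \<sigma> (take (offs (desc p) n) (blk (desc p) n)))"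
proof (induction n)
  case 0
  show ?case using Y_slot[OF assms, of 0] by (simp add: P_0[abs_def])
next
  case (Suc n)
  let ?q = "desc p"
  let ?i = "slot (p (Suc (Suc n)))" and ?s = "\<sigma> (letter (p (Suc (Suc n))))"
  have "offs ?q n \<le> length (blk ?q n)" using offs_less[OF desc_in_Y[OF assms], of n] by simp
  then have "take (offs ?q (Suc n)) (blk ?q (Suc n)) =
      ext (P n) (take ?i ?s) @ take (offs ?q n) (blk ?q n)"
    by (simp add: blk_Suc[OF desc_in_Y[OF assms]])
  then have "ext \<sigma> (take (offs ?q (Suc n)) (blk ?q (Suc n))) =
      ext (P (Suc n)) (take ?i ?s) @ ext \<sigma> (take (offs ?q n) (blk ?q n))"
    by (simp add: ext_ext P_Suc[abs_def])
  then show ?case using Suc by simp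
qed

section \<open>Points that read a path, and the inverse of the coding\<close>

definition follows :: "(int \<Rightarrow> 'a) \<Rightarrow> (nat \<Rightarrow> 'a subst_edge) \<Rightarrow> nat \<Rightarrow> bool" where
  "follows x p n \<longleftrightarrow> win x (- int (offs p n)) (length (blk p n)) = blk p n"

lemma follows_nth:
  assumes "follows x p n" "p \<in> Y" "- int (offs p n) \<le> t" "t < int (rem p n)"
  shows "x t = blk p n ! nat (t + int (offs p n))"
proof -
  have "nat (t + int (offs p n)) < length (blk p n)"
    using assms(3,4) offs_less[OF assms(2), of n] by (simp add: rem_def nat_less_iff)
  then have "win x (- int (offs p n)) (length (blk p n)) ! nat (t + int (offs p n)) = x t"
    using assms(3) by simp
  then show ?thesis using assms(1) by (simp add: follows_def)
qed

lemma follows_mono: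
  assumes "p \<in> Y" "m \<le> n" "follows x p n"
  shows "follows x p m"
proof -
  obtain a b where ab: "blk p n = a @ blk p m @ b" "offs p n = length a + offs p m"
    using blk_embed[OF assms(1,2)] by blast
  have "win x (- int (offs p n)) (length a + (length (blk p m) + length b)) = a @ blk p m @ b"
    using assms(3) ab(1) by (simp add: follows_def)
  then have "win x (- int (offs p n) + int (length a)) (length (blk p m)) = blk p m"
    by (simp only: win_add) simp
  then show ?thesis by (simp add: follows_def ab(2))
qed

lemma follows_eq:
  assumes "p \<in> Y" "follows x p n" "follows x' p n" "- int (offs p n) \<le> t" "t < int (rem p n)"
  shows "x t = x' t"
  using follows_nth[OF assms(2,1,4,5)] follows_nth[OF assms(3,1,4,5)] by simp

lemma follows_unique:
  assumes "good p" "\<And>n. follows x p n" "\<And>n. follows x' p n"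
  shows "x = x'"
proof
  fix t
  obtain n where n: "nat (\<bar>t\<bar> + 1) \<le> offs p n" "nat (\<bar>t\<bar> + 1) \<le> rem p n"
    using good_ge[OF assms(1)] by blast
  show "x t = x' t"
  proof (rule follows_eq[of p x n x' t])
    show "p \<in> Y" using assms(1) by (simp add: good_def)
    show "- int (offs p n) \<le> t" "t < int (rem p n)" using n by linarith+
  qed (use assms in auto)
qed

text \<open>Applying \<open>\<sigma>\<close> to the block around the origin of \<open>y\<close>
  gives a block of \<open>x\<close>, and by \<open>offs_desc\<close> its left end is where level
  \<open>Suc n\<close> of \<open>p\<close> puts it.\<close>

lemma follows_lift:
  assumes p: "p \<in> Y" and x: "parsing \<sigma> y c x" "c 0 = - int (slot (p 1))"
    and y: "follows y (desc p) n"
  shows "follows x p (Suc n)"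
proof -
  let ?o = "offs (desc p) n" and ?u = "blk (desc p) n"
  have o: "?o \<le> length ?u" using offs_less[OF desc_in_Y[OF p], of n] by simp
  have u: "win y (- int ?o) (length ?u) = ?u" using y by (simp add: follows_def)
  have "win y (- int ?o) (?o + (length ?u - ?o)) = ?u" using u o by simp
  then have "win y (- int ?o) ?o @ win y (- int ?o + int ?o) (length ?u - ?o) = ?u"
    by (simp only: win_add)
  then have "win y (- int ?o) ?o = take ?o ?u" by (metis append_eq_conv_conj length_win)
  then have "c 0 = c (- int ?o) + int (length (ext \<sigma> (take ?o ?u)))"
    using parsing_cut_add[OF x(1), of "- int ?o" ?o] by simp
  then have "c (- int ?o) = - int (offs p (Suc n))"
    using x(2) offs_desc[OF p, of n] by simp
  moreover have "ext \<sigma> ?u = win x (c (- int ?o)) (length (ext \<sigma> ?u))"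
    using parsing_ext[OF x(1), of "- int ?o" "length ?u"] u by simp
  ultimately show ?thesis unfolding follows_def blk_desc by simp
qed

definition F :: "(int \<Rightarrow> 'a) \<Rightarrow> nat \<Rightarrow> 'a subst_edge" where
  "F x = case_nat (Top_Edge (x 0)) (\<lambda>n. Occ_Edge ((D ^^ Suc n) x 0) (K ((D ^^ n) x)))"

lemma F_0 [simp]: "F x 0 = Top_Edge (x 0)"
  and F_Suc: "F x (Suc n) = Occ_Edge ((D ^^ Suc n) x 0) (K ((D ^^ n) x))"
  by (auto simp: F_def)

lemma funpow_D_in_X: "x \<in> X \<Longrightarrow> (D ^^ n) x \<in> X"
  by (induction n) (auto simp: D_in_X)

lemma letter_F [simp]: "letter (F x n) = (D ^^ n) x 0"
  by (cases n) (auto simp: F_Suc)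

lemma F_in_Y:
  assumes "x \<in> X"
  shows "F x \<in> Y"
  unfolding in_Y_iff
proof (intro conjI allI)
  show "joined (F x n) (F x (Suc n))" for n
    using K_less[OF funpow_D_in_X[OF assms], of n]
      parsing_nth[OF D_parsing[OF funpow_D_in_X[OF assms]], of "K ((D ^^ n) x)" n 0]
    by (simp add: joined_def F_Suc)
qed simp

lemma desc_F: "desc (F x) = F (D x)"
proof
  show "desc (F x) n = F (D x) n" for n
    by (cases n) (simp_all add: desc_def F_Suc funpow_Suc_right del: funpow.simps(2))
qed

lemma F_follows: "x \<in> X \<Longrightarrow> follows x (F x) n"
proof (induction n arbitrary: x)
  case 0
  then show ?case by (simp add: follows_def blk_def win_def)
next
  case (Suc n)
  show ?case
    using follows_lift[OF F_in_Y[OF Suc.prems] D_parsing[OF Suc.prems], of n]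
      Suc.IH[OF D_in_X[OF Suc.prems]]
    by (simp add: desc_F F_Suc)
qed

text \<open>Blocks of different levels agree where they overlap (\<open>blk_embed\<close>), and on a
  good path they cover the integers, so they glue to a point.\<close>

lemma follows_exists:
  assumes "good p"
  shows "\<exists>x. \<forall>n. follows x p n"
proof -
  have p: "p \<in> Y" using assms by (simp add: good_def)
  have "\<exists>n. - int (offs p n) \<le> t \<and> t < int (rem p n)" for t
  proof -
    obtain n where "nat (\<bar>t\<bar> + 1) \<le> offs p n" "nat (\<bar>t\<bar> + 1) \<le> rem p n"
      using good_ge[OF assms] by blast
    then show ?thesis by (intro exI[of _ n]) linarith
  qed
  then obtain m where m: "\<And>t. - int (offs p (m t)) \<le> t" "\<And>t. t < int (rem p (m t))" by metis
  define x where "x t = blk p (m t) ! nat (t + int (offs p (m t)))" for t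
  have mono: "blk p k ! nat (t + int (offs p k)) = blk p l ! nat (t + int (offs p l))"
    if kl: "k \<le> l" and t: "- int (offs p k) \<le> t" "t < int (rem p k)" for k l t
  proof -
    obtain a b where ab: "blk p l = a @ blk p k @ b" "offs p l = length a + offs p k"
      using blk_embed[OF p kl] by blast
    have "nat (t + int (offs p l)) = length a + nat (t + int (offs p k))"
      using t ab by simp
    moreover have "nat (t + int (offs p k)) < length (blk p k)"
      using t offs_less[OF p, of k] by (simp add: rem_def nat_less_iff)
    ultimately show ?thesis by (simp add: ab(1) nth_append)
  qed
  have "follows x p n" for n
    unfolding follows_def
  proof (rule nth_equalityI)
    fix i assume "i < length (win x (- int (offs p n)) (length (blk p n)))"
    then have i: "i < length (blk p n)" by simp
    define t where "t = int i - int (offs p n)"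
    have t: "- int (offs p n) \<le> t" "t < int (rem p n)"
      using i offs_less[OF p, of n] by (auto simp: t_def rem_def)
    have "blk p (m t) ! nat (t + int (offs p (m t))) = blk p n ! nat (t + int (offs p n))"
    proof (cases "m t \<le> n")
      case True
      from mono[OF this m] show ?thesis .
    next
      case False
      then have "n \<le> m t" by simp
      from mono[OF this t] show ?thesis by (rule sym)
    qed
    then show "win x (- int (offs p n)) (length (blk p n)) ! i = blk p n ! i"
      using i by (simp add: x_def t_def)
  qed simp
  then show ?thesis by blast
qed

definition G :: "(nat \<Rightarrow> 'a subst_edge) \<Rightarrow> int \<Rightarrow> 'a" where
  "G p = (SOME x. \<forall>n. follows x p n)"

lemma G_follows: "good p \<Longrightarrow> follows (G p) p n"
  unfolding G_def using someI_ex[OF follows_exists] by blast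

lemma G_eqI: "good p \<Longrightarrow> (\<And>n. follows x p n) \<Longrightarrow> G p = x"
  using follows_unique G_follows by blast

lemma G_in_X:
  assumes "good p"
  shows "G p \<in> X"
  unfolding in_X_iff
proof (intro allI)
  fix i n
  obtain m where m: "\<And>k. m \<le> k \<Longrightarrow> nat (\<bar>i\<bar> + int n) \<le> offs p k \<and> nat (\<bar>i\<bar> + int n) \<le> rem p k"
    using good_ge[OF assms] by blast
  \<comment> \<open>One level is added because \<open>language\<close> admits only powers with
    \<open>n \<ge> 1\<close>.\<close>
  define k where "k = Suc m"
  have k: "\<bar>i\<bar> + int n \<le> int (offs p k)" "\<bar>i\<bar> + int n \<le> int (rem p k)"
    using m[of k] by (auto simp: k_def)
  have "p \<in> Y" using assms by (simp add: good_def)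
  then have "sublist (win (G p) i n) (win (G p) (- int (offs p k)) (length (blk p k)))"
    using k offs_less[of p k] by (intro sublist_win) (auto simp: rem_def)
  also have "win (G p) (- int (offs p k)) (length (blk p k)) = blk p k"
    using G_follows[OF assms, of k] by (simp add: follows_def)
  finally show "win (G p) i n \<in> language \<sigma>"
    unfolding language_def blk_def k_def by auto
qed

text \<open>Desubstitution shortens words by at most the factor \<open>maxlen\<close>, so unbounded
  ends remain unbounded.\<close>

lemma good_desc:
  assumes "good p"
  shows "good (desc p)"
proof -
  have p: "p \<in> Y" using assms by (simp add: good_def)
  note q = desc_in_Y[OF p]
  have "\<exists>n. N \<le> offs (desc p) n \<and> N \<le> rem (desc p) n" for N
  proof -
    obtain m where m: "\<And>k. m \<le> k \<Longrightarrow> (N + 1) * maxlen \<le> offs p k \<and> (N + 1) * maxlen \<le> rem p k"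
      using good_ge[OF assms] by blast
    let ?o = "offs (desc p) m" and ?u = "blk (desc p) m"
    have o: "?o < length ?u" by (rule offs_less[OF q])
    have "(N + 1) * maxlen \<le> slot (p 1) + length (ext \<sigma> (take ?o ?u))"
      using m[of "Suc m"] offs_desc[OF p, of m] by simp
    also have "\<dots> < maxlen + maxlen * ?o"
      using length_ext_\<sigma>_le[of "take ?o ?u"] Y_slot[OF p, of 0] length_\<sigma>_le[of "letter (p 1)"] o
      by simp
    finally have "(N + 1) * maxlen < (?o + 1) * maxlen" by (simp add: algebra_simps)
    then have 1: "N + 1 < ?o + 1" by (simp only: mult_less_cancel2)
    have "ext \<sigma> ?u = ext \<sigma> (take ?o ?u) @ ext \<sigma> (drop ?o ?u)"
      by (metis append_take_drop_id concat_append map_append)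
    then have "rem p (Suc m) \<le> length (ext \<sigma> (drop ?o ?u))"
      unfolding rem_def blk_desc offs_desc[OF p] by simp
    also have "\<dots> \<le> maxlen * rem (desc p) m"
      using length_ext_\<sigma>_le[of "drop ?o ?u"] by (simp add: rem_def)
    finally have "(N + 1) * maxlen \<le> rem (desc p) m * maxlen"
      using m[of "Suc m"] by (simp add: algebra_simps)
    then have "N + 1 \<le> rem (desc p) m" using maxlen_pos by (simp only: mult_le_cancel2)
    then show ?thesis using 1 by (intro exI[of _ m]) simp
  qed
  then show ?thesis using q unfolding good_def by blast
qed

text \<open>The image of \<open>G (desc p)\<close> with the origin at \<open>slot (p 1)\<close>
  follows \<open>p\<close> on all levels, hence it is \<open>G p\<close>, and uniqueness identifies
  its desubstitution. This is where \<open>F (G p) = p\<close> rests on recognizability.\<close>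

lemma desub_G:
  assumes "good p"
  shows "D (G p) = G (desc p) \<and> K (G p) = slot (p 1)"
proof -
  have p: "p \<in> Y" using assms by (simp add: good_def)
  let ?y = "G (desc p)"
  have gd: "good (desc p)" by (rule good_desc[OF assms])
  obtain x where "parsing \<sigma> ?y (\<lambda>i. cuts \<sigma> ?y i + - int (slot (p 1))) x"
    using parsing_exists[of \<sigma> ?y "- int (slot (p 1))"] \<sigma>_nonempty by blast
  then have x: "parsing \<sigma> ?y (\<lambda>i. cuts \<sigma> ?y i - int (slot (p 1))) x" by simp
  have fs: "follows x p (Suc n)" for n
    using follows_lift[OF p x _ G_follows[OF gd]] by simp
  then have "follows x p n" for n
    using follows_mono[OF p, of n "Suc n" x] by simp
  then have "G p = x" by (rule G_eqI[OF assms])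
  moreover have "?y 0 = letter (p 1)"
    using follows_nth[OF G_follows[OF gd, of 0] desc_in_Y[OF p], of 0] rem_pos[OF desc_in_Y[OF p], of 0]
    by (simp add: blk_def)
  ultimately show ?thesis
    using desub_unique[OF G_in_X[OF assms] G_in_X[OF gd], of _ "slot (p 1)"] x Y_slot[OF p, of 0] by simp
qed

lemma F_G: "good p \<Longrightarrow> F (G p) = p"
proof
  fix n
  show "good p \<Longrightarrow> F (G p) n = p n"
  proof (induction n arbitrary: p)
    case 0
    then have p: "p \<in> Y" by (simp add: good_def)
    then show ?case
      using follows_nth[OF G_follows[OF 0, of 0] p, of 0] rem_pos[OF p, of 0] Y_top[OF p]
      by (simp add: blk_def)
  next
    case (Suc n)
    then have p: "p \<in> Y" by (simp add: good_def)
    show ?case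
    proof (cases n)
      case 0
      have "letter (F (D (G p)) 0) = letter (desc p 0)"
        using Suc.IH[OF good_desc[OF Suc.prems]] 0 desub_G[OF Suc.prems] by simp
      then show ?thesis
        using 0 desub_G[OF Suc.prems] Y_edge[OF p, of 0] by (simp add: F_Suc)
    next
      case (Suc m)
      have "F (G p) (Suc n) = F (D (G p)) n" using desc_F[of "G p"] Suc by (metis desc_Suc)
      also have "\<dots> = desc p n" using Suc.IH[OF good_desc[OF Suc.prems(1)]] desub_G[OF Suc.prems(1)] by simp
      finally show ?thesis using Suc by simp
    qed
  qed
qed

lemma G_F: "x \<in> X \<Longrightarrow> good (F x) \<Longrightarrow> G (F x) = x"
  using G_eqI F_follows by blast

end

section \<open>Tail equivalence and shift orbits\<close>

instance subst_edge :: (countable) countable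
proof
  have "inj (\<lambda>e :: 'a subst_edge. to_nat (case e of Top_Edge a \<Rightarrow> Inl a | Occ_Edge a i \<Rightarrow> Inr (a, i)))"
    by (rule injI) (auto split: subst_edge.splits)
  then show "\<exists>f :: 'a subst_edge \<Rightarrow> nat. inj f" by blast
qed

text \<open>The states \<open>R\<close> with an infinite past satisfy
  \<open>R \<subseteq> f R\<close> as sets, and finiteness makes \<open>f\<close> injective on them.
  It applies to paths whose slots are a function of the letter: one letter then determines all later
  ones.\<close>

lemma backward_orbit_unique:
  fixes f :: "'b :: finite \<Rightarrow> 'b"
  assumes b: "\<And>n. b n = f (b (Suc n))" and b': "\<And>n. b' n = f (b' (Suc n))" and eq: "b 0 = b' 0"
  shows "b n = b' n"
proof -
  define R where "R = {c. \<exists>b. (\<forall>n. b n = f (b (Suc n))) \<and> b 0 = c}"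
  have R: "s n \<in> R" if "\<And>n. s n = f (s (Suc n))" for s n
    unfolding R_def
  proof (intro CollectI exI[of _ "\<lambda>k. s (n + k)"] conjI allI)
    show "s (n + k) = f (s (n + Suc k))" for k
      unfolding add_Suc_right by (rule that)
  qed simp
  have "R \<subseteq> f ` R"
  proof
    fix c assume "c \<in> R"
    then obtain s where s: "\<And>n. s n = f (s (Suc n))" "s 0 = c" unfolding R_def by blast
    have "c = f (s (Suc 0))" using s(1)[of 0] s(2) by simp
    then show "c \<in> f ` R" using R[of s "Suc 0", OF s(1)] by blast
  qed
  then have "card R \<le> card (f ` R)" by (simp add: card_mono)
  then have inj: "inj_on f R" using card_image_le[of R f] by (intro eq_card_imp_inj_on) auto
  show ?thesis
  proof (induction n)
    case (Suc n)
    then have "f (b (Suc n)) = f (b' (Suc n))" using b[of n] b'[of n] by argo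
    then show ?case using inj R[of b, OF b] R[of b', OF b'] by (blast dest: inj_onD)
  qed (rule eq)
qed

lemma bounded_incseq_eventually_const:
  fixes f :: "nat \<Rightarrow> nat"
  assumes "\<And>m n. m \<le> n \<Longrightarrow> f m \<le> f n" "\<And>n. f n \<le> N"
  shows "\<exists>M. \<forall>n\<ge>M. f n = f M"
proof -
  have fin: "finite (range f)" by (rule finite_subset[of _ "{..N}"]) (use assms(2) in auto)
  then have "Max (range f) \<in> range f" by (rule Max_in) simp
  then obtain M where M: "Max (range f) = f M" by blast
  have "f n = f M" if "M \<le> n" for n
    using assms(1)[OF that] Max_ge[OF fin, of "f n"] M by simp
  then show ?thesis by blast
qed

context aperiodic_substitution
begin

text \<open>Edges into level \<open>n\<close> may differ, but the common letter makes the blocks of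
  level \<open>n\<close> equal.\<close>

definition tail_eq :: "(nat \<Rightarrow> 'a subst_edge) \<Rightarrow> (nat \<Rightarrow> 'a subst_edge) \<Rightarrow> nat \<Rightarrow> bool" where
  "tail_eq p q n \<longleftrightarrow> letter (p n) = letter (q n) \<and> (\<forall>i>n. p i = q i)"

lemma tail_rel_iff: "(p, q) \<in> tail_rel B \<longleftrightarrow> p \<in> Y \<and> q \<in> Y \<and> (\<exists>n. tail_eq p q n)"
proof -
  have "(\<forall>\<^sub>F i in sequentially. p i = q i) \<longleftrightarrow> (\<exists>n. tail_eq p q n)"
    unfolding eventually_sequentially tail_eq_def
  proof
    show "\<exists>N. \<forall>i\<ge>N. p i = q i \<Longrightarrow> \<exists>n. letter (p n) = letter (q n) \<and> (\<forall>i>n. p i = q i)"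
      using less_imp_le_nat by (metis order_refl)
    show "\<exists>n. letter (p n) = letter (q n) \<and> (\<forall>i>n. p i = q i) \<Longrightarrow> \<exists>N. \<forall>i\<ge>N. p i = q i"
      using Suc_le_eq by blast
  qed
  then show ?thesis by (simp add: tail_rel_def)
qed

lemma tail_rel_sym: "(p, q) \<in> tail_rel B \<Longrightarrow> (q, p) \<in> tail_rel B"
  unfolding tail_rel_iff tail_eq_def by metis

text \<open>Above \<open>n\<close> the same amounts are added to both offsets. The constant
  difference is the number of shifts separating the two points, see
  \<open>tail_eq_G\<close>.\<close>

lemma tail_eq_offs:
  assumes "tail_eq p q n" "n \<le> m"
  shows "blk p m = blk q m \<and>
    int (offs q m) - int (offs p m) = int (offs q n) - int (offs p n)"
  using assms(2)
proof (induction m rule: dec_induct)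
  case base
  then show ?case using assms(1) by (simp add: blk_def tail_eq_def)
next
  case (step m)
  then have "p (Suc m) = q (Suc m)" using assms(1) by (simp add: tail_eq_def)
  then show ?case using step.IH by (simp add: blk_def)
qed

lemma tail_eq_good:
  assumes "tail_eq p q n" "good p" "q \<in> Y"
  shows "good q"
proof -
  have p: "p \<in> Y" using assms(2) by (simp add: good_def)
  have "\<exists>m. N \<le> offs q m \<and> N \<le> rem q m" for N
  proof -
    obtain k where k: "\<And>m. k \<le> m \<Longrightarrow> N + offs p n + offs q n \<le> offs p m \<and> N + offs p n + offs q n \<le> rem p m"
      using good_ge[OF assms(2)] by blast
    define m where "m = max k n"
    have m: "N + offs p n + offs q n \<le> offs p m" "N + offs p n + offs q n \<le> rem p m"
      using k[of m] by (auto simp: m_def)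
    have e: "blk p m = blk q m" "int (offs q m) - int (offs p m) = int (offs q n) - int (offs p n)"
      using tail_eq_offs[OF assms(1), of m] by (auto simp: m_def)
    have "length (blk p m) = length (blk q m)" using e(1) by simp
    then have "N \<le> offs q m" "N \<le> rem q m"
      using m e(2) offs_add_rem[OF p, of m] offs_add_rem[OF assms(3), of m] by linarith+
    then show ?thesis by blast
  qed
  then show ?thesis using assms(3) unfolding good_def by blast
qed

lemma tail_eq_follows:
  assumes "tail_eq p q n" "q \<in> Y" "\<And>m. follows x p m"
  shows "follows (tr (int (offs q n) - int (offs p n)) x) q m"
proof -
  let ?m = "max m n"
  have e: "blk p ?m = blk q ?m" "int (offs q ?m) - int (offs p ?m) = int (offs q n) - int (offs p n)"
    using tail_eq_offs[OF assms(1), of ?m] by auto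
  have "follows (tr (int (offs q n) - int (offs p n)) x) q ?m"
    using assms(3)[of ?m] unfolding follows_def e(1)[symmetric] e(2)[symmetric] win_tr by simp
  then show ?thesis using follows_mono[OF assms(2), of m ?m] by simp
qed

lemma tail_eq_G:
  assumes "tail_eq p q n" "good p" "q \<in> Y"
  shows "G q = tr (int (offs q n) - int (offs p n)) (G p)"
  using G_eqI[OF tail_eq_good[OF assms]] tail_eq_follows[OF assms(1,3) G_follows[OF assms(2)]]
  by blast

text \<open>Finite paths into the vertex \<open>a\<close> of level \<open>n\<close> address the
  positions of \<open>P n a\<close>: a position picks one block of
  \<open>ext (P n) (\<sigma> a)\<close> and, recursively, a position inside it.\<close>

lemma address_exists:
  assumes "j < length (P n a)"
  shows "\<exists>q. q 0 = Top_Edge (letter (q 0)) \<and> (\<forall>m<n. joined (q m) (q (Suc m))) \<and>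
    letter (q n) = a \<and> offs q n = j"
  using assms
proof (induction n arbitrary: a j)
  case 0
  then show ?case by (intro exI[of _ "\<lambda>_. Top_Edge a"]) simp
next
  case (Suc n)
  obtain i where i: "i < length (\<sigma> a)" "length (ext (P n) (take i (\<sigma> a))) \<le> j"
    "j < length (ext (P n) (take (Suc i) (\<sigma> a)))"
    using ext_index[of j "P n" "\<sigma> a"] Suc.prems unfolding P_Suc_right by blast
  define j' where "j' = j - length (ext (P n) (take i (\<sigma> a)))"
  have "j' < length (P n (\<sigma> a ! i))"
    using i by (simp add: take_Suc_conv_app_nth j'_def)
  from Suc.IH[OF this] obtain q where q: "q 0 = Top_Edge (letter (q 0))"
    "\<forall>m<n. joined (q m) (q (Suc m))" "letter (q n) = \<sigma> a ! i" "offs q n = j'" by blast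
  let ?q = "q(Suc n := Occ_Edge a i)"
  have "offs ?q n = j'" using offs_cong[of n ?q q] q(4) by simp
  then have "offs ?q (Suc n) = j" using i(2) by (simp add: j'_def)
  moreover have "joined (?q m) (?q (Suc m))" if "m < Suc n" for m
    using that q(2,3) i(1) by (cases "m = n") (auto simp: joined_def)
  moreover have "?q 0 = Top_Edge (letter (?q 0))" using q(1) by simp
  moreover have "letter (?q (Suc n)) = a" by simp
  ultimately show ?case by blast
qed

lemma address_path_exists:
  assumes "p \<in> Y" "j < length (blk p n)"
  shows "\<exists>q\<in>Y. tail_eq p q n \<and> offs q n = j"
proof -
  obtain q where q: "q 0 = Top_Edge (letter (q 0))" "\<forall>m<n. joined (q m) (q (Suc m))"
    "letter (q n) = letter (p n)" "offs q n = j"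
    using address_exists assms(2) unfolding blk_def by blast
  define q' where "q' m = (if m \<le> n then q m else p m)" for m
  have "joined (q' m) (q' (Suc m))" for m
    using q(2,3) Y_joined[OF assms(1), of m] by (auto simp: q'_def joined_def not_le le_eq_less_or_eq Suc_le_eq)
  then have "q' \<in> Y" using q(1) by (simp add: in_Y_iff q'_def)
  moreover have "offs q' n = j" using offs_cong[of n q' q] q(4) by (simp add: q'_def)
  moreover have "tail_eq p q' n" using q(3) by (simp add: tail_eq_def q'_def)
  ultimately show ?thesis by blast
qed

text \<open>On a good path some block contains both the origin and \<open>t\<close>. Changing the
  address inside that block gives a tail equivalent path, whose point is
  \<open>tr t x\<close>.\<close>

lemma F_tr_good:
  assumes x: "x \<in> X" and g: "good (F x)"
  shows "good (F (tr t x)) \<and> (F x, F (tr t x)) \<in> tail_rel B"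
proof -
  let ?p = "F x"
  have p: "?p \<in> Y" by (rule F_in_Y[OF x])
  obtain n where n: "nat (\<bar>t\<bar> + 1) \<le> offs ?p n" "nat (\<bar>t\<bar> + 1) \<le> rem ?p n"
    using good_ge[OF g] by blast
  then have "nat (int (offs ?p n) + t) < length (blk ?p n)"
    using offs_add_rem[OF p, of n] by linarith
  then obtain q where q: "q \<in> Y" "tail_eq ?p q n" "offs q n = nat (int (offs ?p n) + t)"
    using address_path_exists[OF p] by blast
  have "int (offs q n) - int (offs ?p n) = t" using n q(3) by linarith
  then have "G q = tr t x" using tail_eq_G[OF q(2) g q(1)] G_F[OF x g] by simp
  then have "F (tr t x) = q" "good q"
    using F_G tail_eq_good[OF q(2) g q(1)] by metis+
  then show ?thesis using p q(1,2) by (auto simp: tail_rel_iff)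
qed

lemma tail_rel_good: "(p, q) \<in> tail_rel B \<Longrightarrow> good p \<Longrightarrow> good q"
  unfolding tail_rel_iff using tail_eq_good by blast

lemma tail_rel_G: "(p, q) \<in> tail_rel B \<Longrightarrow> good p \<Longrightarrow> \<exists>t. G q = tr t (G p)"
  unfolding tail_rel_iff using tail_eq_G by blast

section \<open>Infinite tail classes, and countability of the exceptional paths and points\<close>

lemma P_length_large: "\<exists>n0. \<forall>n\<ge>n0. \<forall>a. N \<le> length (P n a)"
proof -
  have "\<forall>\<^sub>F n in sequentially. N \<le> length (P n a)" for a
    using growth[of a] by (simp add: filterlim_at_top)
  then have "\<forall>\<^sub>F n in sequentially. \<forall>a\<in>UNIV. N \<le> length (P n a)"
    by (intro eventually_ball_finite) auto
  then show ?thesis by (simp add: eventually_sequentially)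
qed

text \<open>Each position of \<open>blk p n\<close> is the address of a path tail equivalent to
  \<open>p\<close>, and growth makes the number of positions unbounded.\<close>

lemma infinite_tail_class:
  assumes "p \<in> Y"
  shows "infinite (tail_rel B `` {p})"
proof
  assume fin: "finite (tail_rel B `` {p})"
  obtain n where n: "card (tail_rel B `` {p}) < length (blk p n)"
    using P_length_large[of "Suc (card (tail_rel B `` {p}))"] unfolding blk_def
    by (meson Suc_le_eq order_refl)
  have "\<exists>q. q \<in> tail_rel B `` {p} \<and> offs q n = j" if "j < length (blk p n)" for j
    using address_path_exists[OF assms that] assms by (auto simp: tail_rel_iff)
  then have "{..<length (blk p n)} \<subseteq> (\<lambda>q. offs q n) ` (tail_rel B `` {p})" by blast
  then have "card {..<length (blk p n)} \<le> card ((\<lambda>q. offs q n) ` (tail_rel B `` {p}))"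
    using fin by (intro card_mono) auto
  also have "\<dots> \<le> card (tail_rel B `` {p})" by (rule card_image_le[OF fin])
  finally show False using n by simp
qed

text \<open>From level \<open>M\<close> on the letters form a backward orbit of the map from
  \<open>a\<close> to its letter at \<open>sel a\<close>, so by \<open>backward_orbit_unique\<close>
  the edges up to level \<open>M\<close> determine the whole path.\<close>

lemma countable_eventually_slot:
  "countable {p \<in> Y. \<forall>n\<ge>M. slot (p (Suc n)) = sel (letter (p (Suc n)))}" (is "countable ?S")
proof (rule countableI'[of "to_nat \<circ> (\<lambda>p. map p [0..<Suc M])"])
  show "inj_on (to_nat \<circ> (\<lambda>p. map p [0..<Suc M])) ?S"
  proof (rule inj_onI)
    fix p q assume p: "p \<in> ?S" and q: "q \<in> ?S"
      and "(to_nat \<circ> (\<lambda>p. map p [0..<Suc M])) p = (to_nat \<circ> (\<lambda>p. map p [0..<Suc M])) q"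
    then have "map p [0..<Suc M] = map q [0..<Suc M]" by simp
    then have le: "p i = q i" if "i \<le> M" for i using that by (simp add: map_eq_conv del: upt_Suc)
    have l: "letter (r (M + n)) = (\<lambda>a. \<sigma> a ! sel a) (letter (r (M + Suc n)))" if "r \<in> ?S" for r n
      using that Y_letter[of r "M + n"] by simp
    have letters: "letter (p (M + n)) = letter (q (M + n))" for n
      using backward_orbit_unique[of "\<lambda>n. letter (p (M + n))" "\<lambda>a. \<sigma> a ! sel a" "\<lambda>n. letter (q (M + n))" n]
        l[OF p] l[OF q] le[of M] by simp
    have "p i = q i" if "i > M" for i
    proof -
      obtain n where n: "i = Suc (M + n)" using \<open>i > M\<close> less_imp_Suc_add by blast
      have "letter (p i) = letter (q i)" using letters[of "Suc n"] n by simp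
      moreover have "slot (p i) = sel (letter (p i))" "slot (q i) = sel (letter (q i))"
        using p q n by auto
      ultimately show ?thesis using Y_edge[of p "M + n"] Y_edge[of q "M + n"] p q n by simp
    qed
    then show "p = q" using le by (metis ext not_le)
  qed
qed

lemma bad_cases:
  assumes "p \<in> Y" "\<not> good p"
  shows "(\<exists>N. \<forall>n. offs p n \<le> N) \<or> (\<exists>N. \<forall>n. rem p n \<le> N)"
  using assms unfolding good_def by (meson nat_le_linear)

text \<open>A bounded end is eventually constant. Nothing is added on the left only at slot 0,
  nothing on the right only at the last slot, and either slot is a function of the letter.\<close>

lemma countable_bad_paths: "countable {p \<in> Y. \<not> good p}"
proof (rule countable_subset)
  let ?S = "\<lambda>M sel. {p \<in> Y. \<forall>n\<ge>M. slot (p (Suc n)) = sel (letter (p (Suc n)))}"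
  let ?last = "\<lambda>a. length (\<sigma> a) - 1"
  show "{p \<in> Y. \<not> good p} \<subseteq> (\<Union>M. ?S M (\<lambda>_. 0)) \<union> (\<Union>M. ?S M ?last)"
  proof safe
    fix p assume p: "p \<in> Y" "\<not> good p" and nin: "p \<notin> (\<Union>M. ?S M ?last)"
    show "p \<in> (\<Union>M. ?S M (\<lambda>_. 0))"
      using bad_cases[OF p]
    proof
      assume "\<exists>N. \<forall>n. offs p n \<le> N"
      then obtain M where M: "\<And>n. M \<le> n \<Longrightarrow> offs p n = offs p M"
        using bounded_incseq_eventually_const[of "offs p"] offs_mono[OF p(1)] by blast
      have "slot (p (Suc n)) = 0" if "M \<le> n" for n
      proof -
        have "ext (P n) (take (slot (p (Suc n))) (\<sigma> (letter (p (Suc n))))) = []"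
          using M[of n] M[of "Suc n"] that by simp
        then have "take (slot (p (Suc n))) (\<sigma> (letter (p (Suc n)))) = []"
          using P_nonempty by (cases "take (slot (p (Suc n))) (\<sigma> (letter (p (Suc n))))") auto
        then show ?thesis by (simp add: \<sigma>_nonempty)
      qed
      then show ?thesis using p(1) by blast
    next
      assume "\<exists>N. \<forall>n. rem p n \<le> N"
      then obtain M where M: "\<And>n. M \<le> n \<Longrightarrow> rem p n = rem p M"
        using bounded_incseq_eventually_const[of "rem p"] rem_mono[OF p(1)] by blast
      have "slot (p (Suc n)) = ?last (letter (p (Suc n)))" if "M \<le> n" for n
      proof -
        have "ext (P n) (drop (Suc (slot (p (Suc n)))) (\<sigma> (letter (p (Suc n))))) = []"
          using M[of n] M[of "Suc n"] that rem_Suc[OF p(1), of n] by simp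
        then have "drop (Suc (slot (p (Suc n)))) (\<sigma> (letter (p (Suc n)))) = []"
          using P_nonempty by (cases "drop (Suc (slot (p (Suc n)))) (\<sigma> (letter (p (Suc n))))") auto
        then show ?thesis using Y_slot[OF p(1), of n] by simp
      qed
      then show ?thesis using p(1) nin by blast
    qed
  qed
  show "countable ((\<Union>M. ?S M (\<lambda>_. 0)) \<union> (\<Union>M. ?S M ?last))"
    using countable_eventually_slot by (intro countable_Un countable_UN) auto
qed

text \<open>The odometer through \<open>n\<close> levels: a carry reaches level \<open>n\<close>
  exactly when the origin is the last position of the whole block. No goodness is assumed, as the
  count of bad points requires.\<close>

lemma F_tr_1:
  assumes x: "x \<in> X"
  shows "if offs (F x) n + 1 < length (blk (F x) n)
    then (D ^^ n) (tr 1 x) = (D ^^ n) x \<and> offs (F (tr 1 x)) n = offs (F x) n + 1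
    else (D ^^ n) (tr 1 x) = tr 1 ((D ^^ n) x) \<and> offs (F (tr 1 x)) n = 0"
proof (induction n)
  case 0
  then show ?case by (simp add: blk_def)
next
  case (Suc n)
  define y where "y = (D ^^ n) x"
  define z where "z = (D ^^ n) (tr 1 x)"
  let ?s = "\<sigma> (D y 0)"
  have y: "y \<in> X" using funpow_D_in_X[OF x] by (simp add: y_def)
  have K: "K y < length ?s" by (rule K_less[OF y])
  have o: "offs (F x) (Suc n) = length (ext (P n) (take (K y) ?s)) + offs (F x) n"
    "offs (F (tr 1 x)) (Suc n) = length (ext (P n) (take (K z) (\<sigma> (D z 0)))) + offs (F (tr 1 x)) n"
    by (simp_all add: F_Suc y_def z_def)
  have b: "blk (F x) (Suc n) = ext (P n) (take (K y) ?s) @ blk (F x) n @ ext (P n) (drop (Suc (K y)) ?s)"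
    using blk_Suc[OF F_in_Y[OF x], of n] by (simp add: F_Suc y_def)
  show ?case
  proof (cases "offs (F x) n + 1 < length (blk (F x) n)")
    case True
    then have "z = y" "offs (F (tr 1 x)) n = offs (F x) n + 1" using Suc.IH by (auto simp: y_def z_def)
    then show ?thesis using True o b by (auto simp: y_def z_def)
  next
    case False
    then have z: "z = tr 1 y" "offs (F (tr 1 x)) n = 0" using Suc.IH by (auto simp: y_def z_def)
    have len: "length (blk (F x) n) = offs (F x) n + 1"
      using False offs_less[OF F_in_Y[OF x], of n] by simp
    have blk: "blk (F x) n = P n (y 0)" by (simp add: blk_def y_def)
    have "y 0 = ?s ! K y" using parsing_nth[OF D_parsing[OF y], of "K y" 0] K by simp
    then have tk: "ext (P n) (take (Suc (K y)) ?s) = ext (P n) (take (K y) ?s) @ blk (F x) n"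
      using K blk by (simp add: take_Suc_conv_app_nth)
    show ?thesis
    proof (cases "K y + 1 < length ?s")
      case True
      then have d: "D z = D y" "K z = K y + 1" using desub_tr[OF y] z(1) by auto
      have "drop (Suc (K y)) ?s \<noteq> []" using True by simp
      then have "ext (P n) (drop (Suc (K y)) ?s) \<noteq> []"
        using P_nonempty by (cases "drop (Suc (K y)) ?s") auto
      then have "0 < length (ext (P n) (drop (Suc (K y)) ?s))" by (rule length_greater_0_conv[THEN iffD2])
      moreover have "length (blk (F x) (Suc n)) = length (ext (P n) (take (K y) ?s)) +
          length (blk (F x) n) + length (ext (P n) (drop (Suc (K y)) ?s))"
        by (simp only: b length_append add.assoc)
      ultimately have lt: "offs (F x) (Suc n) + 1 < length (blk (F x) (Suc n))"
        using o(1) len by linarith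
      have "offs (F (tr 1 x)) (Suc n) = offs (F x) (Suc n) + 1"
        using o d z(2) tk len by simp
      then show ?thesis using lt d by (simp add: y_def z_def)
    next
      case False
      then have d: "D z = tr 1 (D y)" "K z = 0" using desub_tr[OF y] z(1) by auto
      have "drop (Suc (K y)) ?s = []" using False by simp
      then have "\<not> offs (F x) (Suc n) + 1 < length (blk (F x) (Suc n))"
        using o(1) b len by simp
      moreover have "offs (F (tr 1 x)) (Suc n) = 0" using o(2) d z(2) by simp
      ultimately show ?thesis using d by (simp add: y_def z_def)
    qed
  qed
qed

lemma F_tr_forward:
  assumes x: "x \<in> X"
  shows "offs (F x) n + k < length (blk (F x) n) \<Longrightarrow>
    offs (F (tr (int k) x)) n = offs (F x) n + k \<and> blk (F (tr (int k) x)) n = blk (F x) n"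
proof (induction k)
  case (Suc k)
  let ?y = "tr (int k) x"
  have y: "?y \<in> X" by (rule tr_in_X[OF x])
  have IH: "offs (F ?y) n = offs (F x) n + k" "blk (F ?y) n = blk (F x) n"
    using Suc by auto
  then have "offs (F ?y) n + 1 < length (blk (F ?y) n)" using Suc.prems by simp
  then have "(D ^^ n) (tr 1 ?y) = (D ^^ n) ?y" "offs (F (tr 1 ?y)) n = offs (F ?y) n + 1"
    using F_tr_1[OF y, of n] by auto
  moreover have "tr 1 ?y = tr (int (Suc k)) x" by simp
  ultimately show ?case using IH by (simp add: blk_def)
qed simp

lemma F_tr_backward:
  assumes x: "x \<in> X"
  shows "k \<le> offs (F (tr (int k) x)) n \<Longrightarrow>
    offs (F (tr (int k) x)) n = offs (F x) n + k \<and> blk (F (tr (int k) x)) n = blk (F x) n"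
proof (induction k)
  case (Suc k)
  let ?y = "tr (int k) x"
  have y: "?y \<in> X" by (rule tr_in_X[OF x])
  have e: "tr 1 ?y = tr (int (Suc k)) x" by simp
  have "(D ^^ n) (tr 1 ?y) = (D ^^ n) ?y" "offs (F (tr 1 ?y)) n = offs (F ?y) n + 1"
    using F_tr_1[OF y, of n] Suc.prems unfolding e by (auto split: if_splits)
  then show ?case using Suc unfolding e by (simp add: blk_def)
qed simp

text \<open>If the blocks around the origin of \<open>x\<close> do not grow to the left, then all of them start at
  the same position \<open>- o\<close>, and \<open>x\<close> is determined by the two bad paths at \<open>0\<close> and at \<open>- o - 1\<close>.\<close>

lemma countable_bounded_offs: "countable {x \<in> X. \<exists>N. \<forall>n. offs (F x) n \<le> N}"
proof -
  define C where "C k = {x \<in> X. (\<forall>n. offs (F x) n \<le> k) \<and> (\<exists>n. offs (F x) n = k)}" for k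
  have "{x \<in> X. \<exists>N. \<forall>n. offs (F x) n \<le> N} \<subseteq> (\<Union>k. C k)"
  proof safe
    fix x N assume x: "x \<in> X" and N: "\<forall>n. offs (F x) n \<le> N"
    then obtain M where M: "\<And>n. M \<le> n \<Longrightarrow> offs (F x) n = offs (F x) M"
      using bounded_incseq_eventually_const[of "offs (F x)"] offs_mono[OF F_in_Y[OF x]] by blast
    have "offs (F x) n \<le> offs (F x) M" for n
      using offs_mono[OF F_in_Y[OF x], of n "max n M"] M[of "max n M"] by simp
    then show "x \<in> (\<Union>k. C k)" using x unfolding C_def by blast
  qed
  moreover have "countable (C k)" for k
  proof -
    let ?g = "\<lambda>x. tr (- int k - 1) x" and ?bad = "{p \<in> Y. \<not> good p}"
    \<comment> \<open>A larger value would put the origin of \<open>x\<close> into the same block as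
      \<open>- k - 1\<close> and give \<open>x\<close> an offset of at least
      \<open>k + 1\<close>.\<close>
    have rem: "rem (F (?g x)) n \<le> k + 1" if "x \<in> C k" for x n
    proof (rule ccontr)
      assume "\<not> rem (F (?g x)) n \<le> k + 1"
      moreover have gx: "?g x \<in> X" using that by (simp add: C_def tr_in_X_iff)
      ultimately have "offs (F (?g x)) n + (k + 1) < length (blk (F (?g x)) n)"
        using offs_add_rem[OF F_in_Y[OF gx], of n] by simp
      from F_tr_forward[OF gx this] have "k + 1 \<le> offs (F x) n" by simp
      moreover have "offs (F x) n \<le> k" using that by (simp add: C_def)
      ultimately show False by simp
    qed
    have "(\<lambda>x. (F x, F (?g x))) ` C k \<subseteq> ?bad \<times> ?bad"
    proof
      fix r assume "r \<in> (\<lambda>x. (F x, F (?g x))) ` C k"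
      then obtain x where x: "x \<in> C k" "r = (F x, F (?g x))" by blast
      then have X: "x \<in> X" "?g x \<in> X" by (auto simp: C_def tr_in_X_iff)
      have "\<not> Suc k \<le> offs (F x) n" for n using x(1) by (simp add: C_def not_less_eq_eq)
      moreover have "\<not> k + 2 \<le> rem (F (?g x)) n" for n using rem[OF x(1), of n] by simp
      ultimately have "\<not> good (F x)" "\<not> good (F (?g x))" unfolding good_def by blast+
      then show "r \<in> ?bad \<times> ?bad" using x(2) F_in_Y X by simp
    qed
    then have "countable ((\<lambda>x. (F x, F (?g x))) ` C k)"
      using countable_bad_paths by (meson countable_SIGMA countable_subset)
    moreover have "inj_on (\<lambda>x. (F x, F (?g x))) (C k)"
    proof (rule inj_onI)
      fix x x' assume x: "x \<in> C k" and x': "x' \<in> C k" and "(F x, F (?g x)) = (F x', F (?g x'))"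
      then have eq: "F x = F x'" "F (?g x) = F (?g x')" by auto
      have X: "x \<in> X" "?g x \<in> X" "x' \<in> X" "?g x' \<in> X" using x x' by (auto simp: C_def tr_in_X_iff)
      show "x = x'"
      proof
        fix t :: int
        \<comment> \<open>The block of \<open>x\<close> starts at \<open>- k\<close>, and the block
          around \<open>- k - 1\<close> ends at most \<open>k + 1\<close> further right; with this
          length one of the two reaches \<open>t\<close>.\<close>
        obtain n0 where n0: "\<And>n a. n0 \<le> n \<Longrightarrow> nat \<bar>t\<bar> + 2 * k + 4 \<le> length (P n a)"
          using P_length_large by blast
        obtain n1 where n1: "offs (F x) n1 = k" using x by (auto simp: C_def)
        define n where "n = max n0 n1"
        have len: "int (nat \<bar>t\<bar> + 2 * k + 4) \<le> int (length (blk p n))" for p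
          using n0[of n "letter (p n)"] unfolding blk_def of_nat_le_iff by (simp add: n_def)
        show "x t = x' t"
        proof (cases "- int k \<le> t")
          case True
          have "offs (F x) n = k"
            using x offs_mono[OF F_in_Y[OF X(1)], of n1 n] n1 by (simp add: C_def n_def le_antisym)
          then have t: "- int (offs (F x) n) \<le> t" "t < int (rem (F x) n)"
            using True len[of "F x"] offs_add_rem[OF F_in_Y[OF X(1)], of n] by linarith+
          have "follows x' (F x) n" using F_follows[OF X(3)] by (simp only: eq(1))
          from follows_eq[OF F_in_Y[OF X(1)] F_follows[OF X(1)] this t] show ?thesis .
        next
          case False
          let ?s = "t + int k + 1"
          have t: "- int (offs (F (?g x)) n) \<le> ?s" "?s < int (rem (F (?g x)) n)"
            using False len[of "F (?g x)"] offs_add_rem[OF F_in_Y[OF X(2)], of n] rem[OF x, of n]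
              rem_pos[OF F_in_Y[OF X(2)], of n] by linarith+
          have "follows (?g x') (F (?g x)) n" using F_follows[OF X(4)] by (simp only: eq(2))
          from follows_eq[OF F_in_Y[OF X(2)] F_follows[OF X(2)] this t] have "?g x ?s = ?g x' ?s" .
          then show ?thesis by (simp add: tr_def)
        qed
      qed
    qed
    ultimately show ?thesis using countable_image_inj_on by blast
  qed
  ultimately show ?thesis by (meson countable_UN countable_subset countableI_type)
qed

text \<open>If the blocks reach at most \<open>k\<close> to the right, then after shifting by
  \<open>k\<close> they have bounded offsets: a block extending more than \<open>k\<close> to the
  left would contain the origin of \<open>x\<close> and reach too far to its right.\<close>

lemma countable_bad_points: "countable {x \<in> X. \<not> good (F x)}"
proof (rule countable_subset)
  let ?C = "{x \<in> X. \<exists>N. \<forall>n. offs (F x) n \<le> N}"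
  show "{x \<in> X. \<not> good (F x)} \<subseteq> ?C \<union> (\<Union>k. tr (- int k) ` ?C)"
  proof safe
    fix x assume x: "x \<in> X" "\<not> good (F x)" and nin: "x \<notin> (\<Union>k. tr (- int k) ` ?C)"
    show "\<exists>N. \<forall>n. offs (F x) n \<le> N"
      using bad_cases[OF F_in_Y[OF x(1)] x(2)]
    proof
      assume "\<exists>N. \<forall>n. rem (F x) n \<le> N"
      then obtain k where k: "\<And>n. rem (F x) n \<le> k" by blast
      let ?y = "tr (int k) x"
      have y: "?y \<in> X" by (rule tr_in_X[OF x(1)])
      have "offs (F ?y) n \<le> k" for n
      proof (rule ccontr)
        assume "\<not> offs (F ?y) n \<le> k"
        then have "offs (F ?y) n = offs (F x) n + k" "length (blk (F ?y) n) = length (blk (F x) n)"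
          using F_tr_backward[OF x(1), of k n] by auto
        then show False
          using offs_add_rem[OF F_in_Y[OF x(1)], of n] offs_add_rem[OF F_in_Y[OF y], of n]
            rem_pos[OF F_in_Y[OF y], of n] k[of n] by linarith
      qed
      then have "?y \<in> ?C" using y by blast
      moreover have "x = tr (- int k) ?y" by simp
      ultimately show ?thesis using nin by blast
    qed
  qed
  show "countable (?C \<union> (\<Union>k. tr (- int k) ` ?C))"
    by (rule countable_Un[OF countable_bounded_offs countable_UN[OF countableI_type
          countable_image[OF countable_bounded_offs]]])
qed

end

section \<open>Transport of measures\<close>

definition conull :: "'b measure \<Rightarrow> 'b set \<Rightarrow> bool" where
  "conull M Z \<longleftrightarrow> Z \<in> sets M \<and> emeasure M (space M - Z) = 0"

lemma conull_emeasure_eq: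
  assumes "conull M Z" "A \<in> sets M" "C \<in> sets M" "A \<inter> Z = C \<inter> Z"
  shows "emeasure M A = emeasure M C"
proof (rule emeasure_eq_AE)
  have "space M - Z \<in> null_sets M" using assms(1) by (auto simp: conull_def)
  then have "AE x in M. x \<notin> space M - Z" by (rule AE_not_in)
  then show "AE x in M. (x \<in> A) = (x \<in> C)"
    using sets.sets_into_space[OF assms(2)] sets.sets_into_space[OF assms(3)] assms(4)
    by (auto elim!: eventually_mono)
qed fact+

lemma conull_countable_compl:
  assumes Z: "Z \<subseteq> space M" and N: "countable (space M - Z)"
    and sing: "\<And>x. x \<in> space M \<Longrightarrow> {x} \<in> sets M"
    and null: "\<And>x. x \<in> space M - Z \<Longrightarrow> emeasure M {x} = 0"
  shows "conull M Z"
proof -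
  have compl: "space M - Z \<in> sets M" by (rule sets.countable[OF _ N]) (use sing in blast)
  from sets.compl_sets[OF this] have "Z \<in> sets M" using Z by (simp add: double_diff)
  moreover have "space M - Z = (\<Union>x\<in>space M - Z. {x})" by blast
  moreover have "(\<Union>x\<in>space M - Z. {x}) \<in> null_sets M"
    using N sing null by (intro null_sets_UN') auto
  ultimately show ?thesis unfolding conull_def by auto
qed

lemma nonatomic_singleton:
  assumes "nonatomic M" "{x} \<in> sets M"
  shows "emeasure M {x} = 0"
proof (rule ccontr)
  assume "emeasure M {x} \<noteq> 0"
  then obtain C where "C \<subseteq> {x}" "0 < emeasure M C" "emeasure M C < emeasure M {x}"
    using assms unfolding nonatomic_def by (metis not_gr_zero)
  then show False by (auto simp: subset_singleton_iff)
qed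

text \<open>The masses of a sequence of distinct points of \<open>S\<close> are summable, and a
  constant summable sequence vanishes.\<close>

lemma prob_equal_singletons:
  assumes M: "prob_space M" and inf: "infinite S"
    and sing: "\<And>x. x \<in> S \<Longrightarrow> {x} \<in> sets M \<and> emeasure M {x} = c"
  shows "c = 0"
proof -
  obtain f :: "nat \<Rightarrow> 'a" where f: "inj f" "range f \<subseteq> S"
    using infinite_countable_subset[OF inf] by blast
  interpret prob_space M by (rule M)
  have fS: "{f i} \<in> sets M" "emeasure M {f i} = c" for i using f(2) sing by blast+
  have "(\<lambda>i. measure M {f i}) sums measure M (\<Union>i. {f i})"
    using f(1) fS by (intro finite_measure_UNION) (auto simp: disjoint_family_on_def inj_def)
  then have "summable (\<lambda>i::nat. enn2real c)"
    using fS(2) by (auto simp: measure_def dest: sums_summable)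
  then have "enn2real c = 0" by (simp only: summable_const_iff)
  then have "measure M {f 0} = 0" using fS(2) by (simp add: measure_def)
  then show ?thesis using fS(2)[of 0] emeasure_eq_measure[of "{f 0}"] by simp
qed

text \<open>\<open>f\<close> is cut into disjoint pieces \<open>E i\<close> on which it is
  \<open>\<phi> i\<close>. The part of \<open>A\<close> covered by such a piece is described by a
  preimage under the inverse \<open>g\<close>, so no forward image of a Borel set has to be
  measurable. All identities hold up to the null complement of \<open>Z\<close>.\<close>

lemma piecewise_preserving:
  fixes \<phi> :: "nat \<Rightarrow> 'b \<Rightarrow> 'b"
  assumes Z: "conull M Z" and f: "f \<in> M \<rightarrow>\<^sub>M M" and g: "g \<in> M \<rightarrow>\<^sub>M M"
    and fg: "\<And>p. p \<in> Z \<Longrightarrow> f p \<in> Z \<and> g (f p) = p" and gf: "\<And>p. p \<in> Z \<Longrightarrow> g p \<in> Z \<and> f (g p) = p"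
    and \<phi>: "\<And>i. \<phi> i \<in> M \<rightarrow>\<^sub>M M" "\<And>i p. p \<in> Z \<Longrightarrow> \<phi> i p \<in> Z" "\<And>i. inj_on (\<phi> i) Z"
    and inv: "\<And>i A. A \<in> sets M \<Longrightarrow> emeasure M (\<phi> i -` A \<inter> space M) = emeasure M A"
    and cover: "\<And>p. p \<in> Z \<Longrightarrow> \<exists>i. f p = \<phi> i p"
    and eq: "\<And>i. {p \<in> Z. f p = \<phi> i p} \<in> sets M"
    and A: "A \<in> sets M"
  shows "emeasure M (f -` A \<inter> space M) = emeasure M A"
proof -
  define D where "D i = {p \<in> Z. f p = \<phi> i p}" for i
  define E where "E = disjointed D"
  have ZM: "Z \<in> sets M" and Zsp: "Z \<subseteq> space M"
    using Z sets.sets_into_space by (auto simp: conull_def)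
  have E_sets: "E i \<in> sets M" for i
    using sets.range_disjointed_sets[of D M] eq unfolding E_def D_def by auto
  have E_un: "(\<Union>i. E i) = Z"
    using cover unfolding E_def UN_disjointed_eq D_def by auto
  have E_disj: "disjoint_family E" unfolding E_def by (rule disjoint_family_disjointed)
  have E_D: "E i \<subseteq> D i" for i unfolding E_def by (rule disjointed_subset)
  define C where "C i = (f -` A \<inter> space M) \<inter> E i" for i
  define H where "H i = A \<inter> Z \<inter> (g -` E i \<inter> space M)" for i
  have fA: "f -` A \<inter> space M \<in> sets M" by (rule measurable_sets[OF f A])
  have C_sets: "C i \<in> sets M" for i using fA E_sets by (simp add: C_def sets.Int)
  have H_sets: "H i \<in> sets M" for i
    unfolding H_def by (rule sets.Int[OF sets.Int[OF A ZM] measurable_sets[OF g E_sets]])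
  have "emeasure M (C i) = emeasure M (H i)" for i
  proof -
    have "(\<phi> i -` H i \<inter> space M) \<inter> Z = C i \<inter> Z"
    proof (intro equalityI subsetI)
      fix p assume p: "p \<in> (\<phi> i -` H i \<inter> space M) \<inter> Z"
      then have h: "\<phi> i p \<in> A" "\<phi> i p \<in> Z" "g (\<phi> i p) \<in> E i" by (auto simp: H_def)
      then have "f (g (\<phi> i p)) = \<phi> i (g (\<phi> i p))" using E_D[of i] by (auto simp: D_def)
      then have "\<phi> i p = \<phi> i (g (\<phi> i p))" using gf[OF h(2)] by simp
      then have "p = g (\<phi> i p)" using \<phi>(3)[of i] gf[OF h(2)] p by (auto dest: inj_onD)
      then show "p \<in> C i \<inter> Z" using h p E_D[of i] by (auto simp: C_def D_def)
    next
      fix p assume p: "p \<in> C i \<inter> Z"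
      then have "f p = \<phi> i p" "p \<in> E i" "f p \<in> A" using E_D[of i] by (auto simp: C_def D_def)
      then show "p \<in> (\<phi> i -` H i \<inter> space M) \<inter> Z"
        using p fg[of p] Zsp by (auto simp: H_def)
    qed
    then have "emeasure M (\<phi> i -` H i \<inter> space M) = emeasure M (C i)"
      using measurable_sets[OF \<phi>(1) H_sets] C_sets by (intro conull_emeasure_eq[OF Z])
    then show ?thesis using inv[OF H_sets] by simp
  qed
  moreover have "(\<Sum>i. emeasure M (C i)) = emeasure M (\<Union>i. C i)"
    using C_sets E_disj by (intro suminf_emeasure) (auto simp: C_def disjoint_family_on_def)
  moreover have "(\<Sum>i. emeasure M (H i)) = emeasure M (\<Union>i. H i)"
    using H_sets E_disj by (intro suminf_emeasure) (auto simp: H_def disjoint_family_on_def)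
  moreover have "emeasure M (\<Union>i. C i) = emeasure M (f -` A \<inter> space M)"
  proof (rule conull_emeasure_eq[OF Z])
    show "(\<Union>i. C i) \<inter> Z = f -` A \<inter> space M \<inter> Z" using E_un by (auto simp: C_def)
  qed (use C_sets fA in auto)
  moreover have "emeasure M (\<Union>i. H i) = emeasure M A"
  proof (rule conull_emeasure_eq[OF Z])
    show "(\<Union>i. H i) \<inter> Z = A \<inter> Z"
    proof (intro equalityI subsetI)
      fix p assume p: "p \<in> A \<inter> Z"
      then have "g p \<in> Z" using gf by blast
      then obtain i where "g p \<in> E i" using E_un by blast
      then show "p \<in> (\<Union>i. H i) \<inter> Z" using p Zsp by (auto simp: H_def)
    qed (auto simp: H_def)
  qed (use H_sets A in auto)
  ultimately show ?thesis by simp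
qed

text \<open>\<open>M\<close> is the measure to be transported, while \<open>N\<close> and
  \<open>N'\<close> provide the sigma-algebras. The maps are measurable on the whole spaces but
  mutually inverse only between \<open>X0\<close> and \<open>Y0\<close>; the symmetric form allows
  use in both directions.\<close>

locale mod_null_iso =
  fixes M N :: "'b measure" and N' :: "'c measure" and X0 :: "'b set" and Y0 :: "'c set"
    and F :: "'b \<Rightarrow> 'c" and G :: "'c \<Rightarrow> 'b"
  assumes sets_M: "sets M = sets N" and conull_X0: "conull M X0" and Y0: "Y0 \<in> sets N'"
    and F_meas: "F \<in> N \<rightarrow>\<^sub>M N'" and G_meas: "G \<in> N' \<rightarrow>\<^sub>M N"
    and FX: "\<And>x. x \<in> X0 \<Longrightarrow> F x \<in> Y0 \<and> G (F x) = x"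
    and GY: "\<And>y. y \<in> Y0 \<Longrightarrow> G y \<in> X0 \<and> F (G y) = y"
begin

lemma F_measM: "F \<in> M \<rightarrow>\<^sub>M N'"
  using F_meas measurable_cong_sets[OF sets_M refl] by blast

lemma G_measM: "G \<in> N' \<rightarrow>\<^sub>M M"
  using G_meas measurable_cong_sets[OF refl sets_M] by blast

abbreviation "pushed \<equiv> distr M N' F"

lemma conull_image: "conull pushed Y0"
proof -
  have "F -` (space N' - Y0) \<inter> space M \<in> sets M"
    using Y0 by (intro measurable_sets[OF F_measM]) auto
  moreover have "{} \<in> sets M" by simp
  ultimately have "emeasure M (F -` (space N' - Y0) \<inter> space M) = emeasure M {}"
    using FX by (intro conull_emeasure_eq[OF conull_X0]) auto
  then show ?thesis
    using Y0 by (simp add: conull_def emeasure_distr[OF F_measM])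
qed

lemma emeasure_image_vimage:
  assumes "A \<in> sets M"
  shows "emeasure pushed (G -` A \<inter> space N') = emeasure M A"
proof -
  have GA: "G -` A \<inter> space N' \<in> sets N'" using measurable_sets[OF G_measM assms] .
  have "emeasure pushed (G -` A \<inter> space N') = emeasure M (F -` (G -` A \<inter> space N') \<inter> space M)"
    by (rule emeasure_distr[OF F_measM GA])
  also have "\<dots> = emeasure M A"
  proof (rule conull_emeasure_eq[OF conull_X0])
    show "F -` (G -` A \<inter> space N') \<inter> space M \<inter> X0 = A \<inter> X0"
      using FX sets.sets_into_space[OF assms] measurable_space[OF F_measM] by fastforce
  qed (use assms measurable_sets[OF F_measM GA] in auto)
  finally show ?thesis .
qed

lemma distr_image: "distr pushed N G = M"
proof (rule measure_eqI)
  show "sets (distr pushed N G) = sets M" by (simp add: sets_M)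
  fix A assume "A \<in> sets (distr pushed N G)"
  then have A: "A \<in> sets N" by simp
  then show "emeasure (distr pushed N G) A = emeasure M A"
    using emeasure_distr[of G pushed N A] G_meas emeasure_image_vimage[of A] sets_M by simp
qed

lemma nonatomic_image:
  assumes "nonatomic M"
  shows "nonatomic pushed"
  unfolding nonatomic_def
proof (intro ballI impI)
  fix A assume "A \<in> sets pushed" and pos: "0 < emeasure pushed A"
  then have A: "A \<in> sets N'" by simp
  have FA: "F -` A \<inter> space M \<in> sets M" by (rule measurable_sets[OF F_measM A])
  have "0 < emeasure M (F -` A \<inter> space M)" using pos by (simp add: emeasure_distr[OF F_measM A])
  then obtain C where C: "C \<in> sets M" "C \<subseteq> F -` A \<inter> space M" "0 < emeasure M C"
    "emeasure M C < emeasure M (F -` A \<inter> space M)"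
    using assms FA unfolding nonatomic_def by blast
  \<comment> \<open>\<open>C\<close> is carried over as a preimage under \<open>G\<close>, which is
    measurable, instead of an image under \<open>F\<close>; the intersection keeps it inside
    \<open>A\<close>.\<close>
  define C' where "C' = (G -` C \<inter> space N') \<inter> A"
  have C'_sets: "C' \<in> sets N'"
    unfolding C'_def using measurable_sets[OF G_measM C(1)] A by (rule sets.Int)
  have "emeasure pushed C' = emeasure M (F -` C' \<inter> space M)"
    by (rule emeasure_distr[OF F_measM C'_sets])
  also have "\<dots> = emeasure M C"
  proof (rule conull_emeasure_eq[OF conull_X0])
    show "F -` C' \<inter> space M \<inter> X0 = C \<inter> X0"
      using FX C(2) measurable_space[OF F_measM] by (fastforce simp: C'_def)
  qed (use C(1) measurable_sets[OF F_measM C'_sets] in auto)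
  finally show "\<exists>C\<in>sets pushed. C \<subseteq> A \<and> 0 < emeasure pushed C \<and> emeasure pushed C < emeasure pushed A"
    using C C'_sets by (intro bexI[of _ C']) (auto simp: C'_def emeasure_distr[OF F_measM A])
qed

lemma infinite_sigma_finite_image:
  assumes "infinite_sigma_finite M"
  shows "infinite_sigma_finite pushed"
proof -
  have M: "sigma_finite_measure M" "emeasure M (space M) = \<infinity>"
    using assms by (auto simp: infinite_sigma_finite_def)
  then obtain \<A> where \<A>: "countable \<A>" "\<A> \<subseteq> sets M" "\<Union>\<A> = space M" "\<forall>a\<in>\<A>. emeasure M a \<noteq> \<infinity>"
    using sigma_finite_measure.sigma_finite_countable[OF M(1)] by auto
  have "sigma_finite_measure pushed"
  proof
    show "\<exists>A. countable A \<and> A \<subseteq> sets pushed \<and> \<Union>A = space pushed \<and> (\<forall>a\<in>A. emeasure pushed a \<noteq> \<infinity>)"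
    proof (intro exI[of _ "(\<lambda>a. G -` a \<inter> space N') ` \<A>"] conjI)
      show "countable ((\<lambda>a. G -` a \<inter> space N') ` \<A>)" using \<A>(1) by simp
      show "(\<lambda>a. G -` a \<inter> space N') ` \<A> \<subseteq> sets pushed"
        using \<A>(2) measurable_sets[OF G_measM] by auto
      have "(\<Union>a\<in>\<A>. G -` a \<inter> space N') = G -` \<Union>\<A> \<inter> space N'" by blast
      also have "\<dots> = space N'" unfolding \<A>(3) using measurable_space[OF G_measM] by blast
      finally show "\<Union>((\<lambda>a. G -` a \<inter> space N') ` \<A>) = space pushed" by auto
      show "\<forall>a\<in>(\<lambda>a. G -` a \<inter> space N') ` \<A>. emeasure pushed a \<noteq> \<infinity>"
        using \<A>(2,4) emeasure_image_vimage by auto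
    qed
  qed
  moreover have "F -` space N' \<inter> space M = space M" using measurable_space[OF F_measM] by blast
  then have "emeasure pushed (space pushed) = \<infinity>"
    using M(2) by (simp add: emeasure_distr[OF F_measM])
  ultimately show ?thesis by (simp add: infinite_sigma_finite_def)
qed

end

section \<open>The topologies and their Borel sets\<close>

lemma space_borel_of [simp]: "space (borel_of T) = topspace T"
  unfolding borel_of_def by (rule space_measure_of) (auto dest: openin_subset)

lemma sets_borel_of: "sets (borel_of T) = sigma_sets (topspace T) {U. openin T U}"
  unfolding borel_of_def by (rule sets_measure_of) (auto dest: openin_subset)

lemma openin_borel_of: "openin T U \<Longrightarrow> U \<in> sets (borel_of T)"
  by (simp add: sets_borel_of)

lemma measurable_borel_ofI:
  assumes "f \<in> space M \<rightarrow> topspace T" "\<And>U. openin T U \<Longrightarrow> f -` U \<inter> space M \<in> sets M"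
  shows "f \<in> M \<rightarrow>\<^sub>M borel_of T"
  unfolding borel_of_def using assms by (intro measurable_measure_of) (auto dest: openin_subset)

lemma topspace_path_top [simp]: "topspace (path_top D) = path_space D"
proof -
  have "cylinder D [] = path_space D" by (simp add: cylinder_def)
  then have "path_space D \<subseteq> \<Union>(range (cylinder D))" by blast
  moreover have "\<Union>(range (cylinder D)) \<subseteq> path_space D" by (auto simp: cylinder_def)
  ultimately show ?thesis by (simp add: path_top_def)
qed

lemma openin_cylinder: "openin (path_top D) (cylinder D es)"
  unfolding path_top_def by (rule topology_generated_by_Basis) simp

lemma openin_path_topI:
  assumes "A \<subseteq> path_space D"
    "\<And>p. p \<in> A \<Longrightarrow> \<exists>n. \<forall>q\<in>path_space D. (\<forall>i<n. q i = p i) \<longrightarrow> q \<in> A"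
  shows "openin (path_top D) A"
  unfolding openin_subopen[of _ A]
proof
  fix p assume p: "p \<in> A"
  then obtain n where n: "\<forall>q\<in>path_space D. (\<forall>i<n. q i = p i) \<longrightarrow> q \<in> A" using assms(2) by blast
  show "\<exists>T. openin (path_top D) T \<and> p \<in> T \<and> T \<subseteq> A"
  proof (intro exI conjI)
    show "openin (path_top D) (cylinder D (map p [0..<n]))" by (rule openin_cylinder)
    show "p \<in> cylinder D (map p [0..<n])" "cylinder D (map p [0..<n]) \<subseteq> A"
      using n p assms(1) by (auto simp: cylinder_def)
  qed
qed

lemma measurable_path_topI:
  assumes "f \<in> topspace T \<rightarrow> path_space D" "\<And>es. openin T (f -` cylinder D es \<inter> topspace T)"
  shows "f \<in> borel_of T \<rightarrow>\<^sub>M borel_of (path_top D)"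
proof (rule measurable_borel_ofI)
  show "f \<in> space (borel_of T) \<rightarrow> topspace (path_top D)" using assms(1) by simp
  have "continuous_map T (path_top D) f"
    unfolding path_top_def
  proof (rule continuous_on_generated_topo)
    show "f ` topspace T \<subseteq> \<Union>(range (cylinder D))"
      using assms(1) topspace_path_top[of D] unfolding path_top_def by auto
  qed (use assms(2) in auto)
  then show "f -` U \<inter> space (borel_of T) \<in> sets (borel_of T)" if "openin (path_top D) U" for U
    using that openin_borel_of unfolding continuous_map_alt by auto
qed

lemma singleton_path_sets:
  assumes "p \<in> path_space D"
  shows "{p} \<in> sets (borel_of (path_top D))"
proof -
  have "{p} = (\<Inter>n. cylinder D (map p [0..<n]))"
    using assms by (auto simp: cylinder_def fun_eq_iff)
  moreover have "(\<Inter>n. cylinder D (map p [0..<n])) \<in> sets (borel_of (path_top D))"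
    by (intro sets.countable_INT) (auto intro: openin_borel_of openin_cylinder)
  ultimately show ?thesis by simp
qed

lemma sets_path_coord: "{p \<in> path_space D. p n = e} \<in> sets (borel_of (path_top D))"
  by (intro openin_borel_of openin_path_topI) (auto intro!: exI[of _ "Suc n"])

text \<open>Agreement at one level is a union over the edges, hence the countability of the edge
  type.\<close>

lemma sets_path_eq:
  fixes D :: "('v, 'e :: countable) bratteli_diagram"
  assumes f: "f \<in> M \<rightarrow>\<^sub>M borel_of (path_top D)" and g: "g \<in> M \<rightarrow>\<^sub>M borel_of (path_top D)"
  shows "{p \<in> space M. f p = g p} \<in> sets M"
proof -
  have *: "{p \<in> space M. h p n = e} \<in> sets M" if "h \<in> M \<rightarrow>\<^sub>M borel_of (path_top D)" for h n and e :: 'e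
  proof -
    have "{p \<in> space M. h p n = e} = h -` {p \<in> path_space D. p n = e} \<inter> space M"
      using measurable_space[OF that] by auto
    then show ?thesis using measurable_sets[OF that sets_path_coord] by simp
  qed
  have "{p \<in> space M. f p = g p} =
      {p \<in> space M. \<forall>n. \<exists>e. f p n = e \<and> g p n = e}" by (auto simp: fun_eq_iff)
  also have "\<dots> = (\<Inter>n. \<Union>e. {p \<in> space M. f p n = e} \<inter> {p \<in> space M. g p n = e})" by auto
  also have "\<dots> \<in> sets M"
    using *[OF f] *[OF g] by (intro sets.countable_INT) auto
  finally show ?thesis .
qed

lemma topspace_subst_shift_top [simp]: "topspace (subst_shift_top \<sigma>) = subst_shift_space \<sigma>"
  by (simp add: subst_shift_top_def)

lemma openin_subst_shift_topI:
  assumes "A \<subseteq> subst_shift_space \<sigma>"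
    "\<And>x. x \<in> A \<Longrightarrow> \<exists>N::nat. \<forall>y\<in>subst_shift_space \<sigma>. (\<forall>t. \<bar>t\<bar> \<le> int N \<longrightarrow> y t = x t) \<longrightarrow> y \<in> A"
  shows "openin (subst_shift_top \<sigma>) A"
  unfolding openin_subopen[of _ A]
proof
  fix x assume x: "x \<in> A"
  then obtain N :: nat where N: "\<forall>y\<in>subst_shift_space \<sigma>. (\<forall>t. \<bar>t\<bar> \<le> int N \<longrightarrow> y t = x t) \<longrightarrow> y \<in> A"
    using assms(2) by blast
  let ?S = "\<lambda>t. if \<bar>t\<bar> \<le> int N then {x t} else UNIV"
  let ?U = "Pi\<^sub>E UNIV ?S"
  have "{t. \<bar>t\<bar> \<le> int N} = {- int N..int N}" by auto
  then have "finite {t. \<bar>t\<bar> \<le> int N}" by simp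
  moreover have "{t. ?S t \<noteq> UNIV} \<subseteq> {t. \<bar>t\<bar> \<le> int N}" by auto
  ultimately have "finite {t. ?S t \<noteq> UNIV}" by (rule rev_finite_subset)
  then have "openin (product_topology (\<lambda>_. discrete_topology UNIV) UNIV) ?U"
    unfolding openin_PiE_gen by simp
  then have "openin (subst_shift_top \<sigma>) (?U \<inter> subst_shift_space \<sigma>)"
    unfolding subst_shift_top_def by (rule openin_subtopology_Int)
  moreover have "x \<in> ?U \<inter> subst_shift_space \<sigma>" using x assms(1) by auto
  moreover have "?U \<inter> subst_shift_space \<sigma> \<subseteq> A" using N by (auto simp: PiE_iff split: if_splits)
  ultimately show "\<exists>T. openin (subst_shift_top \<sigma>) T \<and> x \<in> T \<and> T \<subseteq> A" by blast
qed

lemma openin_subst_shift_topD: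
  assumes "openin (subst_shift_top \<sigma>) U" "x \<in> U"
  shows "\<exists>N::nat. \<forall>y\<in>subst_shift_space \<sigma>. (\<forall>t. \<bar>t\<bar> \<le> int N \<longrightarrow> y t = x t) \<longrightarrow> y \<in> U"
proof -
  obtain V where V: "openin (product_topology (\<lambda>_. discrete_topology UNIV) UNIV) V"
    "U = V \<inter> subst_shift_space \<sigma>"
    using assms(1) unfolding subst_shift_top_def openin_subtopology by blast
  then obtain S where S: "finite {t. S t \<noteq> UNIV}" "x \<in> Pi\<^sub>E UNIV S" "Pi\<^sub>E UNIV S \<subseteq> V"
    using assms(2) unfolding openin_product_topology_alt by (metis (no_types, lifting) IntD1 UNIV_I topspace_discrete_topology Collect_cong)
  define N where "N = nat (Max (insert 0 (abs ` {t. S t \<noteq> UNIV})))"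
  have "\<bar>t\<bar> \<le> int N" if "S t \<noteq> UNIV" for t
    using that S(1) unfolding N_def by (simp add: Max_ge)
  then have "y \<in> Pi\<^sub>E UNIV S" if "\<forall>t. \<bar>t\<bar> \<le> int N \<longrightarrow> y t = x t" for y
    using that S(2) by (auto simp: PiE_iff) (metis UNIV_I)
  then show ?thesis using S(3) V(2) by blast
qed

lemma singleton_shift_sets:
  assumes "x \<in> subst_shift_space \<sigma>"
  shows "{x} \<in> sets (borel_of (subst_shift_top \<sigma>))"
proof -
  let ?A = "\<lambda>N::nat. {y \<in> subst_shift_space \<sigma>. \<forall>t. \<bar>t\<bar> \<le> int N \<longrightarrow> y t = x t}"
  have "{x} = (\<Inter>N. ?A N)"
  proof (intro equalityI subsetI)
    fix y assume y: "y \<in> (\<Inter>N. ?A N)"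
    have "y t = x t" for t
    proof -
      have "y \<in> ?A (nat \<bar>t\<bar>)" using y by blast
      then show ?thesis by simp
    qed
    then show "y \<in> {x}" by auto
  qed (use assms in auto)
  moreover have "(\<Inter>N. ?A N) \<in> sets (borel_of (subst_shift_top \<sigma>))"
  proof (intro sets.countable_INT subsetI)
    fix S assume "S \<in> range ?A"
    then obtain N where "S = ?A N" by blast
    moreover have "openin (subst_shift_top \<sigma>) (?A N)"
      by (rule openin_subst_shift_topI) (auto intro!: exI[of _ N])
    ultimately show "S \<in> sets (borel_of (subst_shift_top \<sigma>))" by (simp add: openin_borel_of)
  qed auto
  ultimately show ?thesis by simp
qed

section \<open>A countable group generating the tail equivalence relation\<close>

text \<open>With generators closed under inverses every element is a product of a finite word over
  \<open>S\<close>, and there are countably many such words.\<close>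

lemma (in group) countable_generate:
  assumes S: "S \<subseteq> carrier G" "countable S" "\<And>s. s \<in> S \<Longrightarrow> inv s \<in> S"
  shows "countable (generate G S)"
proof -
  let ?f = "\<lambda>ws. foldr (\<otimes>) ws \<one>"
  have closed: "?f ws \<in> carrier G" if "ws \<in> lists S" for ws
    using that S(1) by (induction ws) auto
  have app: "?f (us @ ws) = ?f us \<otimes> ?f ws" if "us \<in> lists S" "ws \<in> lists S" for us ws
    using that(1)
  proof (induction us)
    case (Cons a us)
    then show ?case using closed[of us] closed[OF that(2)] S(1) by (simp add: m_assoc subset_iff)
  qed (use closed[OF that(2)] in simp)
  have "generate G S \<subseteq> ?f ` lists S"
  proof
    fix g assume "g \<in> generate G S"
    then show "g \<in> ?f ` lists S"
    proof induction
      case one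
      show ?case by (rule image_eqI[of _ _ "[]"]) auto
    next
      case (incl h)
      then show ?case using S(1) by (intro image_eqI[of _ _ "[h]"]) auto
    next
      case (inv h)
      then have "inv h \<in> S" by (rule S(3))
      then show ?case using S(1) by (intro image_eqI[of _ _ "[inv h]"]) auto
    next
      case (eng h1 h2)
      then obtain us ws where uw: "us \<in> lists S" "ws \<in> lists S" "h1 = ?f us" "h2 = ?f ws" by blast
      then show ?case using app[OF uw(1,2)] by (intro image_eqI[of _ _ "us @ ws"]) auto
    qed
  qed
  moreover have "countable (?f ` lists S)" using S(2) by simp
  ultimately show ?thesis by (rule countable_subset)
qed

section \<open>Involutions that exchange two finite initial segments\<close>

definition splice_head :: "'e list \<Rightarrow> (nat \<Rightarrow> 'e) \<Rightarrow> nat \<Rightarrow> 'e" where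
  "splice_head v p = (\<lambda>i. if i < length v then v ! i else p i)"

text \<open>For swappable heads this is its own inverse, so the generating set used below is closed
  under inverses.\<close>

definition swap_heads ::
  "('v, 'e) bratteli_diagram \<Rightarrow> 'e list \<Rightarrow> 'e list \<Rightarrow> (nat \<Rightarrow> 'e) \<Rightarrow> nat \<Rightarrow> 'e" where
  "swap_heads D u v p = (if p \<in> cylinder D u then splice_head v p
     else if p \<in> cylinder D v then splice_head u p else p)"

definition swappable :: "('v, 'e) bratteli_diagram \<Rightarrow> 'e list \<Rightarrow> 'e list \<Rightarrow> bool" where
  "swappable D u v \<longleftrightarrow> length u = length v \<and> (\<forall>p\<in>cylinder D u. splice_head v p \<in> path_space D) \<and>
     (\<forall>p\<in>cylinder D v. splice_head u p \<in> path_space D)"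

lemma swappable_sym: "swappable D u v \<Longrightarrow> swappable D v u"
  by (auto simp: swappable_def)

lemma cylinder_path: "p \<in> cylinder D u \<Longrightarrow> p \<in> path_space D"
  by (simp add: cylinder_def)

lemma splice_head_cylinder:
  "swappable D u v \<Longrightarrow> p \<in> cylinder D u \<Longrightarrow> splice_head v p \<in> cylinder D v"
  by (auto simp: swappable_def cylinder_def splice_head_def)

lemma splice_head_splice_head:
  "length u = length v \<Longrightarrow> p \<in> cylinder D u \<Longrightarrow> splice_head u (splice_head v p) = p"
  by (auto simp: cylinder_def splice_head_def fun_eq_iff)

lemma cylinder_eq:
  "length u = length v \<Longrightarrow> p \<in> cylinder D u \<Longrightarrow> p \<in> cylinder D v \<Longrightarrow> u = v"
  by (auto simp: cylinder_def intro: nth_equalityI)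

lemma swap_heads_involution:
  assumes "swappable D u v" "p \<in> path_space D"
  shows "swap_heads D u v p \<in> path_space D" "swap_heads D u v (swap_heads D u v p) = p"
proof -
  have len: "length u = length v" using assms(1) by (simp add: swappable_def)
  note c1 = splice_head_cylinder[OF assms(1), of p]
  note c2 = splice_head_cylinder[OF swappable_sym[OF assms(1)], of p]
  show "swap_heads D u v p \<in> path_space D"
    using c1 c2 assms(2) cylinder_path by (auto simp: swap_heads_def)
  show "swap_heads D u v (swap_heads D u v p) = p"
  proof (cases "u = v")
    case True
    have "splice_head v q = q" if "q \<in> cylinder D v" for q
      using that by (auto simp: splice_head_def cylinder_def fun_eq_iff)
    then show ?thesis by (simp add: swap_heads_def True)
  next
    case False
    then have d: "\<not> (q \<in> cylinder D u \<and> q \<in> cylinder D v)" for q using cylinder_eq[OF len] by blast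
    show ?thesis
      using c1 c2 d splice_head_splice_head[OF len, of p D] splice_head_splice_head[OF len[symmetric], of p D]
      by (auto simp: swap_heads_def)
  qed
qed

lemma swap_heads_tail_rel:
  assumes "swappable D u v" "p \<in> path_space D"
  shows "(p, swap_heads D u v p) \<in> tail_rel D"
proof -
  have "length u = length v" using assms(1) by (simp add: swappable_def)
  then have "\<forall>i\<ge>length u. p i = swap_heads D u v p i"
    by (simp add: swap_heads_def splice_head_def)
  then have "\<forall>\<^sub>F i in sequentially. p i = swap_heads D u v p i"
    unfolding eventually_sequentially by blast
  then show ?thesis
    using assms(2) swap_heads_involution(1)[OF assms] by (simp add: tail_rel_def)
qed

lemma swap_heads_measurable:
  assumes "swappable D u v"
  shows "swap_heads D u v \<in> borel_of (path_top D) \<rightarrow>\<^sub>M borel_of (path_top D)"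
proof (rule measurable_path_topI)
  show "swap_heads D u v \<in> topspace (path_top D) \<rightarrow> path_space D"
    using swap_heads_involution(1)[OF assms] by simp
  have local: "swap_heads D u v q i = swap_heads D u v p i"
    if "p \<in> path_space D" "q \<in> path_space D" "\<forall>i<n. q i = p i" "length u \<le> n" "length v \<le> n" "i < n"
    for p q i n
  proof -
    have "q \<in> cylinder D u \<longleftrightarrow> p \<in> cylinder D u" "q \<in> cylinder D v \<longleftrightarrow> p \<in> cylinder D v"
      using that by (auto simp: cylinder_def)
    then show ?thesis using that by (simp add: swap_heads_def splice_head_def)
  qed
  show "openin (path_top D) (swap_heads D u v -` cylinder D es \<inter> topspace (path_top D))" for es
  proof (rule openin_path_topI)
    fix p assume p: "p \<in> swap_heads D u v -` cylinder D es \<inter> topspace (path_top D)"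
    let ?n = "length u + length v + length es"
    have "q \<in> swap_heads D u v -` cylinder D es \<inter> topspace (path_top D)"
      if "q \<in> path_space D" "\<forall>i<?n. q i = p i" for q
      using p that local[of p q ?n] swap_heads_involution(1)[OF assms that(1)]
      by (auto simp: cylinder_def)
    then show "\<exists>n. \<forall>q\<in>path_space D. (\<forall>i<n. q i = p i) \<longrightarrow>
        q \<in> swap_heads D u v -` cylinder D es \<inter> topspace (path_top D)" by blast
  qed auto
qed

lemma tail_rel_swap:
  assumes "(p, q) \<in> tail_rel D"
  shows "\<exists>u v. swappable D u v \<and> swap_heads D u v p = q"
proof -
  have pq: "p \<in> path_space D" "q \<in> path_space D" using assms by (auto simp: tail_rel_def)
  obtain N0 where "\<forall>i\<ge>N0. p i = q i"
    using assms by (auto simp: tail_rel_def eventually_sequentially)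
  then obtain N where N: "\<forall>i\<ge>N. p i = q i" "1 \<le> N" by (intro that[of "Suc N0"]) auto
  have spl: "splice_head (map q [0..<N]) r \<in> path_space D"
    if p: "p \<in> path_space D" and q: "q \<in> path_space D" and N: "\<forall>i\<ge>N. p i = q i" "1 \<le> N"
      and r: "r \<in> cylinder D (map p [0..<N])" for p q r
  proof -
    let ?s = "splice_head (map q [0..<N]) r"
    have s: "?s i = (if i < N then q i else r i)" for i by (simp add: splice_head_def)
    have rp: "r \<in> path_space D" "\<And>i. i < N \<Longrightarrow> r i = p i" using r by (auto simp: cylinder_def)
    have "target D (?s i) = source D (?s (Suc i))" for i
    proof (cases "Suc i = N")
      \<comment> \<open>At the junction \<open>p\<close> and \<open>q\<close> share the edge
        \<open>N\<close>, so their heads end at the same vertex.\<close>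
      case True
      have "target D (q i) = source D (q (Suc i))" using q by (simp add: path_space_def)
      also have "q (Suc i) = p (Suc i)" using N True by simp
      also have "source D (p (Suc i)) = target D (p i)" using p by (simp add: path_space_def)
      also have "p i = r i" using rp(2)[of i] True by simp
      also have "target D (r i) = source D (r (Suc i))" using rp(1) by (simp add: path_space_def)
      finally show ?thesis using True by (simp add: s)
    next
      case False
      then show ?thesis using q rp(1) by (auto simp: s path_space_def)
    qed
    then show ?thesis using q rp(1) N(2) by (auto simp: path_space_def s)
  qed
  have N': "\<forall>i\<ge>N. q i = p i" using N(1) by auto
  have "swappable D (map p [0..<N]) (map q [0..<N])"
    using spl[OF pq N] spl[OF pq(2,1) N' N(2)] by (auto simp: swappable_def)
  moreover have "p \<in> cylinder D (map p [0..<N])" using pq by (simp add: cylinder_def)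
  then have "swap_heads D (map p [0..<N]) (map q [0..<N]) p = q"
    using N(1) by (auto simp: swap_heads_def splice_head_def fun_eq_iff)
  ultimately show ?thesis by blast
qed

text \<open>Consequences of \<open>tail_invariant\<close> require one concrete generating action.
  The head swaps are countably many, they stay inside tail classes, and by
  \<open>tail_rel_swap\<close> a single one joins any two tail equivalent paths.\<close>

lemma tail_action_exists:
  fixes D :: "('v, 'e :: countable) bratteli_diagram"
  shows "\<exists>G \<phi>. borel_action_generating D G \<phi>"
proof -
  let ?Y = "path_space D" and ?b = "borel_of (path_top D)"
  let ?G = "BijGroup ?Y"
  define S where "S = (\<lambda>(u, v). restrict (swap_heads D u v) ?Y) ` {(u, v). swappable D u v}"
  interpret BG: group ?G by (rule group_BijGroup)
  have bij: "bij_betw (swap_heads D u v) ?Y ?Y" if "swappable D u v" for u v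
    using swap_heads_involution[OF that] by (intro bij_betw_byWitness[of _ "swap_heads D u v"]) auto
  have S_Bij: "S \<subseteq> Bij ?Y"
    using bij by (auto simp: S_def Bij_def cong: bij_betw_cong)
  then have S_carrier: "S \<subseteq> carrier ?G" by (simp add: BijGroup_def)
  have S_inv: "inv\<^bsub>?G\<^esub> s = s" if s: "s \<in> S" for s
  proof (rule BG.inv_equality)
    obtain u v where uv: "swappable D u v" "s = restrict (swap_heads D u v) ?Y"
      using s by (auto simp: S_def)
    have "compose ?Y s s = (\<lambda>p\<in>?Y. p)"
      using swap_heads_involution[OF uv(1)] by (auto simp: compose_def uv(2) fun_eq_iff)
    then show "s \<otimes>\<^bsub>?G\<^esub> s = \<one>\<^bsub>?G\<^esub>" using that S_Bij by (auto simp: BijGroup_def)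
  qed (use that S_carrier in auto)
  define H where "H = generate ?G S"
  have sub: "subgroup H ?G" unfolding H_def by (rule BG.generate_is_subgroup[OF S_carrier])
  have "countable S" unfolding S_def by (rule countable_image) (rule countableI_type)
  then have count: "countable H"
    unfolding H_def using S_inv by (intro BG.countable_generate S_carrier) auto
  have H_Bij: "H \<subseteq> Bij ?Y" using subgroup.subset[OF sub] by (simp add: BijGroup_def)
  have S_prop: "s \<in> ?b \<rightarrow>\<^sub>M ?b \<and> (\<forall>p\<in>?Y. (p, s p) \<in> tail_rel D)" if s: "s \<in> S" for s
  proof -
    obtain u v where uv: "swappable D u v" "s = restrict (swap_heads D u v) ?Y"
      using s by (auto simp: S_def)
    have "s \<in> ?b \<rightarrow>\<^sub>M ?b \<longleftrightarrow> swap_heads D u v \<in> ?b \<rightarrow>\<^sub>M ?b" by (rule measurable_cong) (simp add: uv(2))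
    then have "s \<in> ?b \<rightarrow>\<^sub>M ?b" using swap_heads_measurable[OF uv(1)] by blast
    moreover have "\<forall>p\<in>?Y. (p, s p) \<in> tail_rel D" using swap_heads_tail_rel[OF uv(1)] by (simp add: uv(2))
    ultimately show ?thesis by blast
  qed
  have H_prop: "h \<in> ?b \<rightarrow>\<^sub>M ?b \<and> (\<forall>p\<in>?Y. (p, h p) \<in> tail_rel D)" if "h \<in> H" for h
    using that[unfolded H_def]
  proof induction
    case one
    have e: "\<one>\<^bsub>?G\<^esub> = (\<lambda>p\<in>?Y. p)" by (simp add: BijGroup_def)
    have "(\<lambda>p\<in>?Y. p) \<in> ?b \<rightarrow>\<^sub>M ?b \<longleftrightarrow> (\<lambda>p. p) \<in> ?b \<rightarrow>\<^sub>M ?b" by (rule measurable_cong) simp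
    then have "(\<lambda>p\<in>?Y. p) \<in> ?b \<rightarrow>\<^sub>M ?b" by (rule iffD2) (rule measurable_ident_sets[OF refl])
    moreover have "\<forall>p\<in>?Y. (p, (\<lambda>p\<in>?Y. p) p) \<in> tail_rel D" by (simp add: tail_rel_def)
    ultimately show ?case unfolding e by blast
  next
    case (incl s)
    then show ?case by (rule S_prop)
  next
    case (inv s)
    then show ?case using S_prop S_inv by simp
  next
    case (eng g h)
    have gh: "g \<in> Bij ?Y" "h \<in> Bij ?Y" using eng(1,2) H_Bij by (auto simp: H_def)
    then have e: "g \<otimes>\<^bsub>?G\<^esub> h = compose ?Y g h" by (simp add: BijGroup_def)
    have "compose ?Y g h \<in> ?b \<rightarrow>\<^sub>M ?b \<longleftrightarrow> (\<lambda>p. g (h p)) \<in> ?b \<rightarrow>\<^sub>M ?b"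
      by (rule measurable_cong) (simp add: compose_def)
    moreover have "(\<lambda>p. g (h p)) \<in> ?b \<rightarrow>\<^sub>M ?b"
      by (rule measurable_compose[of h ?b ?b g]) (use eng in auto)
    moreover have "(p, g (h p)) \<in> tail_rel D" if "p \<in> ?Y" for p
    proof -
      have 1: "(p, h p) \<in> tail_rel D" using eng(4) that by blast
      then have "h p \<in> ?Y" by (simp add: tail_rel_def)
      then have 2: "(h p, g (h p)) \<in> tail_rel D" using eng(3) by blast
      show ?thesis using 1 2 by (auto simp: tail_rel_def elim: eventually_elim2)
    qed
    moreover have "compose ?Y g h p = g (h p)" if "p \<in> ?Y" for p using that by (simp add: compose_def)
    ultimately show ?case unfolding e by presburger
  qed
  define K where "K = ?G\<lparr>carrier := H\<rparr>"
  interpret K: group K unfolding K_def by (rule BG.subgroup_imp_group[OF sub])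
  have K: "carrier K = H" by (simp add: K_def)
  define e where "e = to_nat_on H"
  have inj: "inj_on e (carrier K)" unfolding K e_def by (rule inj_on_to_nat_on[OF count])
  \<comment> \<open>\<open>borel_action_generating\<close> asks for a group of natural numbers, so
    the structure is transported along an enumeration of \<open>H\<close>.\<close>
  define N where "N = image_group e K"
  define \<phi> where "\<phi> = inv_into H e"
  have iso: "e \<in> iso K N" unfolding N_def by (rule inj_imp_image_group_iso[OF inj])
  have N_group: "group N" unfolding N_def by (rule K.inj_imp_image_group_is_group[OF inj])
  have "\<phi> \<in> iso N K" unfolding \<phi>_def K[symmetric] by (rule K.iso_set_sym[OF iso])
  then have hom: "\<phi> \<in> hom N K" by (simp add: iso_def)
  have carr: "carrier N = e ` H" by (simp add: N_def image_group_def K)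
  have \<phi>_H: "\<phi> g \<in> H" if "g \<in> carrier N" for g
    using that unfolding carr \<phi>_def by (rule inv_into_into)
  have "\<phi> \<in> hom N ?G"
    using hom subgroup.subset[OF sub] \<phi>_H by (auto simp: hom_def K_def)
  then have "group_action N ?Y \<phi>"
    using N_group group_BijGroup by (intro group_action.intro group_hom.intro group_hom_axioms.intro)
  moreover have "\<forall>g\<in>carrier N. \<phi> g \<in> ?b \<rightarrow>\<^sub>M ?b" using \<phi>_H H_prop by blast
  moreover have "orbit N \<phi> p = tail_rel D `` {p}" if p: "p \<in> ?Y" for p
  proof (intro equalityI subsetI)
    fix q assume "q \<in> orbit N \<phi> p"
    then show "q \<in> tail_rel D `` {p}" using \<phi>_H H_prop p by (auto simp: orbit_def)
  next
    fix q assume "q \<in> tail_rel D `` {p}"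
    then obtain u v where uv: "swappable D u v" "swap_heads D u v p = q" using tail_rel_swap by blast
    let ?s = "restrict (swap_heads D u v) ?Y"
    have "?s \<in> S" using uv(1) by (auto simp: S_def)
    then have "?s \<in> H" unfolding H_def by (rule generate.incl)
    then have "e ?s \<in> carrier N" "\<phi> (e ?s) = ?s"
      using inj by (auto simp: carr \<phi>_def K)
    then show "q \<in> orbit N \<phi> p" unfolding orbit_def using p uv(2) by (auto intro!: exI[of _ "e ?s"])
  qed
  ultimately show ?thesis unfolding borel_action_generating_def by blast
qed

text \<open>A generating action as a sequence of Borel bijections, the form used by
  \<open>piecewise_preserving\<close>; indices outside the carrier are sent to the neutral
  element.\<close>

lemma tail_invariant_family:
  fixes D :: "('v, 'e :: countable) bratteli_diagram"
  obtains \<phi> :: "nat \<Rightarrow> (nat \<Rightarrow> 'e) \<Rightarrow> nat \<Rightarrow> 'e"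
  where "\<And>i. \<phi> i \<in> borel_of (path_top D) \<rightarrow>\<^sub>M borel_of (path_top D)"
    and "\<And>i. bij_betw (\<phi> i) (path_space D) (path_space D)"
    and "\<And>p. p \<in> path_space D \<Longrightarrow> range (\<lambda>i. \<phi> i p) = tail_rel D `` {p}"
    and "\<And>M i A. tail_invariant D M \<Longrightarrow> A \<in> sets M \<Longrightarrow> emeasure M (\<phi> i -` A \<inter> space M) = emeasure M A"
proof -
  obtain G \<phi> where act: "borel_action_generating D G \<phi>" using tail_action_exists[of D] by blast
  then have ga: "group_action G (path_space D) \<phi>"
    and meas: "\<And>g. g \<in> carrier G \<Longrightarrow> \<phi> g \<in> borel_of (path_top D) \<rightarrow>\<^sub>M borel_of (path_top D)"
    and orb: "\<And>p. p \<in> path_space D \<Longrightarrow> orbit G \<phi> p = tail_rel D `` {p}"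
    by (auto simp: borel_action_generating_def)
  interpret group_hom G "BijGroup (path_space D)" \<phi> using ga by (rule group_action.group_hom)
  define \<psi> where "\<psi> i = (if i \<in> carrier G then \<phi> i else \<phi> \<one>\<^bsub>G\<^esub>)" for i
  have \<psi>: "\<exists>g\<in>carrier G. \<psi> i = \<phi> g" for i
    by (cases "i \<in> carrier G") (auto simp: \<psi>_def simp del: hom_one)
  have bij: "bij_betw (\<phi> g) (path_space D) (path_space D)" if "g \<in> carrier G" for g
    using hom_closed[OF that] by (simp add: BijGroup_def Bij_def)
  have "range (\<lambda>i. \<psi> i p) = orbit G \<phi> p" for p
  proof (intro equalityI subsetI)
    fix q assume "q \<in> orbit G \<phi> p"
    then obtain g where "g \<in> carrier G" "q = \<phi> g p" by (auto simp: orbit_def)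
    then show "q \<in> range (\<lambda>i. \<psi> i p)" by (intro image_eqI[of _ _ g]) (auto simp: \<psi>_def)
  next
    fix q assume "q \<in> range (\<lambda>i. \<psi> i p)"
    then obtain i where "q = \<psi> i p" by blast
    then show "q \<in> orbit G \<phi> p" using \<psi>[of i] by (auto simp: orbit_def simp del: hom_one)
  qed
  then have 3: "range (\<lambda>i. \<psi> i p) = tail_rel D `` {p}" if "p \<in> path_space D" for p
    using orb[OF that] by simp
  have 4: "emeasure M (\<psi> i -` A \<inter> space M) = emeasure M A"
    if "tail_invariant D M" "A \<in> sets M" for M i A
    using that act \<psi>[of i] unfolding tail_invariant_def by metis
  have 1: "\<psi> i \<in> borel_of (path_top D) \<rightarrow>\<^sub>M borel_of (path_top D)" for i using meas \<psi>[of i] by metis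
  have 2: "bij_betw (\<psi> i) (path_space D) (path_space D)" for i using bij \<psi>[of i] by metis
  show ?thesis by (rule that[OF 1 2 3 4])
qed

lemma shift_eq_tr: "shift = tr 1"
  by (auto simp: shift_def tr_def fun_eq_iff)

section \<open>The correspondence of ergodic measures\<close>

context aperiodic_substitution
begin

abbreviation "SX \<equiv> borel_of (subst_shift_top \<sigma>)"
abbreviation "SY \<equiv> borel_of (path_top B)"

definition X0 :: "(int \<Rightarrow> 'a) set" where
  "X0 = {x \<in> X. good (F x)}"

definition Y0 :: "(nat \<Rightarrow> 'a subst_edge) set" where
  "Y0 = {p. good p}"

lemma Y0_subset: "Y0 \<subseteq> Y"
  by (auto simp: Y0_def good_def)

section \<open>Measurability of the coding, of its inverse and of the good sets\<close>

lemma tr_measurable: "tr t \<in> SX \<rightarrow>\<^sub>M SX"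
proof (rule measurable_borel_ofI)
  show "tr t \<in> space SX \<rightarrow> topspace (subst_shift_top \<sigma>)" by (auto simp: tr_in_X)
  fix U assume U: "openin (subst_shift_top \<sigma>) U"
  have "openin (subst_shift_top \<sigma>) (tr t -` U \<inter> X)"
  proof (rule openin_subst_shift_topI)
    fix x assume x: "x \<in> tr t -` U \<inter> X"
    then obtain N :: nat where N: "\<forall>y\<in>X. (\<forall>s. \<bar>s\<bar> \<le> int N \<longrightarrow> y s = tr t x s) \<longrightarrow> y \<in> U"
      using openin_subst_shift_topD[OF U, of "tr t x"] by blast
    have "y \<in> tr t -` U \<inter> X" if "y \<in> X" "\<forall>s. \<bar>s\<bar> \<le> int (N + nat \<bar>t\<bar>) \<longrightarrow> y s = x s" for y
    proof -
      have "\<forall>s. \<bar>s\<bar> \<le> int N \<longrightarrow> tr t y s = tr t x s" using that(2) by (simp add: tr_def)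
      then show ?thesis using N tr_in_X[OF that(1), of t] that(1) by blast
    qed
    then show "\<exists>N::nat. \<forall>y\<in>X. (\<forall>s. \<bar>s\<bar> \<le> int N \<longrightarrow> y s = x s) \<longrightarrow> y \<in> tr t -` U \<inter> X" by blast
  qed auto
  then show "tr t -` U \<inter> space SX \<in> sets SX" using openin_borel_of by simp
qed

lemma iterated_desub_continuous:
  "x \<in> X \<Longrightarrow> \<exists>m. \<forall>x'\<in>X. (\<forall>t. \<bar>t\<bar> \<le> int m \<longrightarrow> x' t = x t) \<longrightarrow>
    (\<forall>k\<le>n. K ((D ^^ k) x') = K ((D ^^ k) x) \<and> (\<forall>t. \<bar>t\<bar> \<le> int N \<longrightarrow> (D ^^ k) x' t = (D ^^ k) x t))"
proof (induction n arbitrary: x)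
  case 0
  obtain m where m: "\<forall>x'\<in>X. (\<forall>t. \<bar>t\<bar> \<le> int m \<longrightarrow> x' t = x t) \<longrightarrow> K x' = K x"
    using desub_continuous[OF 0, of 0] by blast
  then show ?case by (intro exI[of _ "max m N"]) auto
next
  case (Suc n)
  obtain m1 where m1: "\<forall>x'\<in>X. (\<forall>t. \<bar>t\<bar> \<le> int m1 \<longrightarrow> x' t = D x t) \<longrightarrow>
    (\<forall>k\<le>n. K ((D ^^ k) x') = K ((D ^^ k) (D x)) \<and> (\<forall>t. \<bar>t\<bar> \<le> int N \<longrightarrow> (D ^^ k) x' t = (D ^^ k) (D x) t))"
    using Suc.IH[OF D_in_X[OF Suc.prems]] by blast
  obtain m2 where m2: "\<forall>x'\<in>X. (\<forall>t. \<bar>t\<bar> \<le> int m2 \<longrightarrow> x' t = x t) \<longrightarrow>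
      K x' = K x \<and> (\<forall>t. \<bar>t\<bar> \<le> int m1 \<longrightarrow> D x' t = D x t)"
    using desub_continuous[OF Suc.prems, of m1] by blast
  show ?case
  proof (intro exI[of _ "max m2 N"] ballI impI allI)
    fix x' k assume x': "x' \<in> X" "\<forall>t. \<bar>t\<bar> \<le> int (max m2 N) \<longrightarrow> x' t = x t" and k: "k \<le> Suc n"
    have 2: "K x' = K x" "\<forall>t. \<bar>t\<bar> \<le> int m1 \<longrightarrow> D x' t = D x t" using m2 x' by auto
    show "K ((D ^^ k) x') = K ((D ^^ k) x) \<and> (\<forall>t. \<bar>t\<bar> \<le> int N \<longrightarrow> (D ^^ k) x' t = (D ^^ k) x t)"
    proof (cases k)
      case 0
      then show ?thesis using 2 x' by simp
    next
      case (Suc l)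
      then have "l \<le> n" using k by simp
      then show ?thesis
        using m1 D_in_X[OF x'(1)] 2(2) unfolding Suc funpow_Suc_right comp_def by blast
    qed
  qed
qed

text \<open>A cylinder tests finitely many letters and positions of iterated desubstitutions, and
  each of these is locally constant, so \<open>F\<close> is even continuous.\<close>

lemma F_measurable: "F \<in> SX \<rightarrow>\<^sub>M SY"
proof (rule measurable_path_topI)
  show "F \<in> topspace (subst_shift_top \<sigma>) \<rightarrow> Y" using F_in_Y by simp
  show "openin (subst_shift_top \<sigma>) (F -` cylinder B es \<inter> topspace (subst_shift_top \<sigma>))" for es
  proof (rule openin_subst_shift_topI)
    fix x assume "x \<in> F -` cylinder B es \<inter> topspace (subst_shift_top \<sigma>)"
    then have x: "x \<in> X" "F x \<in> cylinder B es" by auto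
    obtain m :: nat where m: "\<forall>x'\<in>X. (\<forall>t. \<bar>t\<bar> \<le> int m \<longrightarrow> x' t = x t) \<longrightarrow> (\<forall>k\<le>length es.
        K ((D ^^ k) x') = K ((D ^^ k) x) \<and> (\<forall>t. \<bar>t\<bar> \<le> int 0 \<longrightarrow> (D ^^ k) x' t = (D ^^ k) x t))"
      using iterated_desub_continuous[OF x(1), of "length es" 0] by blast
    have "F x' \<in> cylinder B es" if x': "x' \<in> X" "\<forall>t. \<bar>t\<bar> \<le> int m \<longrightarrow> x' t = x t" for x'
    proof -
      have k: "K ((D ^^ k) x') = K ((D ^^ k) x)" "(D ^^ k) x' 0 = (D ^^ k) x 0" if "k \<le> length es" for k
        using m x' that by auto
      have "F x' i = F x i" if "i < length es" for i
        using k[of i] k[of "i - 1"] that by (cases i) (auto simp: F_Suc simp del: funpow.simps)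
      then show ?thesis using x(2) F_in_Y[OF x'(1)] by (simp add: cylinder_def)
    qed
    then show "\<exists>N::nat. \<forall>y\<in>X. (\<forall>t. \<bar>t\<bar> \<le> int N \<longrightarrow> y t = x t) \<longrightarrow>
        y \<in> F -` cylinder B es \<inter> topspace (subst_shift_top \<sigma>)" by auto
  qed auto
qed

lemma Y0_sets: "Y0 \<in> sets SY"
proof -
  have "Y - Y0 = {p \<in> Y. \<not> good p}" by (auto simp: Y0_def)
  then have c: "countable (Y - Y0)" using countable_bad_paths by simp
  have "Y - Y0 \<in> sets SY" by (rule sets.countable[OF _ c]) (simp add: singleton_path_sets)
  from sets.compl_sets[OF this] show ?thesis using Y0_subset by (simp add: double_diff)
qed

lemma X0_sets: "X0 \<in> sets SX"
proof -
  have "X - X0 = {x \<in> X. \<not> good (F x)}" by (auto simp: X0_def)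
  then have c: "countable (X - X0)" using countable_bad_points by simp
  have "X - X0 \<in> sets SX" by (rule sets.countable[OF _ c]) (simp add: singleton_shift_sets)
  from sets.compl_sets[OF this] show ?thesis by (simp add: double_diff X0_def)
qed

text \<open>The edges up to a level whose block covers the window of radius \<open>N\<close>
  determine the point there.\<close>

lemma G_continuous:
  assumes "good p"
  shows "\<exists>n. \<forall>q. good q \<longrightarrow> (\<forall>i<n. q i = p i) \<longrightarrow> (\<forall>t. \<bar>t\<bar> \<le> int N \<longrightarrow> G q t = G p t)"
proof -
  obtain m where m: "N + 1 \<le> offs p m" "N + 1 \<le> rem p m" using good_ge[OF assms] by blast
  have p: "p \<in> Y" using assms by (simp add: good_def)
  have "G q t = G p t" if q: "good q" and eq: "\<forall>i<Suc m. q i = p i" and t: "\<bar>t\<bar> \<le> int N" for q t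
  proof -
    have qY: "q \<in> Y" using q by (simp add: good_def)
    have o: "offs q m = offs p m" using eq by (intro offs_cong) auto
    have b: "blk q m = blk p m" using eq by (simp add: blk_def)
    have tp: "- int (offs p m) \<le> t" "t < int (rem p m)" using m t by auto
    then have tq: "- int (offs q m) \<le> t" "t < int (rem q m)" by (auto simp: rem_def o b)
    show ?thesis
      using follows_nth[OF G_follows[OF q] qY tq] follows_nth[OF G_follows[OF assms] p tp] by (simp add: o b)
  qed
  then show ?thesis by blast
qed

text \<open>Off the good paths the value is irrelevant, but it has to be a point of the shift space.\<close>

definition G0 :: "(nat \<Rightarrow> 'a subst_edge) \<Rightarrow> int \<Rightarrow> 'a" where
  "G0 p = G (if good p then p else (SOME q. good q))"

lemma G0_good [simp]: "good p \<Longrightarrow> G0 p = G p"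
  by (simp add: G0_def)

lemma G0_measurable:
  assumes "\<exists>q. good q"
  shows "G0 \<in> SY \<rightarrow>\<^sub>M SX"
proof (rule measurable_borel_ofI)
  define q0 where "q0 = (SOME q. good q)"
  have q0: "good q0" unfolding q0_def using assms by (rule someI_ex)
  have G0: "G0 p = (if good p then G p else G q0)" for p by (simp add: G0_def q0_def)
  show "G0 \<in> space SY \<rightarrow> topspace (subst_shift_top \<sigma>)"
    using G_in_X q0 by (simp add: G0)
  fix U assume U: "openin (subst_shift_top \<sigma>) U"
  \<comment> \<open>The union of the cylinders whose good members are all sent into
    \<open>U\<close>. It is open, and on good paths it coincides with the preimage of
    \<open>U\<close>.\<close>
  define V where "V = {q \<in> Y. \<exists>p n. (\<forall>i<n. q i = p i) \<and>
      (\<forall>q'. good q' \<longrightarrow> (\<forall>i<n. q' i = p i) \<longrightarrow> G q' \<in> U)}"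
  have "openin (path_top B) V"
  proof (rule openin_path_topI)
    fix q assume "q \<in> V"
    then obtain p n where pn: "\<forall>i<n. q i = p i" "\<forall>q'. good q' \<longrightarrow> (\<forall>i<n. q' i = p i) \<longrightarrow> G q' \<in> U"
      by (auto simp: V_def)
    have "r \<in> V" if "r \<in> Y" "\<forall>i<n. r i = q i" for r
      unfolding V_def using that pn by (intro CollectI conjI exI[of _ p] exI[of _ n]) auto
    then show "\<exists>n. \<forall>r\<in>Y. (\<forall>i<n. r i = q i) \<longrightarrow> r \<in> V" by blast
  qed (auto simp: V_def)
  then have V: "V \<in> sets SY" by (rule openin_borel_of)
  have mem: "G p \<in> U \<longleftrightarrow> p \<in> V" if p: "good p" for p
  proof
    assume "G p \<in> U"
    then obtain N :: nat where N: "\<forall>y\<in>X. (\<forall>t. \<bar>t\<bar> \<le> int N \<longrightarrow> y t = G p t) \<longrightarrow> y \<in> U"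
      using openin_subst_shift_topD[OF U] by blast
    obtain n where n: "\<forall>q. good q \<longrightarrow> (\<forall>i<n. q i = p i) \<longrightarrow> (\<forall>t. \<bar>t\<bar> \<le> int N \<longrightarrow> G q t = G p t)"
      using G_continuous[OF p] by blast
    have "\<forall>q'. good q' \<longrightarrow> (\<forall>i<n. q' i = p i) \<longrightarrow> G q' \<in> U" using n N G_in_X by blast
    then show "p \<in> V" using p unfolding V_def good_def by blast
  next
    assume "p \<in> V"
    then show "G p \<in> U" using p unfolding V_def by auto
  qed
  have "G0 -` U \<inter> space SY = (Y0 \<inter> V) \<union> (if G q0 \<in> U then Y - Y0 else {})"
  proof (rule Set.set_eqI)
    fix p
    show "p \<in> G0 -` U \<inter> space SY \<longleftrightarrow> p \<in> (Y0 \<inter> V) \<union> (if G q0 \<in> U then Y - Y0 else {})"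
    proof (cases "good p")
      case True
      then show ?thesis using mem[OF True] Y0_subset by (auto simp: G0 Y0_def)
    next
      case False
      then show ?thesis by (simp add: G0 Y0_def)
    qed
  qed
  moreover have "Y - Y0 \<in> sets SY" using sets.compl_sets[OF Y0_sets] by simp
  ultimately show "G0 -` U \<inter> space SY \<in> sets SY" using Y0_sets V by auto
qed

lemma F_X0: "x \<in> X0 \<Longrightarrow> F x \<in> Y0 \<and> G0 (F x) = x"
  by (auto simp: X0_def Y0_def G_F)

lemma G0_Y0: "p \<in> Y0 \<Longrightarrow> G0 p \<in> X0 \<and> F (G0 p) = p"
  by (auto simp: X0_def Y0_def F_G G_in_X)

lemma tr_X0: "x \<in> X \<Longrightarrow> tr t x \<in> X0 \<longleftrightarrow> x \<in> X0"
  using F_tr_good[of x t] F_tr_good[of "tr t x" "- t"] by (auto simp: X0_def tr_in_X)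

section \<open>Nullity of the exceptional sets, and the shift on paths\<close>

lemma shift_invariant_tr:
  assumes M: "sets M = sets SX" "shift_invariant M" and A: "A \<in> sets M"
  shows "emeasure M (tr t -` A \<inter> space M) = emeasure M A"
proof -
  have sp: "space M = X" using sets_eq_imp_space_eq[OF M(1)] by simp
  have meas: "tr t -` A \<inter> X \<in> sets M" if "A \<in> sets M" for A t
    using measurable_sets[OF tr_measurable, of A t] that M(1) by simp
  have pos: "emeasure M (tr (int n) -` A \<inter> X) = emeasure M A" if "A \<in> sets M" for n A
    using that
  proof (induction n arbitrary: A)
    case 0
    have "tr (int 0) -` A \<inter> X = A" using sets.sets_into_space[OF 0] sp by auto
    then show ?case by (rule arg_cong)
  next
    case (Suc n)
    have "tr (int (Suc n)) -` A \<inter> X = tr (int n) -` (tr 1 -` A \<inter> X) \<inter> X"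
      by (auto simp: tr_in_X add.commute)
    moreover have "emeasure M (tr 1 -` A \<inter> X) = emeasure M A"
      using M(2) Suc.prems by (simp add: shift_invariant_def shift_eq_tr sp)
    ultimately show ?case using Suc.IH[OF meas[OF Suc.prems, of 1]] by simp
  qed
  show ?thesis
  proof (cases t rule: int_cases2)
    case (nonneg n)
    then show ?thesis using pos[OF A] sp by simp
  next
    case (nonpos n)
    have "tr (int n) -` (tr t -` A \<inter> X) \<inter> X = A"
      using sets.sets_into_space[OF A] sp nonpos by (auto simp: tr_in_X)
    then show ?thesis using pos[OF meas[OF A, of t], of n] sp by simp
  qed
qed

text \<open>Only countably many points are excluded. Each is null if there are no atoms; under a
  probability measure aperiodicity gives it infinitely many translates of equal mass.\<close>

lemma conull_X0:
  assumes M: "sets M = sets SX" "shift_invariant M" and cases: "prob_space M \<or> nonatomic M"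
  shows "conull M X0"
proof (rule conull_countable_compl)
  have sp: "space M = X" using sets_eq_imp_space_eq[OF M(1)] by simp
  show "X0 \<subseteq> space M" by (auto simp: X0_def sp)
  have "space M - X0 = {x \<in> X. \<not> good (F x)}" by (auto simp: X0_def sp)
  then show "countable (space M - X0)" using countable_bad_points by simp
  show sing: "{x} \<in> sets M" if "x \<in> space M" for x using that M(1) sp singleton_shift_sets by simp
  show "emeasure M {x} = 0" if x: "x \<in> space M - X0" for x
    using cases
  proof
    assume "nonatomic M"
    then show ?thesis using sing[of x] x by (intro nonatomic_singleton) auto
  next
    assume prob: "prob_space M"
    have xX: "x \<in> X" using x sp by simp
    have "inj (\<lambda>n. tr (int n) x)" using tr_inj[OF xX] by (intro injI) (metis of_nat_eq_iff)
    then have "infinite (range (\<lambda>n. tr (int n) x))" by (rule range_inj_infinite)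
    moreover have "{y} \<in> sets M \<and> emeasure M {y} = emeasure M {x}"
      if y_in: "y \<in> range (\<lambda>n. tr (int n) x)" for y
    proof -
      obtain n where n: "y = tr (int n) x" using y_in by blast
      have y: "{y} \<in> sets M" using sing xX n tr_in_X sp by simp
      have "z = x" if "tr (int n) z = tr (int n) x" for z
        using arg_cong[OF that, of "tr (- int n)"] by simp
      then have "tr (int n) -` {y} \<inter> space M = {x}" using n xX sp by auto
      then show ?thesis using shift_invariant_tr[OF M y, of "int n"] y by simp
    qed
    ultimately show ?thesis by (rule prob_equal_singletons[OF prob])
  qed
qed

text \<open>As for \<open>X0\<close>, with the tail class, infinite by growth, in place of the
  orbit: maps preserving the measure carry \<open>p\<close> to every member of its class.\<close>

lemma conull_Y0:
  assumes N: "sets N = sets SY" "tail_invariant B N" and cases: "prob_space N \<or> nonatomic N"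
  shows "conull N Y0"
proof (rule conull_countable_compl)
  have sp: "space N = Y" using sets_eq_imp_space_eq[OF N(1)] by simp
  show "Y0 \<subseteq> space N" using Y0_subset sp by simp
  have "space N - Y0 = {p \<in> Y. \<not> good p}" by (auto simp: Y0_def sp)
  then show "countable (space N - Y0)" using countable_bad_paths by simp
  show sing: "{p} \<in> sets N" if "p \<in> space N" for p using that N(1) sp singleton_path_sets by simp
  show "emeasure N {p} = 0" if p: "p \<in> space N - Y0" for p
    using cases
  proof
    assume "nonatomic N"
    then show ?thesis using sing[of p] p by (intro nonatomic_singleton) auto
  next
    assume prob: "prob_space N"
    have pY: "p \<in> Y" using p sp by simp
    obtain \<phi> :: "nat \<Rightarrow> (nat \<Rightarrow> 'a subst_edge) \<Rightarrow> nat \<Rightarrow> 'a subst_edge"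
      where meas: "\<And>i. \<phi> i \<in> SY \<rightarrow>\<^sub>M SY" and bij: "\<And>i. bij_betw (\<phi> i) Y Y"
        and range: "\<And>p. p \<in> Y \<Longrightarrow> range (\<lambda>i. \<phi> i p) = tail_rel B `` {p}"
        and inv: "\<And>M i A. tail_invariant B M \<Longrightarrow> A \<in> sets M \<Longrightarrow>
          emeasure M (\<phi> i -` A \<inter> space M) = emeasure M A"
      by (rule tail_invariant_family[of B]) blast
    note \<phi> = bij range[OF pY] inv[OF N(2)]
    have "{q} \<in> sets N \<and> emeasure N {q} = emeasure N {p}" if q_in: "q \<in> tail_rel B `` {p}" for q
    proof -
      obtain i where i: "q = \<phi> i p" using q_in \<phi>(2) by blast
      have q: "{q} \<in> sets N" using q_in sing sp by (simp add: tail_rel_def)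
      have "\<phi> i -` {q} \<inter> space N = {p}"
        using \<phi>(1)[of i] pY sp i by (auto simp: bij_betw_def inj_on_def)
      then show ?thesis using \<phi>(3)[OF q, of i] q by simp
    qed
    then show ?thesis by (rule prob_equal_singletons[OF prob infinite_tail_class[OF pY]])
  qed
qed

text \<open>The shift conjugated to paths. On \<open>Y0\<close> the orbits of this action of the
  integers are the tail classes, by \<open>path_shift_Y0\<close> and
  \<open>tail_rel_path_shift\<close>.\<close>

abbreviation path_shift :: "int \<Rightarrow> (nat \<Rightarrow> 'a subst_edge) \<Rightarrow> nat \<Rightarrow> 'a subst_edge" where
  "path_shift t p \<equiv> F (tr t (G0 p))"

lemma path_shift_Y0:
  assumes "p \<in> Y0"
  shows "path_shift t p \<in> Y0" "G0 (path_shift t p) = tr t (G0 p)" "(p, path_shift t p) \<in> tail_rel B"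
proof -
  have p: "good p" using assms by (simp add: Y0_def)
  have g: "G0 p \<in> X0" "F (G0 p) = p" using G0_Y0[OF assms] by auto
  then have "G0 p \<in> X" by (simp add: X0_def del: G0_good)
  then have "tr t (G0 p) \<in> X0" using tr_X0 g(1) by blast
  then show "path_shift t p \<in> Y0" "G0 (path_shift t p) = tr t (G0 p)" using F_X0 by auto
  show "(p, path_shift t p) \<in> tail_rel B"
    using F_tr_good[of "G0 p" t] g by (simp add: X0_def del: G0_good)
qed

lemma path_shift_measurable:
  assumes "\<exists>q. good q"
  shows "path_shift t \<in> SY \<rightarrow>\<^sub>M SY"
  by (rule measurable_compose[OF measurable_compose[OF G0_measurable[OF assms] tr_measurable] F_measurable])

lemma path_shift_inj: "inj_on (path_shift t) Y0"
proof (rule inj_onI)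
  fix p q assume pq: "p \<in> Y0" "q \<in> Y0" and "path_shift t p = path_shift t q"
  then have "tr t (G0 p) = tr t (G0 q)" using path_shift_Y0(2) by metis
  then have "tr (- t) (tr t (G0 p)) = tr (- t) (tr t (G0 q))" by simp
  then show "p = q" using G0_Y0 pq by (metis add.left_inverse tr_0 tr_tr)
qed

lemma tail_rel_path_shift:
  assumes "(p, q) \<in> tail_rel B" "p \<in> Y0"
  shows "\<exists>t. q = path_shift t p"
proof -
  have p: "good p" using assms(2) by (simp add: Y0_def)
  have q: "good q" by (rule tail_rel_good[OF assms(1) p])
  obtain t where "G q = tr t (G p)" using tail_rel_G[OF assms(1) p] by blast
  then have "q = path_shift t p" using F_G[OF q] p by simp
  then show ?thesis by blast
qed

section \<open>Ergodic invariant measures correspond under push-forward\<close>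

lemma mod_null_iso_F:
  assumes "sets M = sets SX" "conull M X0" "\<exists>q. good q"
  shows "mod_null_iso M SX SY X0 Y0 F G0"
  by (rule mod_null_iso.intro[OF assms(1,2) Y0_sets F_measurable G0_measurable[OF assms(3)] F_X0 G0_Y0])

lemma mod_null_iso_G0:
  assumes "sets N = sets SY" "conull N Y0" "\<exists>q. good q"
  shows "mod_null_iso N SY SX Y0 X0 G0 F"
  by (rule mod_null_iso.intro[OF assms(1,2) X0_sets G0_measurable[OF assms(3)] F_measurable G0_Y0 F_X0])

lemma pushed_in_tail_ergodic_measures:
  assumes M: "M \<in> shift_ergodic_measures \<sigma>" and con: "conull M X0" and ex: "\<exists>q. good q"
  shows "distr M SY F \<in> tail_ergodic_measures B"
proof -
  let ?N = "distr M SY F"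
  have sM: "sets M = sets SX" and inv: "shift_invariant M" and erg: "shift_ergodic M"
    using M by (auto simp: shift_ergodic_measures_def borel_measure_on_def)
  have sp: "space M = X" using sets_eq_imp_space_eq[OF sM] by simp
  interpret mod_null_iso M SX SY X0 Y0 F G0 by (rule mod_null_iso_F[OF sM con ex])
  have N: "emeasure ?N A = emeasure M (F -` A \<inter> X)" "F -` A \<inter> X \<in> sets M" if "A \<in> sets SY" for A
    using emeasure_distr[OF F_measM that] measurable_sets[OF F_measM that] sp by auto
  have "tail_ergodic B ?N"
    unfolding tail_ergodic_def
  proof (intro ballI impI)
    fix A assume "A \<in> sets ?N" and sat: "tail_rel B `` A \<subseteq> A"
    then have A: "A \<in> sets SY" by simp
    \<comment> \<open>Intersecting with \<open>X0\<close> makes the set exactly shift invariant,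
      since the link between shift and tail equivalence is established there.\<close>
    define C where "C = (F -` A \<inter> X) \<inter> X0"
    have C: "C \<in> sets M" unfolding C_def using N(2)[OF A] X0_sets sM by auto
    have "shift -` C \<inter> space M = C"
    proof -
      have "tr 1 x \<in> C \<longleftrightarrow> x \<in> C" if x: "x \<in> X" for x
      proof -
        have "F (tr 1 x) \<in> A \<longleftrightarrow> F x \<in> A" if "x \<in> X0"
        proof -
          have "(F x, F (tr 1 x)) \<in> tail_rel B" using F_tr_good[of x 1] that by (auto simp: X0_def)
          then show ?thesis using sat tail_rel_sym by blast
        qed
        then show ?thesis using tr_X0[OF x, of 1] x tr_in_X[OF x, of 1] by (auto simp: C_def)
      qed
      then show ?thesis by (auto simp: shift_eq_tr sp C_def)
    qed
    then have "C \<in> null_sets M \<or> space M - C \<in> null_sets M"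
      using erg C by (simp add: shift_ergodic_def)
    moreover have "emeasure ?N A = emeasure M C"
      unfolding N(1)[OF A] using N(2)[OF A] C by (intro conull_emeasure_eq[OF con]) (auto simp: C_def)
    moreover have "emeasure ?N (Y - A) = emeasure M (X - C)"
    proof -
      have YA: "Y - A \<in> sets SY" using sets.compl_sets[OF A] by simp
      have "X - C \<in> sets M" using sets.compl_sets[OF C] sp by simp
      then show ?thesis
        unfolding N(1)[OF YA] using N(2)[OF YA] F_in_Y
        by (intro conull_emeasure_eq[OF con]) (auto simp: C_def)
    qed
    moreover have "Y - A \<in> sets SY" using sets.compl_sets[OF A] by simp
    ultimately show "A \<in> null_sets ?N \<or> space ?N - A \<in> null_sets ?N"
      using A by (auto simp: null_sets_def sp)
  qed
  moreover have "tail_invariant B ?N"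
    unfolding tail_invariant_def
  proof (intro allI impI ballI)
    fix H \<phi> g A
    assume act: "borel_action_generating B H \<phi>" and g: "g \<in> carrier H" and "A \<in> sets ?N"
    then have A: "A \<in> sets SY" by simp
    have ga: "group_action H Y \<phi>"
      and meas: "\<And>g. g \<in> carrier H \<Longrightarrow> \<phi> g \<in> SY \<rightarrow>\<^sub>M SY"
      and orb: "\<And>p. p \<in> Y \<Longrightarrow> orbit H \<phi> p = tail_rel B `` {p}"
      using act by (auto simp: borel_action_generating_def)
    interpret group_action H Y \<phi> by (rule ga)
    interpret gh: group_hom H "BijGroup Y" \<phi> by (rule group_hom)
    have rel: "(p, \<phi> g p) \<in> tail_rel B" if "p \<in> Y" "g \<in> carrier H" for p g
      using orb[OF that(1)] that(2) by (auto simp: orbit_def)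
    have Y0: "\<phi> g p \<in> Y0" if "p \<in> Y0" "g \<in> carrier H" for p g
      using rel[of p g] tail_rel_good[of p "\<phi> g p"] that Y0_subset by (auto simp: Y0_def)
    let ?g' = "inv\<^bsub>H\<^esub> g"
    have g': "?g' \<in> carrier H" using g by simp
    have cancel: "\<phi> ?g' (\<phi> g p) = p" "\<phi> g (\<phi> ?g' p) = p" if "p \<in> Y0" for p
      using orbit_sym_aux[OF g, of p] orbit_sym_aux[OF g', of p] that Y0_subset g by auto
    have inv_shift: "emeasure ?N (path_shift t -` A \<inter> space ?N) = emeasure ?N A" if "A \<in> sets ?N" for t A
    proof -
      have A: "A \<in> sets SY" using that by simp
      have SA: "path_shift t -` A \<inter> Y \<in> sets SY"
        using measurable_sets[OF path_shift_measurable[OF ex] A, of t] by simp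
      have tA: "tr t -` (F -` A \<inter> X) \<inter> X \<in> sets M"
        using measurable_sets[OF tr_measurable, of "F -` A \<inter> X" t] N(2)[OF A] sM by simp
      have "emeasure M (F -` (path_shift t -` A \<inter> Y) \<inter> X) = emeasure M (tr t -` (F -` A \<inter> X) \<inter> X)"
      proof (rule conull_emeasure_eq[OF con N(2)[OF SA] tA])
        show "F -` (path_shift t -` A \<inter> Y) \<inter> X \<inter> X0 = tr t -` (F -` A \<inter> X) \<inter> X \<inter> X0"
          using F_X0 F_in_Y tr_in_X by auto
      qed
      then show ?thesis
        using N(1)[OF SA] N(1)[OF A] shift_invariant_tr[OF sM inv N(2)[OF A], of t] sp by simp
    qed
    \<comment> \<open>On every good path the group element acts as some power of the transported
      shift; \<open>from_nat\<close> enumerates the integers, so countably many pieces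
      suffice.\<close>
    show "emeasure ?N (\<phi> g -` A \<inter> space ?N) = emeasure ?N A"
    proof (rule piecewise_preserving[where Z = Y0 and g = "\<phi> ?g'" and \<phi> = "\<lambda>i. path_shift (from_nat i)"])
      show "conull ?N Y0" by (rule conull_image)
      show "\<phi> g \<in> ?N \<rightarrow>\<^sub>M ?N" "\<phi> ?g' \<in> ?N \<rightarrow>\<^sub>M ?N" using meas[OF g] meas[OF g'] by simp_all
      show "\<phi> g p \<in> Y0 \<and> \<phi> ?g' (\<phi> g p) = p" "\<phi> ?g' p \<in> Y0 \<and> \<phi> g (\<phi> ?g' p) = p" if "p \<in> Y0" for p
        using Y0[OF that g] Y0[OF that g'] cancel[OF that] by simp_all
      show "path_shift (from_nat i) \<in> ?N \<rightarrow>\<^sub>M ?N" for i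
        using path_shift_measurable[OF ex] by simp
      show "path_shift (from_nat i) p \<in> Y0" if "p \<in> Y0" for i p by (rule path_shift_Y0(1)[OF that])
      show "inj_on (path_shift (from_nat i)) Y0" for i by (rule path_shift_inj)
      show "emeasure ?N (path_shift (from_nat i) -` A \<inter> space ?N) = emeasure ?N A" if "A \<in> sets ?N" for i A
        by (rule inv_shift[OF that])
      show "\<exists>i. \<phi> g p = path_shift (from_nat i) p" if p: "p \<in> Y0" for p
      proof -
        obtain t where "\<phi> g p = path_shift t p"
          using tail_rel_path_shift[OF rel p] p g Y0_subset by blast
        then show ?thesis by (intro exI[of _ "to_nat t"]) simp
      qed
      show "{p \<in> Y0. \<phi> g p = path_shift (from_nat i) p} \<in> sets ?N" for i
      proof -
        have "{p \<in> space SY. \<phi> g p = path_shift (from_nat i) p} \<in> sets SY"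
          by (rule sets_path_eq[OF meas[OF g] path_shift_measurable[OF ex]])
        moreover have "{p \<in> Y0. \<phi> g p = path_shift (from_nat i) p} =
            Y0 \<inter> {p \<in> space SY. \<phi> g p = path_shift (from_nat i) p}" using Y0_subset by auto
        ultimately show ?thesis using Y0_sets by simp
      qed
      show "A \<in> sets ?N" using A by simp
    qed
  qed
  ultimately show ?thesis by (simp add: tail_ergodic_measures_def borel_measure_on_def)
qed

lemma pushed_in_shift_ergodic_measures:
  assumes N: "N \<in> tail_ergodic_measures B" and con: "conull N Y0" and ex: "\<exists>q. good q"
  shows "distr N SX G0 \<in> shift_ergodic_measures \<sigma>"
proof -
  let ?M = "distr N SX G0"
  have sN: "sets N = sets SY" and inv: "tail_invariant B N" and erg: "tail_ergodic B N"
    using N by (auto simp: tail_ergodic_measures_def borel_measure_on_def)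
  have sp: "space N = Y" using sets_eq_imp_space_eq[OF sN] by simp
  interpret mod_null_iso N SY SX Y0 X0 G0 F by (rule mod_null_iso_G0[OF sN con ex])
  have M: "emeasure ?M A = emeasure N (G0 -` A \<inter> Y)" "G0 -` A \<inter> Y \<in> sets N" if "A \<in> sets SX" for A
    using emeasure_distr[OF F_measM that] measurable_sets[OF F_measM that] sp by auto
  have "shift_ergodic ?M"
    unfolding shift_ergodic_def
  proof (intro ballI impI)
    fix A assume "A \<in> sets ?M" and A_inv: "shift -` A \<inter> space ?M = A"
    then have A: "A \<in> sets SX" by simp
    have AX: "A \<subseteq> X" using sets.sets_into_space[OF A] by simp
    have A1: "tr 1 x \<in> A \<longleftrightarrow> x \<in> A" if "x \<in> X" for x
      using A_inv that by (auto simp: shift_eq_tr)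
    have At: "tr t x \<in> A \<longleftrightarrow> x \<in> A" if x: "x \<in> X" for t x
    proof (induction t rule: int_induct[where k = 0])
      case (step1 t)
      then show ?case using A1[OF tr_in_X[OF x, of t]] by (simp add: add.commute)
    next
      case (step2 t)
      then show ?case using A1[OF tr_in_X[OF x, of "t - 1"]] by simp
    qed simp
    \<comment> \<open>Saturated, because a tail class that meets \<open>Y0\<close> is a single orbit
      of \<open>path_shift\<close> and \<open>A\<close> is invariant under all powers of the
      shift.\<close>
    define C where "C = (G0 -` A \<inter> Y) \<inter> Y0"
    have C: "C \<in> sets N" unfolding C_def using M(2)[OF A] Y0_sets sN by auto
    have "tail_rel B `` C \<subseteq> C"
    proof
      fix q assume "q \<in> tail_rel B `` C"
      then obtain p where p: "p \<in> C" "(p, q) \<in> tail_rel B" by blast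
      then obtain t where t: "q = path_shift t p" using tail_rel_path_shift by (auto simp: C_def)
      have p0: "p \<in> Y0" "G0 p \<in> A" using p(1) by (auto simp: C_def)
      then show "q \<in> C"
        using path_shift_Y0[OF p0(1), of t] At[of "G0 p" t] AX Y0_subset by (auto simp: C_def t)
    qed
    then have "C \<in> null_sets N \<or> space N - C \<in> null_sets N"
      using erg C by (simp add: tail_ergodic_def)
    moreover have "emeasure ?M A = emeasure N C"
      unfolding M(1)[OF A] using M(2)[OF A] C by (intro conull_emeasure_eq[OF con]) (auto simp: C_def)
    moreover have XA: "X - A \<in> sets SX" using sets.compl_sets[OF A] by simp
    moreover have "emeasure ?M (X - A) = emeasure N (Y - C)"
    proof -
      have "Y - C \<in> sets N" using sets.compl_sets[OF C] sp by simp
      then show ?thesis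
        unfolding M(1)[OF XA] using M(2)[OF XA] G0_Y0
        by (intro conull_emeasure_eq[OF con]) (auto simp: C_def X0_def)
    qed
    ultimately show "A \<in> null_sets ?M \<or> space ?M - A \<in> null_sets ?M"
      using A by (auto simp: null_sets_def sp)
  qed
  moreover have "shift_invariant ?M"
    unfolding shift_invariant_def
  proof
    fix A assume "A \<in> sets ?M"
    then have A: "A \<in> sets SX" by simp
    obtain \<phi> :: "nat \<Rightarrow> (nat \<Rightarrow> 'a subst_edge) \<Rightarrow> nat \<Rightarrow> 'a subst_edge"
      where meas: "\<And>i. \<phi> i \<in> SY \<rightarrow>\<^sub>M SY" and bij: "\<And>i. bij_betw (\<phi> i) Y Y"
        and range: "\<And>p. p \<in> Y \<Longrightarrow> range (\<lambda>i. \<phi> i p) = tail_rel B `` {p}"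
        and inv': "\<And>M i A. tail_invariant B M \<Longrightarrow> A \<in> sets M \<Longrightarrow>
          emeasure M (\<phi> i -` A \<inter> space M) = emeasure M A"
      by (rule tail_invariant_family[of B]) blast
    note \<phi> = meas bij range inv'[OF inv]
    have NN: "(f \<in> N \<rightarrow>\<^sub>M N) = (f \<in> SY \<rightarrow>\<^sub>M SY)" for f
      using measurable_cong_sets[OF sN sN] by blast
    have TA: "shift -` A \<inter> X \<in> sets SX"
      using measurable_sets[OF tr_measurable A, of 1] by (simp add: shift_eq_tr)
    have SA: "path_shift 1 -` (G0 -` A \<inter> Y) \<inter> Y \<in> sets N"
      using measurable_sets[OF path_shift_measurable[OF ex], of "G0 -` A \<inter> Y" 1] M(2)[OF A] sN by simp
    \<comment> \<open>With the roles reversed: the transported shift is cut into pieces on which it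
      is a member of the generating family.\<close>
    have "emeasure N (path_shift 1 -` (G0 -` A \<inter> Y) \<inter> space N) = emeasure N (G0 -` A \<inter> Y)"
    proof (rule piecewise_preserving[where Z = Y0 and g = "path_shift (- 1)" and \<phi> = \<phi>])
      show "conull N Y0" by (rule con)
      show "path_shift 1 \<in> N \<rightarrow>\<^sub>M N" "path_shift (- 1) \<in> N \<rightarrow>\<^sub>M N"
        unfolding NN by (rule path_shift_measurable[OF ex])+
      show "path_shift 1 p \<in> Y0 \<and> path_shift (- 1) (path_shift 1 p) = p"
        "path_shift (- 1) p \<in> Y0 \<and> path_shift 1 (path_shift (- 1) p) = p" if "p \<in> Y0" for p
        using path_shift_Y0[OF that] G0_Y0[OF that] by auto
      show "\<phi> i \<in> N \<rightarrow>\<^sub>M N" for i unfolding NN by (rule \<phi>(1))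
      show "\<phi> i p \<in> Y0" if "p \<in> Y0" for i p
      proof -
        have "p \<in> Y" "good p" using that Y0_subset by (auto simp: Y0_def)
        then have "(p, \<phi> i p) \<in> tail_rel B" using \<phi>(3)[of p] by blast
        then show ?thesis using tail_rel_good \<open>good p\<close> by (simp add: Y0_def)
      qed
      show "inj_on (\<phi> i) Y0" for i
        using \<phi>(2)[of i] Y0_subset by (meson bij_betw_def inj_on_subset)
      show "emeasure N (\<phi> i -` A \<inter> space N) = emeasure N A" if "A \<in> sets N" for i A
        by (rule \<phi>(4)[OF that])
      show "\<exists>i. path_shift 1 p = \<phi> i p" if "p \<in> Y0" for p
        using path_shift_Y0(3)[OF that, of 1] \<phi>(3)[of p] that Y0_subset by blast
      show "{p \<in> Y0. path_shift 1 p = \<phi> i p} \<in> sets N" for i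
      proof -
        have "{p \<in> space SY. path_shift 1 p = \<phi> i p} \<in> sets SY"
          by (rule sets_path_eq[OF path_shift_measurable[OF ex] \<phi>(1)])
        moreover have "{p \<in> Y0. path_shift 1 p = \<phi> i p} = Y0 \<inter> {p \<in> space SY. path_shift 1 p = \<phi> i p}"
          using Y0_subset by auto
        ultimately show ?thesis using Y0_sets sN by simp
      qed
      show "G0 -` A \<inter> Y \<in> sets N" by (rule M(2)[OF A])
    qed
    moreover have "emeasure N (G0 -` (shift -` A \<inter> X) \<inter> Y) =
        emeasure N (path_shift 1 -` (G0 -` A \<inter> Y) \<inter> Y)"
    proof (rule conull_emeasure_eq[OF con M(2)[OF TA] SA])
      show "G0 -` (shift -` A \<inter> X) \<inter> Y \<inter> Y0 = path_shift 1 -` (G0 -` A \<inter> Y) \<inter> Y \<inter> Y0"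
        using path_shift_Y0(1,2)[of _ 1] Y0_subset G0_Y0 by (auto simp: shift_eq_tr X0_def)
    qed
    ultimately show "emeasure ?M (shift -` A \<inter> space ?M) = emeasure ?M A"
      using M(1)[OF TA] M(1)[OF A] sp by simp
  qed
  ultimately show ?thesis by (simp add: shift_ergodic_measures_def borel_measure_on_def)
qed

text \<open>\<open>Q\<close> and \<open>R\<close> stand for the chosen class of measures on either
  side. Being a probability or non-atomic makes the exceptional sets null; being nonzero settles the
  case without good paths; the last two assumptions carry the class across.\<close>

lemma correspondence:
  assumes Q: "\<And>M. Q M \<Longrightarrow> prob_space M \<or> nonatomic M" "\<And>M. Q M \<Longrightarrow> emeasure M (space M) \<noteq> 0"
    and R: "\<And>N. R N \<Longrightarrow> prob_space N \<or> nonatomic N" "\<And>N. R N \<Longrightarrow> emeasure N (space N) \<noteq> 0"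
    and QR: "\<And>M. mod_null_iso M SX SY X0 Y0 F G0 \<Longrightarrow> Q M \<Longrightarrow> R (distr M SY F)"
    and RQ: "\<And>N. mod_null_iso N SY SX Y0 X0 G0 F \<Longrightarrow> R N \<Longrightarrow> Q (distr N SX G0)"
  shows "\<exists>\<Phi>. bij_betw \<Phi> {M \<in> shift_ergodic_measures \<sigma>. Q M} {N \<in> tail_ergodic_measures B. R N}"
proof -
  have X: "sets M = sets SX" "conull M X0" if "M \<in> shift_ergodic_measures \<sigma>" "Q M" for M
    using that conull_X0[of M] Q(1) by (auto simp: shift_ergodic_measures_def borel_measure_on_def)
  have Y: "sets N = sets SY" "conull N Y0" if "N \<in> tail_ergodic_measures B" "R N" for N
    using that conull_Y0[of N] R(1) by (auto simp: tail_ergodic_measures_def borel_measure_on_def)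
  show ?thesis
  proof (cases "\<exists>q. good q")
    case True
    have "bij_betw (\<lambda>M. distr M SY F) {M \<in> shift_ergodic_measures \<sigma>. Q M}
        {N \<in> tail_ergodic_measures B. R N}"
    proof (rule bij_betw_byWitness[where f' = "\<lambda>N. distr N SX G0"])
      show "\<forall>M\<in>{M \<in> shift_ergodic_measures \<sigma>. Q M}. distr (distr M SY F) SX G0 = M"
        using mod_null_iso.distr_image[OF mod_null_iso_F[OF X True]] by blast
      show "\<forall>N\<in>{N \<in> tail_ergodic_measures B. R N}. distr (distr N SX G0) SY F = N"
        using mod_null_iso.distr_image[OF mod_null_iso_G0[OF Y True]] by blast
      show "(\<lambda>M. distr M SY F) ` {M \<in> shift_ergodic_measures \<sigma>. Q M} \<subseteq> {N \<in> tail_ergodic_measures B. R N}"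
        using pushed_in_tail_ergodic_measures[OF _ X(2) True] QR[OF mod_null_iso_F[OF X True]] by auto
      show "(\<lambda>N. distr N SX G0) ` {N \<in> tail_ergodic_measures B. R N} \<subseteq> {M \<in> shift_ergodic_measures \<sigma>. Q M}"
        using pushed_in_shift_ergodic_measures[OF _ Y(2) True] RQ[OF mod_null_iso_G0[OF Y True]] by auto
    qed
    then show ?thesis by blast
  next
    \<comment> \<open>\<open>G0\<close> needs a good path as default value. Without one,
      \<open>X0\<close> and \<open>Y0\<close> are empty and yet conull, so both sets of nonzero
      measures are empty.\<close>
    case False
    then have "X0 = {}" "Y0 = {}" by (auto simp: X0_def Y0_def)
    then have e: "{M \<in> shift_ergodic_measures \<sigma>. Q M} = {}" "{N \<in> tail_ergodic_measures B. R N} = {}"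
      using X(2) Q(2) Y(2) R(2) by (auto simp: conull_def)
    show ?thesis unfolding e by (simp add: bij_betw_def)
  qed
qed

lemma infinite_measure_nonzero: "infinite_sigma_finite M \<Longrightarrow> emeasure M (space M) \<noteq> 0"
  by (simp add: infinite_sigma_finite_def)

lemma prob_measure_nonzero: "prob_space M \<Longrightarrow> emeasure M (space M) \<noteq> 0"
  by (simp add: prob_space.emeasure_space_1)

lemma prob_correspondence:
  "\<exists>\<Phi>. bij_betw \<Phi> {M \<in> shift_ergodic_measures \<sigma>. prob_space M}
     {N \<in> tail_ergodic_measures B. prob_space N}"
  by (rule correspondence)
    (auto simp: prob_measure_nonzero intro!: prob_space.prob_space_distr mod_null_iso.F_measM)

lemma infinite_correspondence:
  "\<exists>\<Phi>. bij_betw \<Phi> {M \<in> shift_ergodic_measures \<sigma>. nonatomic M \<and> infinite_sigma_finite M}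
     {N \<in> tail_ergodic_measures B. nonatomic N \<and> infinite_sigma_finite N}"
  by (rule correspondence)
    (auto simp: infinite_measure_nonzero mod_null_iso.nonatomic_image mod_null_iso.infinite_sigma_finite_image)

end

theorem theorem5p4:
  fixes \<sigma> :: "'a :: finite \<Rightarrow> 'a list"
  assumes "substitution \<sigma>"
    and "aperiodic \<sigma>"
    and "\<And>a. filterlim (\<lambda>n. length (subst_power \<sigma> n a)) at_top sequentially"
  shows "(\<exists>\<Phi>. bij_betw \<Phi>
            {M \<in> shift_ergodic_measures \<sigma>. prob_space M}
            {M \<in> tail_ergodic_measures (subst_diagram \<sigma>). prob_space M}) \<and>
         (\<exists>\<Phi>. bij_betw \<Phi>
            {M \<in> shift_ergodic_measures \<sigma>. nonatomic M \<and> infinite_sigma_finite M}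
            {M \<in> tail_ergodic_measures (subst_diagram \<sigma>). nonatomic M \<and> infinite_sigma_finite M})"
proof -
  interpret aperiodic_substitution \<sigma> by (rule aperiodic_substitution.intro) fact+
  show ?thesis using prob_correspondence infinite_correspondence by blast
qed

end
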